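(* Let $F$, $H$, $m_0$ satisfy the standing assumptions stated in the context, with constants $C_o\ge 1$, $L>0$. There exist $\lambda_0\ge1$ depending only on $n,C_o,L$ and $\overline C>0$ depending only on $C_o,L$ such that, for every $\lambda\ge\lambda_0$ and every solution $(u_\lambda,m_\lambda)$ of $({\rm MFG}_\lambda)$, $$\sup_{(x,t)\in\mathbb{R}^n\times[0,\infty)}\left|\lambda Du_\lambda(x,t)-D_xF(x,m_\lambda(t))\right|\le\frac{\overline C}{\sqrt\lambda}(L+1).$$ In particular, $\lambda Du_\lambda-D_xF(\cdot,m_\lambda(\cdot))$ converges uniformly to $0$ on $\mathbb{R}^n\times[0,+\infty)$ as $\lambda\to\infty$.
   Context: Fix $n\ge1$ and $\alpha\in(0,1)$. $\mathcal{P}_1(\mathbb{R}^n)$ is the set of Borel probability measures on $\mathbb{R}^n$ with finite first moment and $d_1$ is the $1$-Wasserstein distance. For functions on $\mathbb{R}^n\times[0,\infty)$, $\|u\|_\infty=\sup_{(x,t)}|u(x,t)|$. $D=D_x$ is the gradient in $x$. Standing assumptions: $m_0\in\mathcal{P}_1(\mathbb{R}^n)$, $F:\mathbb{R}^n\times\mathcal{P}_1(\mathbb{R}^n)\to\mathbb{R}$, $H=H(p,x):\mathbb{R}^n\times\mathbb{R}^n\to\mathbb{R}$, and there are constants $C_o\ge1$, $L>0$ such that: - $F(\cdot,m)$ is of class $C^{2,\alpha}$ for all $m$, and $|F(x,m)|\le C_o(1+|x|)$ for all $(x,m)$. - For all $x,y\in\mathbb{R}^n$, $m,\tilde m\in\mathcal{P}_1(\mathbb{R}^n)$: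 $|F(x,m)-F(y,\tilde m)|\le L(|x-y|+d_1(m,\tilde m))$ and $|D_xF(x,m)-D_xF(y,\tilde m)|\le L(|x-y|+d_1(m,\tilde m))$. - $H$ is of class $C^{2,\alpha}$ and convex in its first variable $p$. - For all $p,x$: $-C_o\le H(p,x)\le C_o(1+|p|^2)$; $C_o^{-1}I_d\le D^2_{pp}H(p,x)\le C_oI_d$; $|D_xH(p,x)|+|D^2_{px}H(p,x)|\le C_o(1+|p|)$; $|D^2_{xx}H(p,x)|\le C_o$. For $\lambda>0$, the system $({\rm MFG}_\lambda)$ for $(u_\lambda,m_\lambda)$ is $$\begin{cases}-\partial_tu_\lambda-\Delta u_\lambda+\frac1\lambda H(\lambda Du_\lambda,x)+\lambda u_\lambda=F(x,m_\lambda(t)), & x\in\mathbb{R}^n,\ t\in(0,\infty),\\ \partial_tm_\lambda-\Delta m_\lambda-\mathrm{div}(m_\lambda D_pH(\lambda Du_\lambda,x))=0,& x\in\mathbb{R}^n,\ t\in(0,\infty),\\ m_\lambda(x,0)=m_0(x),& x\in\mathbb{R}^n.\end{cases}$$ Convention: a solution of $({\rm MFG}_\lambda)$ always means a classical solution satisfying $$\inf_{\mathbb{R}^n\times[0,\infty)}u_\lambda>-\infty,\quad\sup_{(x,t)}\frac{u_\lambda(x,t)}{1+|x|}<\infty,\quad\|Du_\lambda\|_\infty<\infty,\quad\|D^2u_\lambda\|_\infty\le1.$$ Here classical solution means: $u_\lambda$ is $C^{2}$ in $x$ and $C^1$ in $t$ on $\mathbb{R}^n\times[0,\infty)$ and satisfies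 its equation pointwise; $t\mapsto m_\lambda(t)\in\mathcal{P}_1(\mathbb{R}^n)$ is $d_1$-continuous on $[0,\infty)$ with $m_\lambda(0)=m_0$, and for $t>0$ it is identified with a density solving the second equation.
   Formalization: The constant C̄ is allowed to depend on the fixed dimension n as well as on C_o and L; a C̄ independent of n is impossible (H=|p|²/2, F=Σf(x_i) with f' a smoothing of |s| near 0 gives an error of order √n/√λ). *)

theory Defs
  imports "HOL-Probability.Probability"
begin

section \<open>Differential operators\<close>

definition grad :: "('a::euclidean_space \<Rightarrow> real) \<Rightarrow> 'a \<Rightarrow> 'a" where
  "grad f x = (\<Sum>b\<in>Basis. frechet_derivative f (at x) b *\<^sub>R b)"

definition deriv_op :: "('a::euclidean_space \<Rightarrow> 'b::euclidean_space) \<Rightarrow> 'a \<Rightarrow> 'a \<Rightarrow>\<^sub>L 'b" where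
  "deriv_op V x = Blinfun (frechet_derivative V (at x))"

text \<open>The norm of a Hessian is the operator norm, the weakest of the usual choices; second-order
  bounds occur below only as hypotheses.\<close>

definition hess :: "('a::euclidean_space \<Rightarrow> real) \<Rightarrow> 'a \<Rightarrow> 'a \<Rightarrow>\<^sub>L 'a" where
  "hess f = deriv_op (grad f)"

definition divergence :: "('a::euclidean_space \<Rightarrow> 'a) \<Rightarrow> 'a \<Rightarrow> real" where
  "divergence V x = (\<Sum>b\<in>Basis. frechet_derivative V (at x) b \<bullet> b)"

definition laplacian :: "('a::euclidean_space \<Rightarrow> real) \<Rightarrow> 'a \<Rightarrow> real" where
  "laplacian f = divergence (grad f)"

text \<open>One-sided at \<open>t = 0\<close>, the ordinary derivative for \<open>t > 0\<close>.\<close>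

definition time_deriv :: "('a \<Rightarrow> real \<Rightarrow> real) \<Rightarrow> 'a \<Rightarrow> real \<Rightarrow> real" where
  "time_deriv f x t = vector_derivative (f x) (at t within {0..})"

section \<open>Regularity classes and norms\<close>

text \<open>Since the Hamiltonian grows quadratically, the Hoelder condition on second derivatives
  is imposed on compact sets.\<close>

definition C2_holder :: "real \<Rightarrow> ('a::euclidean_space \<Rightarrow> real) \<Rightarrow> bool" where
  "C2_holder \<alpha> f \<longleftrightarrow>
     (\<forall>x. f differentiable (at x)) \<and> (\<forall>x. grad f differentiable (at x)) \<and>
     (\<forall>K. compact K \<longrightarrow>
        (\<exists>C. \<forall>x\<in>K. \<forall>y\<in>K. norm (hess f x - hess f y) \<le> C * dist x y powr \<alpha>))"

text \<open>\<open>C\<^sup>2\<close> in space and \<open>C\<^sup>1\<close> in time for \<open>t \<in> T\<close> (where \<open>T \<subseteq> {0..}\<close>), all derivatives being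
  jointly continuous.\<close>

definition C21_on :: "real set \<Rightarrow> ('a::euclidean_space \<Rightarrow> real \<Rightarrow> real) \<Rightarrow> bool" where
  "C21_on T f \<longleftrightarrow>
     (\<forall>x. \<forall>t\<in>T. (\<lambda>y. f y t) differentiable (at x) \<and>
                grad (\<lambda>y. f y t) differentiable (at x) \<and>
                f x differentiable (at t within {0..})) \<and>
     continuous_on (UNIV \<times> T) (\<lambda>(x, t). f x t) \<and>
     continuous_on (UNIV \<times> T) (\<lambda>(x, t). grad (\<lambda>y. f y t) x) \<and>
     continuous_on (UNIV \<times> T) (\<lambda>(x, t). hess (\<lambda>y. f y t) x) \<and>
     continuous_on (UNIV \<times> T) (\<lambda>(x, t). time_deriv f x t)"

definition sup_norm :: "('a \<Rightarrow> real \<Rightarrow> 'b::real_normed_vector) \<Rightarrow> ereal" where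
  "sup_norm f = (SUP (x, t)\<in>UNIV \<times> {0..}. ereal (norm (f x t)))"

section \<open>Probability measures with finite first moment\<close>

definition P1 :: "'a::euclidean_space measure set" where
  "P1 = {\<mu>. prob_space \<mu> \<and> sets \<mu> = sets borel \<and> integrable \<mu> norm}"

definition couplings ::
  "'a::euclidean_space measure \<Rightarrow> 'a measure \<Rightarrow> ('a \<times> 'a) measure set" where
  "couplings \<mu> \<nu> =
     {\<gamma>. prob_space \<gamma> \<and> sets \<gamma> = sets borel \<and> distr \<gamma> borel fst = \<mu> \<and> distr \<gamma> borel snd = \<nu>}"

text \<open>The 1-Wasserstein distance; the infimum is finite on @.\<close>
definition d1 :: "'a::euclidean_space measure \<Rightarrow> 'a measure \<Rightarrow> real" where
  "d1 \<mu> \<nu> = enn2real (INF \<gamma>\<in>couplings \<mu> \<nu>. \<integral>\<^sup>+ (x, y). ennreal (dist x y) \<partial>\<gamma>)"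

section \<open>The mean field game system\<close>

definition coupling_assms ::
  "real \<Rightarrow> real \<Rightarrow> real \<Rightarrow> (real^'n \<Rightarrow> (real^'n) measure \<Rightarrow> real) \<Rightarrow> bool" where
  "coupling_assms \<alpha> Co L F \<longleftrightarrow>
     (\<forall>m\<in>P1. C2_holder \<alpha> (\<lambda>x. F x m)) \<and>
     (\<forall>x. \<forall>m\<in>P1. \<bar>F x m\<bar> \<le> Co * (1 + norm x)) \<and>
     (\<forall>x y. \<forall>m\<in>P1. \<forall>m'\<in>P1. \<bar>F x m - F y m'\<bar> \<le> L * (norm (x - y) + d1 m m')) \<and>
     (\<forall>x y. \<forall>m\<in>P1. \<forall>m'\<in>P1.
        norm (grad (\<lambda>z. F z m) x - grad (\<lambda>z. F z m') y) \<le> L * (norm (x - y) + d1 m m'))"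

definition hamiltonian_assms ::
  "real \<Rightarrow> real \<Rightarrow> (real^'n \<Rightarrow> real^'n \<Rightarrow> real) \<Rightarrow> bool" where
  "hamiltonian_assms \<alpha> Co H \<longleftrightarrow>
     C2_holder \<alpha> (\<lambda>(p, x). H p x) \<and>
     (\<forall>x. convex_on UNIV (\<lambda>p. H p x)) \<and>
     (\<forall>p x. - Co \<le> H p x \<and> H p x \<le> Co * (1 + (norm p)\<^sup>2)) \<and>
     (\<forall>p x \<xi>. inverse Co * (norm \<xi>)\<^sup>2 \<le> blinfun_apply (hess (\<lambda>q. H q x) p) \<xi> \<bullet> \<xi> \<and>
              blinfun_apply (hess (\<lambda>q. H q x) p) \<xi> \<bullet> \<xi> \<le> Co * (norm \<xi>)\<^sup>2) \<and>
     (\<forall>p x. norm (grad (H p) x) + norm (deriv_op (\<lambda>y. grad (\<lambda>q. H q y) p) x)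
              \<le> Co * (1 + norm p)) \<and>
     (\<forall>p x. norm (hess (H p) x) \<le> Co)"

definition standing_assms ::
  "real \<Rightarrow> real \<Rightarrow> real \<Rightarrow> (real^'n \<Rightarrow> (real^'n) measure \<Rightarrow> real) \<Rightarrow>
   (real^'n \<Rightarrow> real^'n \<Rightarrow> real) \<Rightarrow> (real^'n) measure \<Rightarrow> bool" where
  "standing_assms \<alpha> Co L F H m0 \<longleftrightarrow>
     m0 \<in> P1 \<and> coupling_assms \<alpha> Co L F \<and> hamiltonian_assms \<alpha> Co H"

definition HJB_solution ::
  "real \<Rightarrow> (real^'n \<Rightarrow> (real^'n) measure \<Rightarrow> real) \<Rightarrow> (real^'n \<Rightarrow> real^'n \<Rightarrow> real) \<Rightarrow>
   (real^'n \<Rightarrow> real \<Rightarrow> real) \<Rightarrow> (real \<Rightarrow> (real^'n) measure) \<Rightarrow> bool" where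
  "HJB_solution lam F H u m \<longleftrightarrow>
     C21_on {0..} u \<and>
     (\<forall>x. \<forall>t>0. - time_deriv u x t - laplacian (\<lambda>y. u y t) x
        + 1 / lam * H (lam *\<^sub>R grad (\<lambda>y. u y t) x) x + lam * u x t = F x (m t))"

text \<open>The flow \<open>m\<close> is \<open>P1\<close>-valued and \<open>d1\<close>-continuous up to \<open>t = 0\<close>; for \<open>t > 0\<close> it has a density
  \<open>\<rho>\<close> which is a classical solution of the Fokker-Planck equation.\<close>

definition FP_solution ::
  "real \<Rightarrow> (real^'n \<Rightarrow> real^'n \<Rightarrow> real) \<Rightarrow> (real^'n) measure \<Rightarrow>
   (real^'n \<Rightarrow> real \<Rightarrow> real) \<Rightarrow> (real \<Rightarrow> (real^'n) measure) \<Rightarrow> bool" where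
  "FP_solution lam H m0 u m \<longleftrightarrow>
     (\<forall>t\<ge>0. m t \<in> P1) \<and> m 0 = m0 \<and>
     (\<forall>t\<ge>0. ((\<lambda>s. d1 (m s) (m t)) \<longlongrightarrow> 0) (at t within {0..})) \<and>
     (\<exists>\<rho>. C21_on {0<..} \<rho> \<and>
        (\<forall>t>0. (\<forall>x. 0 \<le> \<rho> x t) \<and> m t = density lborel (\<lambda>x. ennreal (\<rho> x t))) \<and>
        (\<forall>x. \<forall>t>0. time_deriv \<rho> x t - laplacian (\<lambda>y. \<rho> y t) x
           - divergence (\<lambda>y. \<rho> y t *\<^sub>R grad (\<lambda>p. H p y) (lam *\<^sub>R grad (\<lambda>z. u z t) y)) x = 0))"

definition MFG_solution ::
  "real \<Rightarrow> (real^'n \<Rightarrow> (real^'n) measure \<Rightarrow> real) \<Rightarrow> (real^'n \<Rightarrow> real^'n \<Rightarrow> real) \<Rightarrow>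
   (real^'n) measure \<Rightarrow> (real^'n \<Rightarrow> real \<Rightarrow> real) \<Rightarrow> (real \<Rightarrow> (real^'n) measure) \<Rightarrow> bool" where
  "MFG_solution lam F H m0 u m \<longleftrightarrow>
     HJB_solution lam F H u m \<and> FP_solution lam H m0 u m \<and>
     bdd_below ((\<lambda>(x, t). u x t) ` (UNIV \<times> {0..})) \<and>
     bdd_above ((\<lambda>(x, t). u x t / (1 + norm x)) ` (UNIV \<times> {0..})) \<and>
     sup_norm (\<lambda>x t. grad (\<lambda>y. u y t) x) < \<infinity> \<and>
     sup_norm (\<lambda>x t. hess (\<lambda>y. u y t) x) \<le> 1"

end

theory Submission
  imports Defs
begin

text \<open>
  Since \<open>m\<close> solves a Fokker-Planck equation with bounded drift, \<open>d1 (m t) (m s)\<close> is at most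
  \<open>(n / \<delta> + C) * (t - s) + 4 * \<delta>\<close> for every \<open>\<delta> > 0\<close>. By Kantorovich duality it is enough to test
  the equation with finite minima of cones; these are approximated by smooth 1-Lipschitz functions
  whose Laplacian is bounded above by \<open>n / \<delta>\<close>, and the one-sided bound suffices.

  The increment \<open>u (x + h) t - u x t\<close> solves a linear equation whose zeroth-order term is \<open>lam\<close> times
  the increment and whose right-hand side is the increment of \<open>F\<close> up to an error
  \<open>O(norm h / lam)\<close>. Comparing it with a barrier that is affine in time and a smoothed cone in space,
  at the scale \<open>\<delta> = 1 / sqrt lam\<close>, gives first a bound on \<open>lam * Du\<close> and then the convergence rate.
\<close>

section \<open>Kantorovich duality for the 1-Wasserstein distance\<close>

text \<open>The Hamilton-Jacobi equation cannot be differentiated in \<open>x\<close>, as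
  \<open>u\<close> is only \<open>C21_on\<close>; spatial increments replace derivatives, and the
  gradient bound is recovered by letting the step length tend to zero. The equation runs backward in
  time without a terminal condition, on an unbounded space, so a maximum has to be forced by a
  penalty growing both forward in time and in space. Its slopes are those of the bound for the
  increment of \<open>F\<close>, divided by \<open>lam\<close>: the term \<open>lam * u\<close> then
  cancels the growing part exactly, and what remains is of order \<open>1 / lam\<close>, plus the
  value of the soft cone at its tip.

  The quadratic growth of \<open>H\<close> makes every constant depend on a bound \<open>R\<close>
  for \<open>lam * Du\<close>, finite by the notion of solution but a priori not uniform. A run with
  vanishing penalty gives \<open>R \<le> L + Co * (1 + R) / lam\<close>, which is linear in
  \<open>R\<close> and closes for \<open>lam \<ge> 2 * Co\<close>. The resulting uniform drift bound
  controls the flow \<open>m\<close>; the Lipschitz bound on \<open>D_x F\<close> then shows that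
  the increment of \<open>F\<close> by \<open>h\<close> varies by at most \<open>L * norm h\<close>
  times the displacement of \<open>(x, m)\<close>, so that every error is proportional to
  \<open>norm h\<close>.\<close>

definition segment_closed :: "('s \<Rightarrow> real) set \<Rightarrow> bool" where
  "segment_closed X \<longleftrightarrow>
     (\<forall>w\<in>X. \<forall>v\<in>X. \<forall>r\<in>{0..1}. (\<lambda>s. (1 - r) * w s + r * v s) \<in> X)"

text \<open>The pairs (constraint, cost) of points of \<open>X\<close> fill a compact convex set in
  the plane; \<open>segment_closed\<close> is convexity for functions. If this set misses the
  half-line \<open>Q\<close> of admissible pairs, a line separates the two strictly, and its slope,
  when finite, is a multiplier for which \<open>ex\<close> fails.\<close>

lemma lagrange_one_constraint:
  fixes X :: "('s \<Rightarrow> real) set" and c l :: "('s \<Rightarrow> real) \<Rightarrow> real"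
  assumes X: "compact X" "segment_closed X"
    and cont: "continuous_on X c" "continuous_on X l"
    and aff: "\<And>w v r. c (\<lambda>s. (1 - r) * w s + r * v s) = (1 - r) * c w + r * c v"
      "\<And>w v r. l (\<lambda>s. (1 - r) * w s + r * v s) = (1 - r) * l w + r * l v"
    and ex: "\<And>g. \<exists>w\<in>X. c w + g * l w \<le> K"
  shows "\<exists>w\<in>X. l w = 0 \<and> c w \<le> K"
proof (rule ccontr)
  assume no: "\<not> ?thesis"
  define P where "P = (\<lambda>w. (l w, c w)) ` X"
  define Q where "Q = {0::real} \<times> {..K}"
  have P: "compact P" "P \<noteq> {}"
    unfolding P_def using ex X(1) by (auto intro!: compact_continuous_image continuous_intros cont)
  have "convex P"
    unfolding convex_alt
  proof (intro ballI allI impI)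
    fix x y r assume xy: "x \<in> P" "y \<in> P" and r: "0 \<le> r \<and> r \<le> (1::real)"
    then obtain w v where w: "w \<in> X" "v \<in> X" and "x = (l w, c w)" "y = (l v, c v)"
      by (auto simp: P_def)
    then have "(1 - r) *\<^sub>R x + r *\<^sub>R y
        = (l (\<lambda>s. (1 - r) * w s + r * v s), c (\<lambda>s. (1 - r) * w s + r * v s))"
      by (simp add: aff)
    moreover have "(\<lambda>s. (1 - r) * w s + r * v s) \<in> X"
      using X(2) w r by (auto simp: segment_closed_def)
    ultimately show "(1 - r) *\<^sub>R x + r *\<^sub>R y \<in> P" unfolding P_def by (rule image_eqI)
  qed
  moreover have "convex Q" "closed Q"
    unfolding Q_def by (auto intro!: convex_Times closed_Times)
  moreover have "P \<inter> Q = {}" using no by (auto simp: P_def Q_def)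
  ultimately obtain a \<beta> where a: "\<And>x. x \<in> P \<Longrightarrow> inner a x < \<beta>" "\<And>x. x \<in> Q \<Longrightarrow> inner a x > \<beta>"
    using separating_hyperplane_compact_closed[of P Q] P by metis
  obtain f s where fs: "a = (f, s)" by (cases a)
  have 1: "f * l w + s * c w < \<beta>" if "w \<in> X" for w
    using a(1)[of "(l w, c w)"] that by (auto simp: P_def fs inner_prod_def)
  have 2: "s * r > \<beta>" if "r \<le> K" for r
    using a(2)[of "(0, r)"] that by (auto simp: Q_def fs inner_prod_def)
  \<comment> \<open>\<open>Q\<close> is unbounded below in its second coordinate, which excludes a
    positive \<open>s\<close>.\<close>
  have "s \<le> 0"
  proof (rule ccontr)
    assume "\<not> s \<le> 0"
    then have "s * min K (\<beta> / s) \<le> \<beta>" by (simp add: min_def field_simps)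
    with 2[of "min K (\<beta> / s)"] show False by simp
  qed
  show False
  proof (cases "s = 0")
    case True
    with 2[of K] have b: "\<beta> < 0" by simp
    obtain B where B: "\<And>w. w \<in> X \<Longrightarrow> \<bar>c w\<bar> \<le> B"
      using compact_imp_bounded[OF compact_continuous_image[OF cont(1) X(1)]]
      by (auto simp: bounded_iff)
    \<comment> \<open>For a vertical line, \<open>f * l w < \<beta> < 0\<close> on all of
      \<open>X\<close>, so \<open>l\<close> stays away from zero; with this multiplier
      \<open>g * l w\<close> outweighs \<open>c\<close> and \<open>K\<close> together.\<close>
    define g where "g = (\<bar>K\<bar> + \<bar>B\<bar> + 1) * f / \<beta>"
    obtain w where w: "w \<in> X" "c w + g * l w \<le> K" using ex by blast
    have "f * l w / \<beta> > 1" using 1[OF w(1)] True b by (simp add: field_simps)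
    then have "(\<bar>K\<bar> + \<bar>B\<bar> + 1) * (f * l w / \<beta>) > \<bar>K\<bar> + \<bar>B\<bar> + 1"
      using mult_strict_left_mono[of 1 "f * l w / \<beta>" "\<bar>K\<bar> + \<bar>B\<bar> + 1"] by simp
    then have "g * l w > \<bar>K\<bar> + \<bar>B\<bar> + 1" by (simp add: g_def field_simps)
    with w(2) B[OF w(1)] show False by linarith
  next
    case False
    with \<open>s \<le> 0\<close> have s: "s < 0" by simp
    obtain w where w: "w \<in> X" "c w + f / s * l w \<le> K" using ex by blast
    have "f * l w + s * c w < s * K" using 1[OF w(1)] 2[of K] by simp
    then have "s * (c w + f / s * l w) < s * K" using s by (simp add: algebra_simps)
    with w(2) s show False by (smt (verit) mult_less_cancel_left_neg)
  qed
qed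

text \<open>Imposing the constraint \<open>i\<close> cuts \<open>X\<close> down to a compact convex
  \<open>Y\<close>. To see that \<open>Y\<close> inherits the hypothesis, the multipliers of the
  other constraints are frozen and absorbed into the cost \<open>c'\<close>, and only the multiplier
  of \<open>i\<close> varies.\<close>

lemma lagrange_finite_constraints:
  fixes X :: "('s \<Rightarrow> real) set" and c :: "'s \<Rightarrow> real" and l :: "'k \<Rightarrow> 's \<Rightarrow> real"
  assumes "finite I" "compact X" "segment_closed X"
    and "\<And>g. \<exists>w\<in>X. (\<Sum>s\<in>S. w s * (c s + (\<Sum>i\<in>I. g i * l i s))) \<le> K"
  shows "\<exists>w\<in>X. (\<forall>i\<in>I. (\<Sum>s\<in>S. w s * l i s) = 0) \<and> (\<Sum>s\<in>S. w s * c s) \<le> K"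
  using assms
proof (induction I arbitrary: X rule: finite_induct)
  case empty
  then show ?case by simp
next
  case (insert i I)
  have cont: "continuous_on A (\<lambda>w. \<Sum>s\<in>S. w s * d s)" for d :: "'s \<Rightarrow> real" and A
    by (intro continuous_intros continuous_on_subset[OF continuous_on_product_coordinates]) auto
  have aff: "(\<Sum>s\<in>S. ((1 - r) * w s + r * v s) * d s)
      = (1 - r) * (\<Sum>s\<in>S. w s * d s) + r * (\<Sum>s\<in>S. v s * d s)" for w v d :: "'s \<Rightarrow> real" and r
    by (simp add: sum_distrib_left algebra_simps flip: sum.distrib)
  define Y where "Y = {w\<in>X. (\<Sum>s\<in>S. w s * l i s) = 0}"
  have "Y = X \<inter> {w. (\<Sum>s\<in>S. w s * l i s) = 0}" by (auto simp: Y_def)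
  moreover have "closed {w. (\<Sum>s\<in>S. w s * l i s) = 0}"
    by (rule closed_Collect_eq[OF cont]) simp
  ultimately have Yc: "compact Y" using insert.prems(1) by (simp add: compact_Int_closed)
  have Ys: "segment_closed Y"
    using insert.prems(2) by (auto simp: segment_closed_def Y_def aff)
  have "\<exists>w\<in>Y. (\<Sum>s\<in>S. w s * (c s + (\<Sum>j\<in>I. g j * l j s))) \<le> K" for g
  proof -
    define c' where "c' s = c s + (\<Sum>j\<in>I. g j * l j s)" for s
    have "\<exists>w\<in>X. (\<Sum>s\<in>S. w s * l i s) = 0 \<and> (\<Sum>s\<in>S. w s * c' s) \<le> K"
    proof (rule lagrange_one_constraint[OF insert.prems(1,2) cont cont aff aff])
      fix h
      obtain w where w: "w \<in> X"
        "(\<Sum>s\<in>S. w s * (c s + (\<Sum>j\<in>insert i I. (g(i := h)) j * l j s))) \<le> K"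
        using insert.prems(3)[of "g(i := h)"] by auto
      have "c s + (\<Sum>j\<in>insert i I. (g(i := h)) j * l j s) = c' s + h * l i s" for s
        using insert.hyps by (auto intro!: sum.cong simp: c'_def)
      with w(2) have "(\<Sum>s\<in>S. w s * (c' s + h * l i s)) \<le> K" by simp
      then have "(\<Sum>s\<in>S. w s * c' s) + h * (\<Sum>s\<in>S. w s * l i s) \<le> K"
        by (simp add: sum_distrib_left distrib_left sum.distrib mult.left_commute)
      with w(1) show "\<exists>w\<in>X. (\<Sum>s\<in>S. w s * c' s) + h * (\<Sum>s\<in>S. w s * l i s) \<le> K" by blast
    qed
    then show ?thesis by (auto simp: Y_def c'_def)
  qed
  from insert.IH[OF Yc Ys this] show ?case by (auto simp: Y_def)
qed

text \<open>Vanishing off \<open>S\<close> keeps the simplex compact in the product topology on all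
  functions, however large the index type is.\<close>

definition prob_weights :: "'s set \<Rightarrow> ('s \<Rightarrow> real) set" where
  "prob_weights S = {w. (\<forall>s. 0 \<le> w s) \<and> (\<forall>s. s \<notin> S \<longrightarrow> w s = 0) \<and> sum w S = 1}"

lemma compact_prob_weights:
  assumes "finite S"
  shows "compact (prob_weights S)"
proof -
  define B where "B = (\<Pi>\<^sub>E s\<in>UNIV. if s \<in> S then {0..1} else {0::real})"
  have "compact B"
    using compactin_PiE[of "\<lambda>_. euclideanreal" UNIV "\<lambda>s. if s \<in> S then {0..1} else {0}"]
    by (auto simp: B_def euclidean_product_topology)
  moreover have "closed {w :: 'a \<Rightarrow> real. sum w S = 1}"
    by (intro closed_Collect_eq continuous_on_sum continuous_on_product_coordinates) simp
  ultimately have "compact (B \<inter> {w. sum w S = 1})" by (simp add: compact_Int_closed)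
  moreover have "prob_weights S = B \<inter> {w. sum w S = 1}"
  proof (intro equalityI subsetI)
    fix w assume w: "w \<in> prob_weights S"
    then have "w s \<le> 1" if "s \<in> S" for s
      using member_le_sum[of s S w] that assms by (auto simp: prob_weights_def)
    with w show "w \<in> B \<inter> {w. sum w S = 1}" by (auto simp: prob_weights_def B_def)
  next
    fix w assume "w \<in> B \<inter> {w. sum w S = 1}"
    then have "w s \<in> (if s \<in> S then {0..1} else {0})" "sum w S = 1" for s
      by (auto simp: B_def PiE_iff)
    then show "w \<in> prob_weights S"
      unfolding prob_weights_def
      by (auto split: if_splits) (metis atLeastAtMost_iff empty_iff insert_iff order_refl)+
  qed
  ultimately show ?thesis by simp
qed

lemma segment_closed_prob_weights: "segment_closed (prob_weights S)"
  by (auto simp: segment_closed_def prob_weights_def sum.distrib simp flip: sum_distrib_left)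

text \<open>A plan is a point of the simplex over \<open>J \<times> J\<close>, its marginals are
  linear constraints, and the multipliers are the Kantorovich potentials. For fixed multipliers the
  Lagrangian is minimised at a vertex, so a single pair \<open>(i, j)\<close> has to be found.
  Replacing the first potential by the transform of the second explains why \<open>dual\<close>
  involves \<open>g\<close> alone.\<close>

lemma discrete_kantorovich_duality:
  fixes \<mu> \<nu> :: "'i \<Rightarrow> real" and c :: "'i \<Rightarrow> 'i \<Rightarrow> real"
  assumes J: "finite J" "J \<noteq> {}"
    and \<mu>: "\<And>i. 0 \<le> \<mu> i" "sum \<mu> J = 1" and \<nu>: "\<And>i. 0 \<le> \<nu> i" "sum \<nu> J = 1"
    and dual: "\<And>g. (\<Sum>i\<in>J. \<mu> i * Min ((\<lambda>j. c i j - g j) ` J)) + (\<Sum>j\<in>J. \<nu> j * g j) \<le> K"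
  shows "\<exists>\<gamma>. (\<forall>i j. 0 \<le> \<gamma> i j) \<and> (\<forall>i\<in>J. (\<Sum>j\<in>J. \<gamma> i j) = \<mu> i) \<and>
    (\<forall>j\<in>J. (\<Sum>i\<in>J. \<gamma> i j) = \<nu> j) \<and> (\<Sum>i\<in>J. \<Sum>j\<in>J. \<gamma> i j * c i j) \<le> K"
proof -
  define S where "S = J \<times> J"
  have S: "finite S" "S \<noteq> {}" using J by (auto simp: S_def)
  define X where "X = prob_weights S"
  \<comment> \<open>The weights have total mass one, so subtracting \<open>\<mu> a\<close> or
    \<open>\<nu> b\<close> turns a marginal condition into the vanishing of a linear
    functional.\<close>
  define l :: "'i + 'i \<Rightarrow> 'i \<times> 'i \<Rightarrow> real" where
    "l k = (\<lambda>(i, j). case k of Inl a \<Rightarrow> of_bool (i = a) - \<mu> a | Inr b \<Rightarrow> of_bool (j = b) - \<nu> b)" for k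
  have "\<exists>w\<in>X. (\<Sum>s\<in>S. w s * (case_prod c s + (\<Sum>k\<in>J <+> J. g k * l k s))) \<le> K" for g
  proof -
    define f1 where "f1 a = g (Inl a)" for a
    define g1 where "g1 b = g (Inr b)" for b
    have sl: "(\<Sum>k\<in>J <+> J. g k * l k (i, j))
        = f1 i + g1 j - (\<Sum>a\<in>J. f1 a * \<mu> a) - (\<Sum>b\<in>J. g1 b * \<nu> b)" if "i \<in> J" "j \<in> J" for i j
    proof -
      have "(\<Sum>a\<in>J. h a * of_bool (i = a)) = h i" if "i \<in> J" for h :: "'i \<Rightarrow> real" and i
        using J(1) that by (subst sum.remove[OF _ that]) (auto intro!: sum.neutral)
      then show ?thesis
        using J(1) that
        by (simp add: sum.Plus l_def f1_def g1_def right_diff_distrib sum_subtractf)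
    qed
    \<comment> \<open>\<open>mn\<close> is the transform of \<open>- g1\<close>: the largest first
      potential whose sum with \<open>- g1\<close> stays below the cost.\<close>
    define mn where "mn i = Min ((\<lambda>j. c i j + g1 j) ` J)" for i
    have "(\<Sum>i\<in>J. \<mu> i * mn i) - (\<Sum>j\<in>J. \<nu> j * g1 j) \<le> K"
      using dual[of "\<lambda>j. - g1 j"] by (simp add: mn_def sum_negf)
    \<comment> \<open>the average of \<open>mn i + f1 i\<close> bounds its minimum\<close>
    have "\<exists>i\<in>J. mn i + f1 i \<le> (\<Sum>i\<in>J. \<mu> i * (mn i + f1 i))"
    proof (rule ccontr)
      assume "\<not> ?thesis"
      then have less: "\<And>i. i \<in> J \<Longrightarrow> (\<Sum>i\<in>J. \<mu> i * (mn i + f1 i)) < mn i + f1 i" by force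
      obtain i0 where i0: "i0 \<in> J" "\<mu> i0 > 0"
        using \<mu> by (metis less_eq_real_def sum.neutral zero_neq_one)
      have "(\<Sum>i\<in>J. \<mu> i * (\<Sum>i\<in>J. \<mu> i * (mn i + f1 i))) < (\<Sum>i\<in>J. \<mu> i * (mn i + f1 i))"
      proof (rule sum_strict_mono_ex1[OF J(1)])
        show "\<forall>a\<in>J. \<mu> a * (\<Sum>i\<in>J. \<mu> i * (mn i + f1 i)) \<le> \<mu> a * (mn a + f1 a)"
          using less \<mu>(1) by (blast intro: mult_left_mono less_imp_le)
        show "\<exists>a\<in>J. \<mu> a * (\<Sum>i\<in>J. \<mu> i * (mn i + f1 i)) < \<mu> a * (mn a + f1 a)"
          using less[OF i0(1)] i0 by (blast intro: mult_strict_left_mono)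
      qed
      then show False using \<mu>(2) by (simp flip: sum_distrib_right)
    qed
    then obtain i where i: "i \<in> J" "mn i + f1 i \<le> (\<Sum>i\<in>J. \<mu> i * (mn i + f1 i))" by blast
    have "mn i \<in> (\<lambda>j. c i j + g1 j) ` J"
      unfolding mn_def using J by (intro Min_in) auto
    then obtain j where j: "j \<in> J" "mn i = c i j + g1 j" by blast
    \<comment> \<open>The vertex of the simplex that carries all mass at
      \<open>(i, j)\<close>.\<close>
    define w where "w s = (of_bool (s = (i, j)) :: real)" for s :: "'i \<times> 'i"
    have "w \<in> X" using i j S by (auto simp: X_def prob_weights_def w_def S_def)
    moreover have "(\<Sum>s\<in>S. w s * (case_prod c s + (\<Sum>k\<in>J <+> J. g k * l k s)))
        = c i j + (\<Sum>k\<in>J <+> J. g k * l k (i, j))"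
      using S i j by (subst sum.remove[of S "(i, j)"]) (auto simp: S_def w_def)
    moreover have "c i j + (\<Sum>k\<in>J <+> J. g k * l k (i, j)) \<le> K"
      using i j sl[of i j] \<open>(\<Sum>i\<in>J. \<mu> i * mn i) - (\<Sum>j\<in>J. \<nu> j * g1 j) \<le> K\<close>
      by (simp add: distrib_left sum.distrib mult.commute)
    ultimately show ?thesis by (intro bexI[of _ w]) simp_all
  qed
  from lagrange_finite_constraints[OF _ _ _ this] obtain w where
    w: "w \<in> X" "\<And>k. k \<in> J <+> J \<Longrightarrow> (\<Sum>s\<in>S. w s * l k s) = 0" "(\<Sum>s\<in>S. w s * case_prod c s) \<le> K"
    using J(1) S(1) compact_prob_weights segment_closed_prob_weights unfolding X_def
    by (metis finite_Plus)
  have w1: "(\<Sum>i\<in>J. \<Sum>j\<in>J. w (i, j)) = 1" and w0: "\<And>s. 0 \<le> w s"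
    using w(1) by (auto simp: X_def prob_weights_def S_def sum.cartesian_product)
  have "(\<Sum>j\<in>J. w (a, j)) = \<mu> a" if a: "a \<in> J" for a
  proof -
    have "0 = (\<Sum>i\<in>J. \<Sum>j\<in>J. w (i, j) * (of_bool (i = a) - \<mu> a))"
      using w(2)[OF InlI[OF a]] by (simp add: S_def sum.cartesian_product l_def split_def)
    also have "\<dots> = (\<Sum>i\<in>J. \<Sum>j\<in>J. w (i, j) * of_bool (i = a)) - (\<Sum>i\<in>J. \<Sum>j\<in>J. w (i, j)) * \<mu> a"
      by (simp add: right_diff_distrib sum_subtractf sum_distrib_right)
    also have "(\<Sum>i\<in>J. \<Sum>j\<in>J. w (i, j) * of_bool (i = a)) = (\<Sum>j\<in>J. w (a, j))"
      using a J(1) by (simp add: sum.remove[of J a] flip: sum_distrib_right)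
    finally show ?thesis using w1 by simp
  qed
  moreover have "(\<Sum>i\<in>J. w (i, b)) = \<nu> b" if b: "b \<in> J" for b
  proof -
    have "0 = (\<Sum>i\<in>J. \<Sum>j\<in>J. w (i, j) * (of_bool (j = b) - \<nu> b))"
      using w(2)[OF InrI[OF b]] by (simp add: S_def sum.cartesian_product l_def split_def)
    also have "\<dots> = (\<Sum>i\<in>J. \<Sum>j\<in>J. w (i, j) * of_bool (j = b)) - (\<Sum>i\<in>J. \<Sum>j\<in>J. w (i, j)) * \<nu> b"
      by (simp add: right_diff_distrib sum_subtractf sum_distrib_right)
    also have "(\<Sum>i\<in>J. \<Sum>j\<in>J. w (i, j) * of_bool (j = b)) = (\<Sum>i\<in>J. w (i, b))"
      using b J(1) by (intro sum.cong) (simp_all add: sum.remove[of J b])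
    finally show ?thesis using w1 by simp
  qed
  moreover have "(\<Sum>i\<in>J. \<Sum>j\<in>J. w (i, j) * c i j) \<le> K"
    using w(3) by (simp add: S_def sum.cartesian_product split_def)
  ultimately show ?thesis using w0 by (intro exI[of _ "\<lambda>i j. w (i, j)"]) auto
qed

section \<open>From finite transport problems to Borel measures\<close>

lemma nn_integral_finite_range:
  fixes a :: "'a::euclidean_space \<Rightarrow> 'b::euclidean_space" and h :: "'b \<Rightarrow> real"
  assumes "prob_space \<nu>" and s[measurable_cong]: "sets \<nu> = sets borel" and [measurable]: "a \<in> borel_measurable borel"
    and J: "finite J" "\<And>x. a x \<in> J" and h: "\<And>q. 0 \<le> h q"
  shows "(\<integral>\<^sup>+ y. ennreal (h (a y)) \<partial>\<nu>) = ennreal (\<Sum>q\<in>J. h q * measure \<nu> (a -` {q}))"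
proof -
  interpret prob_space \<nu> by fact
  have m[measurable]: "a -` {q} \<in> sets \<nu>" for q
    using measurable_sets[OF assms(3), of "{q}"] s by simp
  have "(\<integral>\<^sup>+ y. ennreal (h (a y)) \<partial>\<nu>) = (\<integral>\<^sup>+ y. (\<Sum>q\<in>J. ennreal (h q) * indicator (a -` {q}) y) \<partial>\<nu>)"
  proof (intro nn_integral_cong)
    fix y
    have "(\<Sum>q\<in>J. ennreal (h q) * indicator (a -` {q}) y) = ennreal (h (a y))"
      using J by (subst sum.remove[of _ "a y"]) (auto intro!: sum.neutral)
    then show "ennreal (h (a y)) = (\<Sum>q\<in>J. ennreal (h q) * indicator (a -` {q}) y)" by simp
  qed
  also have "\<dots> = (\<Sum>q\<in>J. ennreal (h q) * emeasure \<nu> (a -` {q}))"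
    by (subst nn_integral_sum) (auto simp: nn_integral_cmult_indicator)
  also have "\<dots> = ennreal (\<Sum>q\<in>J. h q * measure \<nu> (a -` {q}))"
    using h by (simp add: emeasure_eq_measure flip: ennreal_mult sum_ennreal)
  finally show ?thesis .
qed

lemma coupling_of_discrete_coupling:
  fixes \<mu> \<nu> :: "'a::euclidean_space measure" and a :: "'a \<Rightarrow> 'a" and \<gamma> :: "'a \<Rightarrow> 'a \<Rightarrow> real"
  assumes \<mu>: "prob_space \<mu>" "sets \<mu> = sets borel" and \<nu>: "prob_space \<nu>" "sets \<nu> = sets borel"
    and a[measurable]: "a \<in> borel_measurable borel" and J: "finite J" "\<And>x. a x \<in> J"
    and \<gamma>: "\<And>p q. 0 \<le> \<gamma> p q" "\<And>p. p \<in> J \<Longrightarrow> (\<Sum>q\<in>J. \<gamma> p q) = measure \<mu> (a -` {p})"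
      "\<And>q. q \<in> J \<Longrightarrow> (\<Sum>p\<in>J. \<gamma> p q) = measure \<nu> (a -` {q})"
  obtains \<Gamma> where "\<Gamma> \<in> couplings \<mu> \<nu>"
    "(\<integral>\<^sup>+ (x, y). ennreal (dist x y) \<partial>\<Gamma>) \<le> (\<integral>\<^sup>+ x. ennreal (dist x (a x)) \<partial>\<mu>)
       + ennreal (\<Sum>p\<in>J. \<Sum>q\<in>J. \<gamma> p q * dist p q) + (\<integral>\<^sup>+ y. ennreal (dist y (a y)) \<partial>\<nu>)"
proof -
  note [measurable_cong] = \<mu>(2) \<nu>(2)
  interpret M: prob_space \<mu> by fact
  interpret N: prob_space \<nu> by fact
  interpret P: pair_prob_space \<mu> \<nu> ..
  define m where "m p = measure \<mu> (a -` {p})" for p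
  define n where "n q = measure \<nu> (a -` {q})" for q
  \<comment> \<open>On a null cell the quotient is \<open>0\<close> because division by zero gives
    zero; \<open>\<gamma>\<close> vanishes there as well, so no mass is lost.\<close>
  define h where "h p q = \<gamma> p q / (m p * n q)" for p q
  have h0: "0 \<le> h p q" for p q using \<gamma>(1) by (auto simp: h_def m_def n_def)
  have zero: "\<gamma> p q = 0" if "p \<in> J" "q \<in> J" "m p = 0 \<or> n q = 0" for p q
    using that \<gamma> J(1) sum_nonneg_eq_0_iff[of J "\<gamma> p"] sum_nonneg_eq_0_iff[of J "\<lambda>p. \<gamma> p q"]
    unfolding m_def n_def by metis
  have hm: "h p q * n q * m p = \<gamma> p q" if "p \<in> J" "q \<in> J" for p q
    using zero[OF that] by (auto simp: h_def)
  have sm: "(\<Sum>q\<in>J. h p q * n q) = 1" if "p \<in> J" "m p \<noteq> 0" for p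
  proof -
    have "(\<Sum>q\<in>J. h p q * n q) * m p = m p"
      using that \<gamma>(2)[of p] hm by (simp add: sum_distrib_right m_def)
    with that show ?thesis by simp
  qed
  have sn: "(\<Sum>p\<in>J. h p q * m p) = 1" if "q \<in> J" "n q \<noteq> 0" for q
  proof -
    have "(\<Sum>p\<in>J. h p q * m p) * n q = (\<Sum>p\<in>J. \<gamma> p q)"
      unfolding sum_distrib_right
      by (intro sum.cong refl) (metis hm mult.commute mult.left_commute that(1))
    with that \<gamma>(3)[of q] show ?thesis by (simp add: n_def)
  qed
  \<comment> \<open>The normalisations \<open>sm\<close> and \<open>sn\<close> hold only on cells of
    positive measure, and almost every point lies in such a cell.\<close>
  have pos: "AE x in \<kappa>. measure \<kappa> (a -` {a x}) \<noteq> 0"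
    if k: "prob_space \<kappa>" and s: "sets \<kappa> = sets borel" for \<kappa> :: "'a measure"
  proof -
    interpret prob_space \<kappa> by fact
    have "AE x in \<kappa>. \<forall>p\<in>J. measure \<kappa> (a -` {p}) = 0 \<longrightarrow> a x \<noteq> p"
    proof (subst AE_finite_all[OF J(1)], intro ballI)
      fix p
      have "a -` {p} \<in> sets \<kappa>" using measurable_sets[OF a, of "{p}"] s by simp
      then show "AE x in \<kappa>. measure \<kappa> (a -` {p}) = 0 \<longrightarrow> a x \<noteq> p"
        by (cases "measure \<kappa> (a -` {p}) = 0") (auto intro!: AE_I[of _ _ "a -` {p}"] simp: emeasure_eq_measure)
    qed
    then show ?thesis using J(2) by (auto elim!: eventually_mono)
  qed
  \<comment> \<open>\<open>h\<close> is an arbitrary function of two points; measurability rests on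
    the finite range of \<open>a\<close>.\<close>
  have [measurable]: "(\<lambda>z. h (a (fst z)) (a (snd z))) \<in> borel_measurable (\<mu> \<Otimes>\<^sub>M \<nu>)"
  proof -
    have "h (a (fst z)) (a (snd z)) = (\<Sum>p\<in>J. \<Sum>q\<in>J. h p q * indicator {p} (a (fst z)) * indicator {q} (a (snd z)))" for z :: "'a \<times> 'a"
    proof -
      have pick: "(\<Sum>q\<in>J. G q * indicator {q} y) = G y" if "y \<in> J" for G :: "'a \<Rightarrow> real" and y
        using J(1) that by (subst sum.remove[of _ y]) (auto intro!: sum.neutral)
      have "(\<Sum>p\<in>J. \<Sum>q\<in>J. h p q * indicator {p} (a (fst z)) * indicator {q} (a (snd z)))
          = (\<Sum>p\<in>J. h p (a (snd z)) * indicator {p} (a (fst z)))"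
        by (intro sum.cong refl pick J)
      then show ?thesis by (simp add: pick J(2))
    qed
    then show ?thesis by simp
  qed
  have [measurable]: "(\<lambda>y. G (a y)) \<in> borel_measurable borel" for G :: "'a \<Rightarrow> real"
  proof -
    have "G (a y) = (\<Sum>q\<in>J. G q * indicator {q} (a y))" for y
      using J by (subst sum.remove[of _ "a y"]) (auto intro!: sum.neutral)
    then show ?thesis by simp
  qed
  have in1: "(\<integral>\<^sup>+ y. ennreal (h p (a y)) \<partial>\<nu>) = ennreal (\<Sum>q\<in>J. h p q * n q)" for p
    unfolding n_def by (rule nn_integral_finite_range[OF \<nu> a J]) (rule h0)
  have in2: "(\<integral>\<^sup>+ x. ennreal (h (a x) q) \<partial>\<mu>) = ennreal (\<Sum>p\<in>J. h p q * m p)" for q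
    unfolding m_def by (rule nn_integral_finite_range[OF \<mu> a J]) (rule h0)
  define \<Gamma> where "\<Gamma> = density (\<mu> \<Otimes>\<^sub>M \<nu>) (\<lambda>z. ennreal (h (a (fst z)) (a (snd z))))"
  have sets[measurable_cong]: "sets \<Gamma> = sets (borel \<Otimes>\<^sub>M borel)"
    by (simp add: \<Gamma>_def sets_pair_measure_cong[OF \<mu>(2) \<nu>(2)])
  have fst: "(\<integral>\<^sup>+ z. f (fst z) \<partial>\<Gamma>) = (\<integral>\<^sup>+ x. f x \<partial>\<mu>)"
    if [measurable]: "f \<in> borel_measurable borel" for f :: "'a \<Rightarrow> ennreal"
  proof -
    have "(\<integral>\<^sup>+ z. f (fst z) \<partial>\<Gamma>) = (\<integral>\<^sup>+ z. ennreal (h (a (fst z)) (a (snd z))) * f (fst z) \<partial>(\<mu> \<Otimes>\<^sub>M \<nu>))"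
      unfolding \<Gamma>_def by (subst nn_integral_density) auto
    also have "\<dots> = (\<integral>\<^sup>+ x. \<integral>\<^sup>+ y. ennreal (h (a x) (a y)) * f x \<partial>\<nu> \<partial>\<mu>)"
      by (subst N.nn_integral_fst[symmetric]) auto
    also have "\<dots> = (\<integral>\<^sup>+ x. ennreal (\<Sum>q\<in>J. h (a x) q * n q) * f x \<partial>\<mu>)"
      by (intro nn_integral_cong, subst nn_integral_multc) (auto simp: in1)
    also have "\<dots> = (\<integral>\<^sup>+ x. f x \<partial>\<mu>)"
      using pos[OF \<mu>] by (intro nn_integral_cong_AE) (auto elim!: eventually_mono simp: sm J(2) m_def)
    finally show ?thesis .
  qed
  have snd: "(\<integral>\<^sup>+ z. f (snd z) \<partial>\<Gamma>) = (\<integral>\<^sup>+ x. f x \<partial>\<nu>)"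
    if [measurable]: "f \<in> borel_measurable borel" for f :: "'a \<Rightarrow> ennreal"
  proof -
    have "(\<integral>\<^sup>+ z. f (snd z) \<partial>\<Gamma>) = (\<integral>\<^sup>+ z. ennreal (h (a (fst z)) (a (snd z))) * f (snd z) \<partial>(\<mu> \<Otimes>\<^sub>M \<nu>))"
      unfolding \<Gamma>_def by (subst nn_integral_density) auto
    also have "\<dots> = (\<integral>\<^sup>+ y. \<integral>\<^sup>+ x. ennreal (h (a x) (a y)) * f y \<partial>\<mu> \<partial>\<nu>)"
      by (subst P.nn_integral_snd[symmetric]) auto
    also have "\<dots> = (\<integral>\<^sup>+ y. ennreal (\<Sum>p\<in>J. h p (a y) * m p) * f y \<partial>\<nu>)"
      by (intro nn_integral_cong, subst nn_integral_multc) (auto simp: in2)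
    also have "\<dots> = (\<integral>\<^sup>+ x. f x \<partial>\<nu>)"
      using pos[OF \<nu>] by (intro nn_integral_cong_AE) (auto elim!: eventually_mono simp: sn J(2) n_def)
    finally show ?thesis .
  qed
  have mid: "(\<integral>\<^sup>+ z. ennreal (dist (a (fst z)) (a (snd z))) \<partial>\<Gamma>) = ennreal (\<Sum>p\<in>J. \<Sum>q\<in>J. \<gamma> p q * dist p q)"
  proof -
    have "(\<integral>\<^sup>+ z. ennreal (dist (a (fst z)) (a (snd z))) \<partial>\<Gamma>)
        = (\<integral>\<^sup>+ z. ennreal (h (a (fst z)) (a (snd z)) * dist (a (fst z)) (a (snd z))) \<partial>(\<mu> \<Otimes>\<^sub>M \<nu>))"
      unfolding \<Gamma>_def by (subst nn_integral_density) (auto simp: ennreal_mult h0)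
    also have "\<dots> = (\<integral>\<^sup>+ x. \<integral>\<^sup>+ y. ennreal (h (a x) (a y) * dist (a x) (a y)) \<partial>\<nu> \<partial>\<mu>)"
      by (subst N.nn_integral_fst[symmetric]) auto
    also have "\<dots> = (\<integral>\<^sup>+ x. ennreal (\<Sum>q\<in>J. h (a x) q * dist (a x) q * n q) \<partial>\<mu>)"
      unfolding n_def
      by (intro nn_integral_cong, subst nn_integral_finite_range[OF \<nu> a J]) (auto simp: h0)
    also have "\<dots> = ennreal (\<Sum>p\<in>J. (\<Sum>q\<in>J. h p q * dist p q * n q) * m p)"
      unfolding m_def
      by (subst nn_integral_finite_range[OF \<mu> a J]) (auto intro!: sum_nonneg mult_nonneg_nonneg simp: h0 n_def)
    also have "(\<Sum>p\<in>J. (\<Sum>q\<in>J. h p q * dist p q * n q) * m p) = (\<Sum>p\<in>J. \<Sum>q\<in>J. \<gamma> p q * dist p q)"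
      unfolding sum_distrib_right
    proof (intro sum.cong refl)
      fix p q assume "p \<in> J" "q \<in> J"
      from hm[OF this] show "h p q * dist p q * n q * m p = \<gamma> p q * dist p q"
        by (metis mult.commute mult.left_commute)
    qed
    finally show ?thesis .
  qed
  have "\<Gamma> \<in> couplings \<mu> \<nu>"
    unfolding couplings_def
  proof (intro CollectI conjI)
    show "prob_space \<Gamma>"
      using fst[of "\<lambda>_. 1"] by (intro prob_spaceI) (simp add: M.emeasure_space_1)
    show "sets \<Gamma> = sets borel" unfolding sets by (subst borel_prod) (rule refl)
    show "distr \<Gamma> borel fst = \<mu>"
    proof (rule measure_eqI)
      fix A :: "'a set" assume "A \<in> sets (distr \<Gamma> borel fst)"
      then have A[measurable]: "A \<in> sets borel" by simp
      have "emeasure (distr \<Gamma> borel fst) A = (\<integral>\<^sup>+ x. indicator A x \<partial>distr \<Gamma> borel fst)"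
        by (subst nn_integral_indicator) auto
      also have "\<dots> = (\<integral>\<^sup>+ z. indicator A (fst z) \<partial>\<Gamma>)"
        by (subst nn_integral_distr) auto
      also have "\<dots> = emeasure \<mu> A" by (subst fst) auto
      finally show "emeasure (distr \<Gamma> borel fst) A = emeasure \<mu> A" .
    qed (simp add: \<mu>)
    show "distr \<Gamma> borel snd = \<nu>"
    proof (rule measure_eqI)
      fix A :: "'a set" assume "A \<in> sets (distr \<Gamma> borel snd)"
      then have A[measurable]: "A \<in> sets borel" by simp
      have "emeasure (distr \<Gamma> borel snd) A = (\<integral>\<^sup>+ x. indicator A x \<partial>distr \<Gamma> borel snd)"
        by (subst nn_integral_indicator) auto
      also have "\<dots> = (\<integral>\<^sup>+ z. indicator A (snd z) \<partial>\<Gamma>)"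
        by (subst nn_integral_distr) auto
      also have "\<dots> = emeasure \<nu> A" by (subst snd) auto
      finally show "emeasure (distr \<Gamma> borel snd) A = emeasure \<nu> A" .
    qed (simp add: \<nu>)
  qed
  moreover have "(\<integral>\<^sup>+ (x, y). ennreal (dist x y) \<partial>\<Gamma>) \<le> (\<integral>\<^sup>+ x. ennreal (dist x (a x)) \<partial>\<mu>)
       + ennreal (\<Sum>p\<in>J. \<Sum>q\<in>J. \<gamma> p q * dist p q) + (\<integral>\<^sup>+ y. ennreal (dist y (a y)) \<partial>\<nu>)"
  proof -
    have tri: "dist x y \<le> dist x (a x) + dist (a x) (a y) + dist y (a y)" for x y
      by metric
    have "(\<integral>\<^sup>+ (x, y). ennreal (dist x y) \<partial>\<Gamma>) \<le> (\<integral>\<^sup>+ z. ennreal (dist (fst z) (a (fst z)))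
        + ennreal (dist (a (fst z)) (a (snd z))) + ennreal (dist (snd z) (a (snd z))) \<partial>\<Gamma>)"
      by (intro nn_integral_mono) (auto simp: tri simp flip: ennreal_plus)
    also have "\<dots> = (\<integral>\<^sup>+ z. ennreal (dist (fst z) (a (fst z))) \<partial>\<Gamma>)
        + (\<integral>\<^sup>+ z. ennreal (dist (a (fst z)) (a (snd z))) \<partial>\<Gamma>)
        + (\<integral>\<^sup>+ z. ennreal (dist (snd z) (a (snd z))) \<partial>\<Gamma>)"
      by (simp add: nn_integral_add)
    also have "\<dots> = (\<integral>\<^sup>+ x. ennreal (dist x (a x)) \<partial>\<mu>)
       + ennreal (\<Sum>p\<in>J. \<Sum>q\<in>J. \<gamma> p q * dist p q) + (\<integral>\<^sup>+ y. ennreal (dist y (a y)) \<partial>\<nu>)"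
      using fst[of "\<lambda>x. ennreal (dist x (a x))"] snd[of "\<lambda>x. ennreal (dist x (a x))"] mid by simp
    finally show ?thesis .
  qed
  ultimately show ?thesis using that by blast
qed


text \<open>Dominated convergence with majorant \<open>3 * norm x\<close>, which is integrable for
  measures in \<open>P1\<close>.\<close>

lemma tendsto_integral_dist_approx:
  fixes \<mu> :: "'a::euclidean_space measure" and F :: "nat \<Rightarrow> 'a \<Rightarrow> 'a"
  assumes \<mu>: "\<mu> \<in> P1" and [measurable]: "\<And>i. F i \<in> borel_measurable borel"
    and lim: "\<And>x. (\<lambda>i. F i x) \<longlonglongrightarrow> x" and bd: "\<And>i x. norm (F i x) \<le> 2 * norm x"
  shows "integrable \<mu> (\<lambda>x. dist x (F i x))" "(\<lambda>i. \<integral>x. dist x (F i x) \<partial>\<mu>) \<longlonglongrightarrow> 0"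
proof -
  have [measurable_cong]: "sets \<mu> = sets borel" and int: "integrable \<mu> norm"
    using \<mu> by (auto simp: P1_def)
  have b: "norm (dist x (F i x)) \<le> 3 * norm x" for x i
    using bd[of i x] norm_triangle_ineq4[of x "F i x"] by (simp add: dist_norm)
  have i3: "integrable \<mu> (\<lambda>x. 3 * norm x)" using int by simp
  show "integrable \<mu> (\<lambda>x. dist x (F i x))"
    by (rule Bochner_Integration.integrable_bound[OF i3]) (auto intro!: AE_I2 b[simplified])
  have "(\<lambda>i. \<integral>x. dist x (F i x) \<partial>\<mu>) \<longlonglongrightarrow> (\<integral>x. 0 \<partial>\<mu>)"
  proof (rule integral_dominated_convergence[where w = "\<lambda>x. 3 * norm x"])
    show "AE x in \<mu>. (\<lambda>i. dist x (F i x)) \<longlonglongrightarrow> 0"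
    proof (rule AE_I2)
      fix x show "(\<lambda>i. dist x (F i x)) \<longlonglongrightarrow> 0"
        using tendsto_dist[OF tendsto_const lim, of x x] by simp
    qed
    show "AE x in \<mu>. norm (dist x (F i x)) \<le> 3 * norm x" for i by (rule AE_I2) (rule b)
  qed (use i3 in auto)
  then show "(\<lambda>i. \<integral>x. dist x (F i x) \<partial>\<mu>) \<longlonglongrightarrow> 0" by simp
qed

section \<open>Minima of cones as dual potentials\<close>

text \<open>For finite nonempty \<open>J\<close> this is the largest 1-Lipschitz function lying
  below \<open>- g\<close> on \<open>J\<close>, that is, the transform of \<open>g\<close> for the
  cost \<open>dist\<close>.\<close>

definition cone_min :: "'a set \<Rightarrow> ('a \<Rightarrow> real) \<Rightarrow> 'a::euclidean_space \<Rightarrow> real" where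
  "cone_min J g x = Min ((\<lambda>a. dist x a - g a) ` J)"

lemma cone_min_le: "finite J \<Longrightarrow> a \<in> J \<Longrightarrow> cone_min J g x \<le> dist x a - g a"
  unfolding cone_min_def by (rule Min_le) auto

lemma cone_min_attained:
  assumes "finite J" "J \<noteq> {}"
  obtains a where "a \<in> J" "cone_min J g x = dist x a - g a"
proof -
  have "cone_min J g x \<in> (\<lambda>a. dist x a - g a) ` J"
    unfolding cone_min_def using assms by (intro Min_in) auto
  then show ?thesis using that by blast
qed

lemma cone_min_lipschitz:
  assumes "finite J" "J \<noteq> {}"
  shows "\<bar>cone_min J g x - cone_min J g y\<bar> \<le> dist x y"
proof -
  have "cone_min J g x \<le> cone_min J g y + dist x y" for x y
  proof -
    obtain a where a: "a \<in> J" "cone_min J g y = dist y a - g a"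
      using cone_min_attained[OF assms] by blast
    have "cone_min J g x \<le> dist x a - g a" using assms(1) a(1) by (rule cone_min_le)
    with a(2) show ?thesis using dist_triangle[of x a y] by linarith
  qed
  from this[of x y] this[of y x] show ?thesis by (simp add: dist_commute abs_le_iff)
qed

lemma integrable_lipschitz_P1:
  fixes f :: "'a::euclidean_space \<Rightarrow> real"
  assumes \<mu>: "\<mu> \<in> P1" and f: "\<And>x y. \<bar>f x - f y\<bar> \<le> C * dist x y"
  shows "f \<in> borel_measurable borel" "integrable \<mu> f"
proof -
  interpret prob_space \<mu> using \<mu> by (simp add: P1_def)
  have [measurable_cong]: "sets \<mu> = sets borel" and int: "integrable \<mu> norm"
    using \<mu> by (auto simp: P1_def)
  have "C-lipschitz_on UNIV f \<or> C < 0"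
    using f by (auto simp: lipschitz_on_def dist_real_def)
  moreover have "continuous_on UNIV f" if "C < 0"
  proof -
    have "f x = f y" for x y
      using f[of x y] that by (smt (verit) mult_nonpos_nonneg zero_le_dist)
    then have "f = (\<lambda>_. f 0)" by auto
    then show ?thesis by (metis continuous_on_const)
  qed
  ultimately have "continuous_on UNIV f" using lipschitz_on_continuous_on by blast
  then show m[measurable]: "f \<in> borel_measurable borel" by (rule borel_measurable_continuous_onI)
  show "integrable \<mu> f"
  proof (rule Bochner_Integration.integrable_bound)
    show "integrable \<mu> (\<lambda>x. C * norm x + \<bar>f 0\<bar>)" using int by auto
    show "AE x in \<mu>. norm (f x) \<le> norm (C * norm x + \<bar>f 0\<bar>)"
    proof (rule AE_I2)
      fix x show "norm (f x) \<le> norm (C * norm x + \<bar>f 0\<bar>)"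
        using f[of x 0] by (simp add: dist_norm)
    qed
  qed simp
qed

text \<open>Both measures are quantised by the same simple map \<open>a\<close>, chosen close to the
  identity in mean. For the quantised measures the dual bound of the finite problem is the
  hypothesis \<open>K\<close> up to the quantisation error, and the optimal finite plan lifts to a
  coupling of \<open>\<mu>\<close> and \<open>\<nu>\<close> themselves.\<close>

theorem d1_le_of_dual_bound:
  fixes \<mu> \<nu> :: "'a::euclidean_space measure"
  assumes \<mu>: "\<mu> \<in> P1" and \<nu>: "\<nu> \<in> P1" and K0: "0 \<le> K"
    and K: "\<And>J g. finite J \<Longrightarrow> J \<noteq> {} \<Longrightarrow>
      (\<integral>x. cone_min J g x \<partial>\<mu>) - (\<integral>x. cone_min J g x \<partial>\<nu>) \<le> K"
  shows "d1 \<mu> \<nu> \<le> K"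
proof (rule field_le_epsilon)
  fix e :: real assume e: "0 < e"
  \<comment> \<open>Four errors of this size occur: two when potentials are compared at
    \<open>x\<close> and \<open>a x\<close>, two when the finite plan is lifted.\<close>
  define \<epsilon> where "\<epsilon> = e / 4"
  have \<epsilon>: "\<epsilon> > 0" using e by (simp add: \<epsilon>_def)
  interpret M: prob_space \<mu> using \<mu> by (simp add: P1_def)
  interpret N: prob_space \<nu> using \<nu> by (simp add: P1_def)
  have sm: "sets \<mu> = sets borel" and sn: "sets \<nu> = sets borel"
    using \<mu> \<nu> by (auto simp: P1_def)
  note [measurable_cong] = sm sn
  obtain F :: "nat \<Rightarrow> 'a \<Rightarrow> 'a" where F: "\<And>i. simple_function borel (F i)"
    "\<And>x. (\<lambda>i. F i x) \<longlonglongrightarrow> x" "\<And>i x. dist (F i x) 0 \<le> 2 * dist x 0"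
    using borel_measurable_implies_sequence_metric[of "\<lambda>x::'a. x" borel 0] by auto
  have Fm: "F i \<in> borel_measurable borel" for i
    using F(1) by (rule borel_measurable_simple_function)
  have Fn: "norm (F i x) \<le> 2 * norm x" for i x using F(3)[of i x] by simp
  note lim = tendsto_integral_dist_approx[OF _ Fm F(2) Fn]
  have "\<forall>\<^sub>F i in sequentially. (\<integral>x. dist x (F i x) \<partial>\<mu>) < \<epsilon> \<and> (\<integral>x. dist x (F i x) \<partial>\<nu>) < \<epsilon>"
    using order_tendstoD(2)[OF lim(2)[OF \<mu>] \<epsilon>] order_tendstoD(2)[OF lim(2)[OF \<nu>] \<epsilon>]
    by (rule eventually_conj)
  then obtain i where i: "(\<integral>x. dist x (F i x) \<partial>\<mu>) < \<epsilon>" "(\<integral>x. dist x (F i x) \<partial>\<nu>) < \<epsilon>"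
    by (auto simp: eventually_sequentially)
  define a where "a = F i"
  define J where "J = range a"
  have am[measurable]: "a \<in> borel_measurable borel" unfolding a_def by (rule Fm)
  have J: "finite J" "J \<noteq> {}" "\<And>x. a x \<in> J"
    using simple_functionD(1)[OF F(1)[of i]] by (auto simp: J_def a_def)
  have da: "(\<integral>\<^sup>+ x. ennreal (dist x (a x)) \<partial>\<mu>) \<le> ennreal \<epsilon>" "(\<integral>\<^sup>+ x. ennreal (dist x (a x)) \<partial>\<nu>) \<le> ennreal \<epsilon>"
    using i lim(1)[OF \<mu>, of i] lim(1)[OF \<nu>, of i]
    by (auto simp: a_def nn_integral_eq_integral intro!: ennreal_leI)
  have fin: "(\<integral>x. h (a x) \<partial>\<kappa>) = (\<Sum>p\<in>J. measure \<kappa> (a -` {p}) * h p)" "integrable \<kappa> (\<lambda>x. h (a x))"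
    if "prob_space \<kappa>" and s[measurable_cong]: "sets \<kappa> = sets borel" for \<kappa> and h :: "'a \<Rightarrow> real"
  proof -
    interpret prob_space \<kappa> by fact
    have [measurable]: "a -` {p} \<in> sets \<kappa>" for p
      using measurable_sets[OF am, of "{p}"] s by simp
    have eq: "(\<lambda>x. h (a x)) = (\<lambda>x. \<Sum>p\<in>J. h p * indicator (a -` {p}) x)"
    proof
      fix x show "h (a x) = (\<Sum>p\<in>J. h p * indicator (a -` {p}) x)"
        using J(1,3) by (subst sum.remove[of _ "a x"]) (auto intro!: sum.neutral)
    qed
    have int: "integrable \<kappa> (\<lambda>x. h p * indicator (a -` {p}) x)" for p
      by (intro integrable_mult_right) (auto simp: emeasure_eq_measure)
    show "integrable \<kappa> (\<lambda>x. h (a x))" unfolding eq using int by auto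
    show "(\<integral>x. h (a x) \<partial>\<kappa>) = (\<Sum>p\<in>J. measure \<kappa> (a -` {p}) * h p)"
      unfolding eq using int by (simp add: Bochner_Integration.integral_sum mult.commute sets_eq_imp_space_eq[OF s])
  qed
  define m where "m p = measure \<mu> (a -` {p})" for p
  define n where "n p = measure \<nu> (a -` {p})" for p
  have m1: "sum m J = 1" and n1: "sum n J = 1"
    using fin(1)[OF _ sm, of "\<lambda>_. 1"] fin(1)[OF _ sn, of "\<lambda>_. 1"] M.prob_space_axioms N.prob_space_axioms
    by (simp_all add: m_def n_def M.prob_space N.prob_space)
  have "(\<Sum>p\<in>J. m p * Min ((\<lambda>q. dist p q - g q) ` J)) + (\<Sum>q\<in>J. n q * g q) \<le> K + 2 * \<epsilon>" for g
  proof -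
    let ?\<phi> = "cone_min J g"
    note lip = cone_min_lipschitz[OF J(1,2), of g]
    have lip1: "\<bar>?\<phi> x - ?\<phi> y\<bar> \<le> 1 * dist x y" for x y using lip by simp
    have p: "?\<phi> (a x) \<le> ?\<phi> x + dist x (a x)" "?\<phi> x - dist x (a x) \<le> ?\<phi> (a x)" for x
      using lip[of x "a x"] by (auto simp: abs_le_iff)
    have "(\<integral>x. ?\<phi> (a x) \<partial>\<mu>) \<le> (\<integral>x. ?\<phi> x + dist x (a x) \<partial>\<mu>)"
      using lim(1)[OF \<mu>, of i] integrable_lipschitz_P1(2)[OF \<mu> lip1]
      by (intro integral_mono fin(2) M.prob_space_axioms sm p) (auto simp: a_def)
    also have "\<dots> \<le> (\<integral>x. ?\<phi> x \<partial>\<mu>) + \<epsilon>"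
      using i lim(1)[OF \<mu>, of i] integrable_lipschitz_P1(2)[OF \<mu> lip1] by (simp add: a_def)
    finally have 1: "(\<integral>x. ?\<phi> (a x) \<partial>\<mu>) \<le> (\<integral>x. ?\<phi> x \<partial>\<mu>) + \<epsilon>" .
    have "(\<integral>x. ?\<phi> x \<partial>\<nu>) - \<epsilon> \<le> (\<integral>x. ?\<phi> x - dist x (a x) \<partial>\<nu>)"
      using i lim(1)[OF \<nu>, of i] integrable_lipschitz_P1(2)[OF \<nu> lip1] by (simp add: a_def)
    also have "\<dots> \<le> (\<integral>x. ?\<phi> (a x) \<partial>\<nu>)"
      using lim(1)[OF \<nu>, of i] integrable_lipschitz_P1(2)[OF \<nu> lip1]
      by (intro integral_mono fin(2) N.prob_space_axioms sn p) (auto simp: a_def)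
    also have "\<dots> = (\<Sum>q\<in>J. n q * ?\<phi> q)" by (simp add: fin(1)[OF N.prob_space_axioms sn] n_def)
    \<comment> \<open>At its apex \<open>q\<close> a cone has the value \<open>- g q\<close>, which
      bounds the minimum of all cones there.\<close>
    also have "\<dots> \<le> (\<Sum>q\<in>J. n q * (- g q))"
    proof (intro sum_mono mult_left_mono)
      fix q assume "q \<in> J"
      then show "?\<phi> q \<le> - g q" using cone_min_le[OF J(1), of q g q] by simp
    qed (simp add: n_def)
    finally have 2: "(\<Sum>q\<in>J. n q * g q) \<le> \<epsilon> - (\<integral>x. ?\<phi> x \<partial>\<nu>)" by (simp add: sum_negf)
    have "(\<integral>x. ?\<phi> (a x) \<partial>\<mu>) = (\<Sum>p\<in>J. m p * ?\<phi> p)"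
      by (simp add: fin(1)[OF M.prob_space_axioms sm] m_def)
    also have "\<dots> = (\<Sum>p\<in>J. m p * Min ((\<lambda>q. dist p q - g q) ` J))"
      by (simp add: cone_min_def)
    finally show ?thesis using 1 2 K[OF J(1,2), of g] by linarith
  qed
  from discrete_kantorovich_duality[OF J(1,2) _ m1 _ n1 this]
  have "\<exists>\<gamma>. (\<forall>p q. 0 \<le> \<gamma> p q) \<and> (\<forall>p\<in>J. (\<Sum>q\<in>J. \<gamma> p q) = m p) \<and>
    (\<forall>q\<in>J. (\<Sum>p\<in>J. \<gamma> p q) = n q) \<and> (\<Sum>p\<in>J. \<Sum>q\<in>J. \<gamma> p q * dist p q) \<le> K + 2 * \<epsilon>"
    by (simp add: m_def n_def)
  then obtain \<gamma> where
    \<gamma>: "\<And>p q. 0 \<le> \<gamma> p q" "\<And>p. p \<in> J \<Longrightarrow> (\<Sum>q\<in>J. \<gamma> p q) = m p"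
      "\<And>q. q \<in> J \<Longrightarrow> (\<Sum>p\<in>J. \<gamma> p q) = n q" "(\<Sum>p\<in>J. \<Sum>q\<in>J. \<gamma> p q * dist p q) \<le> K + 2 * \<epsilon>"
    by blast
  obtain \<Gamma> where \<Gamma>: "\<Gamma> \<in> couplings \<mu> \<nu>"
    "(\<integral>\<^sup>+ (x, y). ennreal (dist x y) \<partial>\<Gamma>) \<le> (\<integral>\<^sup>+ x. ennreal (dist x (a x)) \<partial>\<mu>)
       + ennreal (\<Sum>p\<in>J. \<Sum>q\<in>J. \<gamma> p q * dist p q) + (\<integral>\<^sup>+ y. ennreal (dist y (a y)) \<partial>\<nu>)"
    using coupling_of_discrete_coupling[OF M.prob_space_axioms sm N.prob_space_axioms sn am J(1,3)
      \<gamma>(1) \<gamma>(2)[unfolded m_def] \<gamma>(3)[unfolded n_def]] by blast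
  have "(INF \<gamma>\<in>couplings \<mu> \<nu>. \<integral>\<^sup>+ (x, y). ennreal (dist x y) \<partial>\<gamma>)
      \<le> (\<integral>\<^sup>+ (x, y). ennreal (dist x y) \<partial>\<Gamma>)"
    using \<Gamma>(1) by (rule INF_lower)
  also have "\<dots> \<le> ennreal \<epsilon> + ennreal (K + 2 * \<epsilon>) + ennreal \<epsilon>"
    using \<Gamma>(2) by (rule order_trans) (intro add_mono da ennreal_leI \<gamma>(4))
  also have "\<dots> = ennreal (K + e)"
    using K0 \<epsilon> by (simp add: \<epsilon>_def flip: ennreal_plus)
  finally show "d1 \<mu> \<nu> \<le> K + e"
    unfolding d1_def using K0 e by (intro enn2real_leI) auto
qed

section \<open>Smooth semiconcave approximations of the dual potentials\<close>

text \<open>Gradient and Hessian are carried as data, so that compositions yield formulas whose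
  trace can be estimated. Continuity of the Hessian is asked direction by direction, which in finite
  dimension amounts to continuity in operator norm.\<close>

definition has_grad_hess ::
  "('a::euclidean_space \<Rightarrow> real) \<Rightarrow> ('a \<Rightarrow> 'a) \<Rightarrow> ('a \<Rightarrow> 'a \<Rightarrow> 'a) \<Rightarrow> bool" where
  "has_grad_hess f G D \<longleftrightarrow>
     (\<forall>x. (f has_derivative (\<lambda>h. G x \<bullet> h)) (at x)) \<and> (\<forall>x. (G has_derivative D x) (at x)) \<and>
     (\<forall>b. continuous_on UNIV (\<lambda>x. D x b))"

definition op_trace :: "('a::euclidean_space \<Rightarrow> 'a) \<Rightarrow> real" where
  "op_trace A = (\<Sum>b\<in>Basis. A b \<bullet> b)"

text \<open>Weaker than semiconcavity in the usual sense: only the Laplacian is bounded above, which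
  is the quantity that meets the density in the Fokker-Planck equation.\<close>

definition lip_semiconcave :: "real \<Rightarrow> ('a::euclidean_space \<Rightarrow> real) \<Rightarrow> bool" where
  "lip_semiconcave \<kappa> f \<longleftrightarrow>
     (\<exists>G D. has_grad_hess f G D \<and> (\<forall>x. norm (G x) \<le> 1) \<and> (\<forall>x. op_trace (D x) \<le> \<kappa>))"

lemma op_trace_rank_one: "op_trace (\<lambda>h. (v \<bullet> h) *\<^sub>R w) = v \<bullet> w"
  unfolding op_trace_def by (subst euclidean_inner[of v w]) (simp add: inner_commute)

lemma op_trace_add: "op_trace (\<lambda>h. A h + B h) = op_trace A + op_trace B"
  by (simp add: op_trace_def inner_add_left sum.distrib)

lemma op_trace_diff: "op_trace (\<lambda>h. A h - B h) = op_trace A - op_trace B"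
  by (simp add: op_trace_def inner_diff_left sum_subtractf)

lemma op_trace_scaleR: "op_trace (\<lambda>h. c *\<^sub>R A h) = c * op_trace A"
  by (simp add: op_trace_def sum_distrib_left)

lemma op_trace_id: "op_trace (\<lambda>h::'a::euclidean_space. h) = DIM('a)"
  by (simp add: op_trace_def)

lemma has_grad_hess_continuous:
  assumes "has_grad_hess f G D"
  shows "continuous_on A f" "continuous_on A G" "continuous_on A (\<lambda>x. D x b)"
proof -
  show "continuous_on A f" "continuous_on A G"
    by (rule has_derivative_continuous_on[OF has_derivative_at_withinI],
        use assms in \<open>auto simp: has_grad_hess_def\<close>)+
  show "continuous_on A (\<lambda>x. D x b)"
    using assms unfolding has_grad_hess_def by (blast intro: continuous_on_subset)
qed

definition soft_norm :: "real \<Rightarrow> 'a::euclidean_space \<Rightarrow> real" where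
  "soft_norm \<delta> x = sqrt (\<delta>\<^sup>2 + x \<bullet> x)"

lemma soft_norm_bounds:
  assumes "\<delta> > 0"
  shows "\<delta> \<le> soft_norm \<delta> x" "norm x \<le> soft_norm \<delta> x" "soft_norm \<delta> x \<le> norm x + \<delta>"
proof -
  show "\<delta> \<le> soft_norm \<delta> x" unfolding soft_norm_def by (rule real_le_rsqrt) simp
  show "norm x \<le> soft_norm \<delta> x"
    unfolding soft_norm_def by (rule real_le_rsqrt) (simp add: power2_norm_eq_inner)
  show "soft_norm \<delta> x \<le> norm x + \<delta>"
    unfolding soft_norm_def using assms
    by (intro real_le_lsqrt) (auto simp: power2_norm_eq_inner power2_sum)
qed

lemma soft_norm_0: "\<delta> > 0 \<Longrightarrow> soft_norm \<delta> 0 = \<delta>"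
  by (simp add: soft_norm_def)

text \<open>The Hessian is the identity minus the rank-one operator of \<open>G x\<close>, divided
  by \<open>f x\<close>. Its trace is at most the dimension divided by \<open>f x\<close>, and
  \<open>f x \<ge> \<delta>\<close>.\<close>

lemma has_grad_hess_soft_norm:
  fixes a :: "'a::euclidean_space"
  assumes "\<delta> > 0"
  defines "f \<equiv> \<lambda>x. soft_norm \<delta> (x - a)"
  defines "G \<equiv> \<lambda>x. (1 / f x) *\<^sub>R (x - a)"
  defines "D \<equiv> \<lambda>x h. (1 / f x) *\<^sub>R h - (1 / f x) *\<^sub>R ((G x \<bullet> h) *\<^sub>R G x)"
  shows "has_grad_hess f G D" "norm (G x) \<le> 1" "op_trace (D x) \<le> DIM('a) / \<delta>"
proof -
  have pos: "f x > 0" "\<delta> \<le> f x" "norm (x - a) \<le> f x" for x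
    using soft_norm_bounds[OF assms(1), of "x - a"] assms(1) by (auto simp: f_def)
  have f': "(f has_derivative (\<lambda>h. G x \<bullet> h)) (at x)" for x
  proof -
    have p: "\<delta>\<^sup>2 + (x - a) \<bullet> (x - a) > 0" using assms(1) by (simp add: add_pos_nonneg)
    have "((\<lambda>x. \<delta>\<^sup>2 + (x - a) \<bullet> (x - a)) has_derivative (\<lambda>h. 2 * ((x - a) \<bullet> h))) (at x)"
      by (auto intro!: derivative_eq_intros simp: fun_eq_iff inner_commute)
    from has_derivative_real_sqrt[OF p this] show ?thesis
      unfolding f_def G_def soft_norm_def
      by (rule has_derivative_eq_rhs) (rule ext, simp only: inner_scaleR_left, simp add: inverse_eq_divide)
  qed
  have "(G has_derivative D x) (at x)" for x
    unfolding G_def D_def using pos(1)[of x]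
    by (auto intro!: derivative_eq_intros f' simp: fun_eq_iff G_def field_simps)
  moreover have "continuous_on UNIV (\<lambda>x. D x b)" for b
  proof -
    have cf: "continuous_on UNIV f" by (rule has_derivative_continuous_on[OF f'])
    have nz: "f x \<noteq> 0" for x using pos(1)[of x] by simp
    have "continuous_on UNIV G" unfolding G_def by (intro continuous_intros cf) (simp add: nz)
    then show ?thesis unfolding D_def by (intro continuous_intros cf) (auto simp: nz)
  qed
  ultimately show "has_grad_hess f G D" using f' by (simp add: has_grad_hess_def)
  have "norm (G x) = norm (x - a) / f x" unfolding G_def norm_scaleR using pos[of x] by simp
  then show "norm (G x) \<le> 1" using pos[of x] by simp
  have "op_trace (D x) = (1 / f x) * (DIM('a) - G x \<bullet> G x)"
    unfolding D_def by (simp add: op_trace_diff op_trace_scaleR op_trace_rank_one op_trace_id right_diff_distrib del: scaleR_scaleR)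
  also have "\<dots> \<le> (1 / f x) * DIM('a)" using pos(1)[of x] by (intro mult_left_mono) auto
  also have "\<dots> \<le> (1 / \<delta>) * DIM('a)" using pos[of x] assms(1) by (intro mult_right_mono) (auto simp: frac_le)
  finally show "op_trace (D x) \<le> DIM('a) / \<delta>" by simp
qed

definition soft_min :: "real \<Rightarrow> real \<Rightarrow> real \<Rightarrow> real" where
  "soft_min \<eta> s t = (s + t - sqrt (\<eta>\<^sup>2 + (s - t)\<^sup>2)) / 2"

lemma soft_min_bounds:
  assumes "\<eta> > 0"
  shows "\<bar>soft_min \<eta> s t - min s t\<bar> \<le> \<eta> / 2"
proof -
  define S where "S = sqrt (\<eta>\<^sup>2 + (s - t)\<^sup>2)"
  have "\<bar>s - t\<bar> \<le> S" unfolding S_def by (rule real_le_rsqrt) simp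
  moreover have "S \<le> \<bar>s - t\<bar> + \<eta>"
    unfolding S_def using assms by (intro real_le_lsqrt) (auto simp: power2_sum)
  moreover have eq: "soft_min \<eta> s t - min s t = (\<bar>s - t\<bar> - S) / 2"
    by (simp add: soft_min_def S_def min_def field_simps)
  ultimately show ?thesis unfolding eq by (simp add: abs_le_iff)
qed

text \<open>The gradient is a convex combination of the two gradients with weights
  \<open>(1 - r) / 2\<close> and \<open>(1 + r) / 2\<close>. Differentiating the weights adds only a
  rank-one term that is a nonpositive multiple of \<open>F x - G x\<close> tensored with itself, so
  the bounds \<open>1\<close> and \<open>\<kappa>\<close> survive whatever \<open>\<eta>\<close>
  is.\<close>

lemma lip_semiconcave_soft_min:
  fixes f g :: "'a::euclidean_space \<Rightarrow> real"
  assumes \<eta>: "\<eta> > 0" and f: "lip_semiconcave \<kappa> f" and g: "lip_semiconcave \<kappa> g"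
  shows "lip_semiconcave \<kappa> (\<lambda>x. soft_min \<eta> (f x) (g x))"
proof -
  obtain F D where F: "has_grad_hess f F D" "\<And>x. norm (F x) \<le> 1" "\<And>x. op_trace (D x) \<le> \<kappa>"
    using f by (auto simp: lip_semiconcave_def)
  obtain G E where G: "has_grad_hess g G E" "\<And>x. norm (G x) \<le> 1" "\<And>x. op_trace (E x) \<le> \<kappa>"
    using g by (auto simp: lip_semiconcave_def)
  note ders = F(1)[unfolded has_grad_hess_def, THEN conjunct1, rule_format]
    G(1)[unfolded has_grad_hess_def, THEN conjunct1, rule_format]
    F(1)[unfolded has_grad_hess_def, THEN conjunct2, THEN conjunct1, rule_format]
    G(1)[unfolded has_grad_hess_def, THEN conjunct2, THEN conjunct1, rule_format]
  define q where "q x = sqrt (\<eta>\<^sup>2 + (f x - g x)\<^sup>2)" for x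
  define r where "r x = (f x - g x) / q x" for x
  define P where "P x = ((1 - r x) / 2) *\<^sub>R F x + ((1 + r x) / 2) *\<^sub>R G x" for x
  define R where "R x = (\<eta>\<^sup>2 / q x ^ 3) *\<^sub>R (F x - G x)" for x
  define Q where "Q x h = ((1 - r x) / 2) *\<^sub>R D x h + ((1 + r x) / 2) *\<^sub>R E x h
     - (1 / 2) *\<^sub>R ((R x \<bullet> h) *\<^sub>R (F x - G x))" for x h
  have q0: "\<eta>\<^sup>2 + (f x - g x)\<^sup>2 > 0" for x using \<eta> by (simp add: add_pos_nonneg)
  have q: "q x > 0" for x using q0 by (simp add: q_def)
  have q2: "q x * q x = \<eta>\<^sup>2 + (f x - g x)\<^sup>2" for x
    using q0[of x] by (simp add: q_def)
  have r: "\<bar>r x\<bar> \<le> 1" for x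
  proof -
    have "\<bar>f x - g x\<bar> \<le> q x" unfolding q_def by (rule real_le_rsqrt) simp
    then show ?thesis using q[of x] by (simp add: r_def)
  qed
  have q': "(q has_derivative (\<lambda>h. r x * ((F x - G x) \<bullet> h))) (at x)" for x
  proof -
    have "((\<lambda>x. \<eta>\<^sup>2 + (f x - g x)\<^sup>2) has_derivative (\<lambda>h. 2 * (f x - g x) * ((F x - G x) \<bullet> h))) (at x)"
      by (auto intro!: derivative_eq_intros ders simp: fun_eq_iff inner_diff_left algebra_simps)
    from has_derivative_real_sqrt[OF q0 this] show ?thesis
      unfolding q_def[abs_def, symmetric]
      by (rule has_derivative_eq_rhs) (use q[of x] in \<open>auto simp: r_def q_def[symmetric] fun_eq_iff field_simps\<close>)
  qed
  have f': "((\<lambda>x. soft_min \<eta> (f x) (g x)) has_derivative (\<lambda>h. P x \<bullet> h)) (at x)" for x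
    unfolding soft_min_def q_def[symmetric] P_def
    by (auto intro!: derivative_eq_intros ders q' simp: fun_eq_iff inner_diff_left inner_add_left field_simps)
  have r': "(r has_derivative (\<lambda>h. R x \<bullet> h)) (at x)" for x
  proof -
    have "((\<lambda>x. (f x - g x) / q x) has_derivative
        (\<lambda>h. ((F x \<bullet> h - G x \<bullet> h) * q x - (f x - g x) * (r x * ((F x - G x) \<bullet> h))) / (q x * q x))) (at x)"
      using q[of x] by (intro has_derivative_divide' has_derivative_diff ders q') auto
    moreover have "((F x \<bullet> h - G x \<bullet> h) * q x - (f x - g x) * (r x * ((F x - G x) \<bullet> h))) / (q x * q x)
        = R x \<bullet> h" for h
    proof -
      have "((F x \<bullet> h - G x \<bullet> h) * q x - (f x - g x) * (r x * ((F x - G x) \<bullet> h)))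
          = (F x - G x) \<bullet> h * ((q x * q x - (f x - g x)\<^sup>2) / q x)"
        using q[of x] by (simp add: r_def inner_diff_left field_simps power2_eq_square)
      also have "\<dots> = (F x - G x) \<bullet> h * (\<eta>\<^sup>2 / q x)" by (simp add: q2)
      finally show ?thesis using q[of x] by (simp add: R_def power3_eq_cube mult.commute)
    qed
    ultimately show ?thesis by (simp add: r_def[abs_def])
  qed
  have P': "(P has_derivative Q x) (at x)" for x
    unfolding P_def[abs_def] Q_def[abs_def]
    by (auto intro!: derivative_eq_intros ders r' simp: fun_eq_iff algebra_simps scaleR_add_left[symmetric])
  have "continuous_on UNIV (\<lambda>x. Q x b)" for b
  proof -
    have c: "continuous_on UNIV q" "continuous_on UNIV r"
      using q' r' by (auto intro!: has_derivative_continuous_on)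
    have nz: "q x \<noteq> 0" for x using q[of x] by simp
    have "continuous_on UNIV R"
      unfolding R_def by (intro continuous_intros c has_grad_hess_continuous[OF F(1)]
        has_grad_hess_continuous[OF G(1)]) (simp add: nz)
    then show ?thesis
      unfolding Q_def by (intro continuous_intros c has_grad_hess_continuous[OF F(1)]
        has_grad_hess_continuous[OF G(1)]) simp_all
  qed
  with f' P' have "has_grad_hess (\<lambda>x. soft_min \<eta> (f x) (g x)) P Q" by (simp add: has_grad_hess_def)
  moreover have "norm (P x) \<le> 1" for x
  proof -
    have "norm (P x) \<le> ((1 - r x) / 2) * norm (F x) + ((1 + r x) / 2) * norm (G x)"
      using r[of x] unfolding P_def by (intro norm_triangle_le) (auto simp: abs_le_iff)
    also have "\<dots> \<le> ((1 - r x) / 2) * 1 + ((1 + r x) / 2) * 1"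
      using r[of x] F(2) G(2) by (intro add_mono mult_left_mono) (auto simp: abs_le_iff)
    finally show ?thesis by (simp add: field_simps)
  qed
  moreover have "op_trace (Q x) \<le> \<kappa>" for x
  proof -
    have "op_trace (Q x) = ((1 - r x) / 2) * op_trace (D x) + ((1 + r x) / 2) * op_trace (E x)
        - (1 / 2) * (R x \<bullet> (F x - G x))"
      unfolding Q_def by (simp add: op_trace_diff op_trace_add op_trace_scaleR op_trace_rank_one del: scaleR_scaleR)
    moreover have "R x \<bullet> (F x - G x) \<ge> 0" using q[of x] by (simp add: R_def)
    moreover have "((1 - r x) / 2) * op_trace (D x) + ((1 + r x) / 2) * op_trace (E x)
        \<le> ((1 - r x) / 2) * \<kappa> + ((1 + r x) / 2) * \<kappa>"
      using r[of x] F(3) G(3) by (intro add_mono mult_left_mono) (auto simp: abs_le_iff)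
    moreover have "((1 - r x) / 2) * \<kappa> + ((1 + r x) / 2) * \<kappa> = \<kappa>" by (simp add: field_simps)
    ultimately show ?thesis by linarith
  qed
  ultimately show ?thesis unfolding lip_semiconcave_def by blast
qed

lemma lip_semiconcave_add_const:
  assumes "lip_semiconcave \<kappa> f"
  shows "lip_semiconcave \<kappa> (\<lambda>x. f x + c)"
proof -
  have "has_grad_hess (\<lambda>x. f x + c) G D" if "has_grad_hess f G D" for G D
    using that unfolding has_grad_hess_def by (auto intro!: derivative_eq_intros)
  with assms show ?thesis unfolding lip_semiconcave_def by blast
qed

lemma lip_semiconcave_soft_norm:
  "\<delta> > 0 \<Longrightarrow> lip_semiconcave (DIM('a) / \<delta>) (\<lambda>x::'a::euclidean_space. soft_norm \<delta> (x - a))"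
  unfolding lip_semiconcave_def using has_grad_hess_soft_norm by blast

lemma cone_min_smooth_approx:
  fixes J :: "'a::euclidean_space set"
  assumes "finite J" "J \<noteq> {}" and \<delta>: "\<delta> > 0" and "\<eta> > 0"
  shows "\<exists>f. lip_semiconcave (DIM('a) / \<delta>) f \<and> (\<forall>x. \<bar>f x - cone_min J g x\<bar> \<le> \<delta> + \<eta>)"
  using assms(1,2,4)
proof (induction J arbitrary: \<eta> rule: finite_ne_induct)
  case (singleton a)
  have "lip_semiconcave (DIM('a) / \<delta>) (\<lambda>x. soft_norm \<delta> (x - a) + - g a)"
    by (intro lip_semiconcave_add_const lip_semiconcave_soft_norm \<delta>)
  moreover have "\<bar>soft_norm \<delta> (x - a) + - g a - cone_min {a} g x\<bar> \<le> \<delta> + \<eta>" for x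
    using soft_norm_bounds[OF \<delta>, of "x - a"] singleton by (simp add: cone_min_def dist_norm)
  ultimately show ?case by blast
next
  case (insert a J)
  \<comment> \<open>Halving \<open>\<eta>\<close> for the smaller set pays for the error
    \<open>\<eta> / 2\<close> of one more soft minimum; the error \<open>\<delta>\<close> of the
    cones does not accumulate, since the minimum of two functions is nonexpansive in the sup
    norm.\<close>
  obtain f where f: "lip_semiconcave (DIM('a) / \<delta>) f" "\<And>x. \<bar>f x - cone_min J g x\<bar> \<le> \<delta> + \<eta> / 2"
    using insert.IH[of "\<eta> / 2"] insert.prems by auto
  define h where "h x = soft_min \<eta> (soft_norm \<delta> (x - a) + - g a) (f x)" for x
  have "lip_semiconcave (DIM('a) / \<delta>) h"
    unfolding h_def using insert.prems
    by (intro lip_semiconcave_soft_min lip_semiconcave_add_const lip_semiconcave_soft_norm \<delta> f)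
  moreover have "\<bar>h x - cone_min (insert a J) g x\<bar> \<le> \<delta> + \<eta>" for x
  proof -
    have "cone_min (insert a J) g x = min (dist x a - g a) (cone_min J g x)"
      using insert.hyps by (simp add: cone_min_def)
    then show ?thesis
      using f(2)[of x] soft_norm_bounds[OF \<delta>, of "x - a"]
        soft_min_bounds[OF insert.prems, of "soft_norm \<delta> (x - a) + - g a" "f x"]
      unfolding h_def dist_norm by linarith
  qed
  ultimately show ?case by blast
qed

section \<open>Truncation to compactly supported test functions\<close>

text \<open>Exponents from two upwards make the positive part glue differentiably to zero: at the
  origin the difference quotient is at most \<open>\<bar>h\<bar> ^ Suc k\<close>. The cases
  \<open>k = 1\<close> and \<open>k = 0\<close> differentiate \<open>truncation\<close>
  twice.\<close>

lemma DERIV_max0_power: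
  fixes s :: real
  shows "((\<lambda>s. max 0 s ^ Suc (Suc k)) has_real_derivative real (Suc (Suc k)) * max 0 s ^ Suc k) (at s)"
proof -
  have pow: "((\<lambda>s. s ^ Suc (Suc k)) has_real_derivative real (Suc (Suc k)) * s ^ Suc k) (at s)"
    using DERIV_pow[of "Suc (Suc k)" s] by simp
  consider "s < 0" | "s > 0" | "s = 0" by linarith
  then show ?thesis
  proof cases
    case 1
    show ?thesis
    proof (rule has_field_derivative_transform_within_open[where f = "\<lambda>_. 0" and S = "{..<0}"])
      show "((\<lambda>_. 0) has_real_derivative real (Suc (Suc k)) * max 0 s ^ Suc k) (at s)"
        using 1 by (simp add: max_def)
    qed (use 1 in \<open>auto simp: max_def\<close>)
  next
    case 2
    show ?thesis
    proof (rule has_field_derivative_transform_within_open[where f = "\<lambda>s. s ^ Suc (Suc k)" and S = "{0<..}"])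
      show "((\<lambda>s. s ^ Suc (Suc k)) has_real_derivative real (Suc (Suc k)) * max 0 s ^ Suc k) (at s)"
        using 2 pow by (simp add: max_def)
    qed (use 2 in \<open>auto simp: max_def\<close>)
  next
    case 3
    have "((\<lambda>h::real. max 0 h ^ Suc (Suc k) / h) \<longlongrightarrow> 0) (at 0)"
    proof (rule Lim_null_comparison[where g = "\<lambda>h. \<bar>h\<bar> ^ Suc k"])
      have "norm (max 0 h ^ Suc (Suc k) / h) \<le> \<bar>h\<bar> ^ Suc k" for h :: real
      proof (cases "h > 0")
        case False
        then have m: "max 0 h = 0" by simp
        show ?thesis unfolding m by simp
      qed (simp add: max_def)
      then show "\<forall>\<^sub>F h in at 0. norm (max 0 h ^ Suc (Suc k) / h) \<le> \<bar>h\<bar> ^ Suc k" for h :: real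
        by (intro always_eventually) blast
      show "((\<lambda>h::real. \<bar>h\<bar> ^ Suc k) \<longlongrightarrow> 0) (at 0)"
        by (auto intro!: tendsto_eq_intros)
    qed
    then show ?thesis using 3 by (simp add: DERIV_def)
  qed
qed

lemma has_grad_hess_compose:
  fixes \<theta> \<theta>' \<theta>'' :: "real \<Rightarrow> real"
  assumes f: "has_grad_hess f G D"
    and \<theta>: "\<And>s. (\<theta> has_real_derivative \<theta>' s) (at s)" "\<And>s. (\<theta>' has_real_derivative \<theta>'' s) (at s)"
      "continuous_on UNIV \<theta>''"
  shows "has_grad_hess (\<lambda>x. \<theta> (f x)) (\<lambda>x. \<theta>' (f x) *\<^sub>R G x)
    (\<lambda>x h. \<theta>' (f x) *\<^sub>R D x h + \<theta>'' (f x) *\<^sub>R ((G x \<bullet> h) *\<^sub>R G x))"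
proof -
  note f' = f[unfolded has_grad_hess_def, THEN conjunct1, rule_format]
    and G' = f[unfolded has_grad_hess_def, THEN conjunct2, THEN conjunct1, rule_format]
  have 1: "((\<lambda>x. \<theta> (f x)) has_derivative (\<lambda>h. \<theta>' (f x) * (G x \<bullet> h))) (at x)" for x
    using DERIV_compose_FDERIV[OF \<theta>(1) f'] by (simp add: mult.commute)
  have 2: "((\<lambda>x. \<theta>' (f x)) has_derivative (\<lambda>h. \<theta>'' (f x) * (G x \<bullet> h))) (at x)" for x
    using DERIV_compose_FDERIV[OF \<theta>(2) f'] by (simp add: mult.commute)
  have "((\<lambda>x. \<theta>' (f x) *\<^sub>R G x) has_derivative
      (\<lambda>h. \<theta>' (f x) *\<^sub>R D x h + \<theta>'' (f x) *\<^sub>R ((G x \<bullet> h) *\<^sub>R G x))) (at x)" for x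
    using has_derivative_scaleR[OF 2 G'] by simp
  moreover have "continuous_on UNIV (\<lambda>x. \<theta>' (f x) *\<^sub>R D x h + \<theta>'' (f x) *\<^sub>R ((G x \<bullet> h) *\<^sub>R G x))" for h
  proof -
    have "continuous_on UNIV \<theta>'" using \<theta>(2) by (auto intro!: DERIV_continuous_on)
    from continuous_on_compose2[OF this has_grad_hess_continuous(1)[OF f]]
      continuous_on_compose2[OF \<theta>(3) has_grad_hess_continuous(1)[OF f]]
    show ?thesis
      by (intro continuous_intros has_grad_hess_continuous[OF f]) auto
  qed
  ultimately show ?thesis using 1 by (simp add: has_grad_hess_def)
qed

text \<open>Composing with an increasing concave function that is constant from \<open>M\<close> on keeps the
  gradient and Laplacian bounds while making the function constant near infinity.\<close>

definition truncation :: "real \<Rightarrow> real \<Rightarrow> real" where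
  "truncation M s = - (max 0 (M - s) ^ 3) / (3 * M\<^sup>2)"

lemma lip_semiconcave_truncation:
  fixes f :: "'a::euclidean_space \<Rightarrow> real"
  assumes f: "lip_semiconcave \<kappa> f" and f0: "\<And>x. 0 \<le> f x" and M: "M > 0" and \<kappa>: "0 \<le> \<kappa>"
  shows "lip_semiconcave \<kappa> (\<lambda>x. truncation M (f x))"
proof -
  obtain G D where G: "has_grad_hess f G D" "\<And>x. norm (G x) \<le> 1" "\<And>x. op_trace (D x) \<le> \<kappa>"
    using f by (auto simp: lip_semiconcave_def)
  define t1 where "t1 s = max 0 (M - s) ^ 2 / M\<^sup>2" for s
  define t2 where "t2 s = - 2 * max 0 (M - s) / M\<^sup>2" for s
  have d: "((\<lambda>s. max 0 (M - s) ^ Suc (Suc k)) has_real_derivative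
      (real (Suc (Suc k)) * max 0 (M - s) ^ Suc k) * (- 1)) (at s)" for k s
    by (rule DERIV_chain2[OF DERIV_max0_power]) (auto intro!: derivative_eq_intros)
  have "(truncation M has_real_derivative t1 s) (at s)" for s
    unfolding truncation_def[abs_def] t1_def
    using DERIV_cdivide[OF DERIV_minus[OF d[of 1 s]], of "3 * M\<^sup>2"] M
    by (simp add: numeral_3_eq_3 numeral_2_eq_2)
  moreover have "(t1 has_real_derivative t2 s) (at s)" for s
    unfolding t1_def[abs_def] t2_def
    using DERIV_cdivide[OF d[of 0 s], of "M\<^sup>2"] by (simp add: numeral_2_eq_2)
  moreover have "continuous_on UNIV t2"
    unfolding t2_def using M by (intro continuous_intros) auto
  ultimately have "has_grad_hess (\<lambda>x. truncation M (f x)) (\<lambda>x. t1 (f x) *\<^sub>R G x)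
    (\<lambda>x h. t1 (f x) *\<^sub>R D x h + t2 (f x) *\<^sub>R ((G x \<bullet> h) *\<^sub>R G x))"
    by (intro has_grad_hess_compose[OF G(1)])
  moreover have t1: "0 \<le> t1 (f x)" "t1 (f x) \<le> 1" for x
  proof -
    \<comment> \<open>The factor \<open>1 / (3 * M\<^sup>2)\<close> normalises the slope of
      \<open>truncation M\<close> to one at zero; since the slope exceeds one at negative arguments,
      \<open>f\<close> has to be nonnegative.\<close>
    have "max 0 (M - f x) \<le> M" using f0[of x] M by simp
    then have "max 0 (M - f x) ^ 2 \<le> M ^ 2" by (intro power_mono) auto
    then show "0 \<le> t1 (f x)" "t1 (f x) \<le> 1" using M by (auto simp: t1_def)
  qed
  moreover have "norm (t1 (f x) *\<^sub>R G x) \<le> 1" for x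
    using mult_mono[OF t1(2) G(2)[of x]] t1[of x] by simp
  moreover have "op_trace (\<lambda>h. t1 (f x) *\<^sub>R D x h + t2 (f x) *\<^sub>R ((G x \<bullet> h) *\<^sub>R G x)) \<le> \<kappa>" for x
  proof -
    have "t2 (f x) * (G x \<bullet> G x) \<le> 0"
      using M by (intro mult_nonpos_nonneg) (auto simp: t2_def divide_nonpos_nonneg)
    moreover have "t1 (f x) * op_trace (D x) \<le> 1 * \<kappa>"
      using t1[of x] G(3)[of x] \<kappa> by (meson mult_mono order_trans mult_left_mono mult_right_mono)
    ultimately show ?thesis
      by (simp add: op_trace_add op_trace_scaleR op_trace_rank_one del: scaleR_scaleR)
  qed
  ultimately show ?thesis unfolding lip_semiconcave_def by blast
qed

lemma truncation_diff_eq: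
  assumes "0 < M"
  shows "truncation M s - truncation M 0
    = (M - max 0 (M - s)) * (M\<^sup>2 + M * max 0 (M - s) + (max 0 (M - s))\<^sup>2) / (3 * M\<^sup>2)"
proof -
  define m where "m = max 0 (M - s)"
  have "truncation M s - truncation M 0 = (M ^ 3 - m ^ 3) / (3 * M\<^sup>2)"
    using assms by (simp add: truncation_def m_def field_simps)
  also have "M ^ 3 - m ^ 3 = (M - m) * (M\<^sup>2 + M * m + m\<^sup>2)"
    by (simp add: eval_nat_numeral algebra_simps)
  finally show ?thesis by (simp add: m_def)
qed

text \<open>As soon as \<open>M = real (Suc k)\<close> exceeds \<open>s\<close>, the difference
  equals \<open>s - s\<^sup>2 / M + s ^ 3 / (3 * M\<^sup>2)\<close>, and both corrections
  vanish.\<close>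

lemma truncation_limit:
  "(\<lambda>k. truncation (real (Suc k)) s - truncation (real (Suc k)) 0) \<longlonglongrightarrow> s" if "0 \<le> s"
proof -
  obtain N where "s \<le> real N" using real_arch_simple by blast
  then have "\<forall>\<^sub>F k in sequentially. s \<le> real (Suc k)"
    by (intro eventually_sequentiallyI[of N]) auto
  then have "\<forall>\<^sub>F k in sequentially. s - s\<^sup>2 / real (Suc k) + s ^ 3 / (3 * (real (Suc k))\<^sup>2)
      = truncation (real (Suc k)) s - truncation (real (Suc k)) 0"
  proof eventually_elim
    case (elim k)
    define M where "M = real (Suc k)"
    have M: "M > 0" "max 0 (M - s) = M - s" using elim by (auto simp: M_def)
    have "s - s\<^sup>2 / M + s ^ 3 / (3 * M\<^sup>2) = s * (M\<^sup>2 + M * (M - s) + (M - s)\<^sup>2) / (3 * M\<^sup>2)"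
      using M(1) by (simp add: field_simps eval_nat_numeral)
    then show ?case
      using truncation_diff_eq[OF M(1), of s] M(2) by (simp add: M_def)
  qed
  moreover have "(\<lambda>k. s - s\<^sup>2 / real (Suc k) + s ^ 3 / (3 * (real (Suc k))\<^sup>2)) \<longlonglongrightarrow> s"
  proof -
    have "(\<lambda>k. s - s\<^sup>2 * inverse (real (Suc k)) + s ^ 3 / 3 * (inverse (real (Suc k)))\<^sup>2)
        \<longlonglongrightarrow> s - s\<^sup>2 * 0 + s ^ 3 / 3 * 0\<^sup>2"
      by (intro tendsto_intros LIMSEQ_inverse_real_of_nat)
    then have "(\<lambda>k. s - s\<^sup>2 * inverse (real (Suc k)) + s ^ 3 / 3 * (inverse (real (Suc k)))\<^sup>2)
        \<longlonglongrightarrow> s" by simp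
    note lim = this
    have eq: "s - s\<^sup>2 * inverse r + s ^ 3 / 3 * (inverse r)\<^sup>2 = s - s\<^sup>2 / r + s ^ 3 / (3 * r\<^sup>2)" for r
      by (cases "r = 0") (simp_all add: field_simps power2_eq_square)
    from lim show ?thesis unfolding eq .
  qed
  ultimately show ?thesis by (rule Lim_transform_eventually[rotated])
qed

text \<open>Supplies the majorant for the passage to the limit under the integral: in the factorised
  difference, \<open>M\<^sup>2 + M * m + m\<^sup>2\<close> never exceeds
  \<open>3 * M\<^sup>2\<close>.\<close>

lemma truncation_le: "0 \<le> s \<Longrightarrow> 0 < M \<Longrightarrow> \<bar>truncation M s - truncation M 0\<bar> \<le> s"
proof -
  assume s: "0 \<le> s" and M: "0 < M"
  define m where "m = max 0 (M - s)"
  have m: "0 \<le> m" "m \<le> M" "M - m \<le> s" using s M by (auto simp: m_def)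
  have eq: "truncation M s - truncation M 0 = (M - m) * (M\<^sup>2 + M * m + m\<^sup>2) / (3 * M\<^sup>2)"
    using truncation_diff_eq[OF M] by (simp add: m_def)
  have "M * m \<le> M * M" using m M by simp
  then have "M\<^sup>2 + M * m + m\<^sup>2 \<le> 3 * M\<^sup>2"
    using m power_mono[of m M 2] by (simp add: power2_eq_square)
  then have "(M - m) * (M\<^sup>2 + M * m + m\<^sup>2) \<le> s * (3 * M\<^sup>2)"
    using m M by (intro mult_mono) auto
  moreover have "0 \<le> (M - m) * (M\<^sup>2 + M * m + m\<^sup>2)" using m M by simp
  ultimately show ?thesis unfolding eq using M by (simp add: abs_le_iff field_simps)
qed

section \<open>Time regularity of Fokker-Planck flows\<close>

lemma integrable_compact_support:
  fixes f :: "'a::euclidean_space \<Rightarrow> real"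
  assumes "continuous_on UNIV f" and "\<And>x. R < norm x \<Longrightarrow> f x = 0"
  shows "integrable lborel f"
proof -
  have "integrable lborel (\<lambda>x. indicator (cball 0 R) x *\<^sub>R f x)"
    using assms(1) by (intro borel_integrable_compact) (auto intro: continuous_on_subset)
  also have "(\<lambda>x. indicator (cball 0 R) x *\<^sub>R f x) = f"
    using assms(2) by (auto simp: fun_eq_iff indicator_def)
  finally show ?thesis .
qed

lemma derivative_zero_outside:
  assumes "(f has_derivative f') (at x)" and "\<And>y. R < norm y \<Longrightarrow> f y = 0" and "R < norm x"
  shows "f' = (\<lambda>_. 0)"
proof -
  have "open {y. R < norm y}" by (intro open_Collect_less continuous_intros)
  then have "((\<lambda>_. 0) has_derivative f') (at x)"
    using assms by (intro has_derivative_transform_within_open[OF assms(1)]) auto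
  then show ?thesis using has_derivative_unique has_derivative_const by blast
qed

lemma bounded_compact_support:
  fixes f :: "'a::euclidean_space \<Rightarrow> real"
  assumes "continuous_on UNIV f" and "\<And>x. R < norm x \<Longrightarrow> f x = 0"
  obtains B where "B \<ge> 0" "\<And>x. \<bar>f x\<bar> \<le> B"
proof -
  have "bounded (f ` cball 0 R)"
    using assms(1) by (intro compact_imp_bounded compact_continuous_image) (auto intro: continuous_on_subset)
  then obtain B where B: "\<forall>x\<in>cball 0 R. \<bar>f x\<bar> \<le> B" by (auto simp: bounded_iff)
  have "\<bar>f x\<bar> \<le> \<bar>B\<bar>" for x
  proof (cases "norm x \<le> R")
    case True
    then have "\<bar>f x\<bar> \<le> B" using B by simp
    then show ?thesis by linarith
  qed (use assms(2)[of x] in simp)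
  then show ?thesis using that[of "\<bar>B\<bar>"] by auto
qed

text \<open>Translation invariance of Lebesgue measure makes every difference quotient integrate to
  zero. With \<open>norm b \<le> 1\<close> and steps at most one, all quotients live on the ball of
  radius \<open>R + 1\<close>, where the bound \<open>B\<close> on the derivative dominates
  them.\<close>

lemma integral_directional_derivative_zero:
  fixes g :: "'a::euclidean_space \<Rightarrow> real"
  assumes der: "\<And>x. (g has_derivative g' x) (at x)" and cont: "continuous_on UNIV (\<lambda>x. g' x b)"
    and supp: "\<And>x. R < norm x \<Longrightarrow> g x = 0" and b: "norm b \<le> 1"
  shows "(\<integral>x. g' x b \<partial>lborel) = 0"
proof -
  have cg: "continuous_on UNIV g" using der by (rule has_derivative_continuous_on)
  have int: "integrable lborel g" using cg supp by (rule integrable_compact_support)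
  have bm: "g \<in> borel_measurable borel" using cg by (rule borel_measurable_continuous_onI)
  have zero: "g' x b = 0" if "R < norm x" for x
    using derivative_zero_outside[OF der supp that] by simp
  obtain B where B: "B \<ge> 0" "\<And>x. \<bar>g' x b\<bar> \<le> B"
    using bounded_compact_support[OF cont zero] by blast
  define h where "h k = inverse (real (Suc k))" for k
  have h: "0 < h k" "h k \<le> 1" for k by (auto simp: h_def field_simps)
  have line: "((\<lambda>s. g (x + s *\<^sub>R b)) has_derivative (\<lambda>r. r * g' (x + s *\<^sub>R b) b)) (at s)" for x s
  proof -
    have "((\<lambda>s. x + s *\<^sub>R b) has_derivative (\<lambda>r. r *\<^sub>R b)) (at s)"
      by (auto intro!: derivative_eq_intros)
    from has_derivative_compose[OF this der] show ?thesis
      using has_derivative_linear[OF der] by (simp add: linear_cmul)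
  qed
  have lip: "\<bar>g (x + s *\<^sub>R b) - g x\<bar> \<le> B * s" if "s > 0" for x s
  proof -
    have "\<exists>c\<in>{0<..<s}. g (x + s *\<^sub>R b) - g (x + 0 *\<^sub>R b) = (s - 0) * g' (x + c *\<^sub>R b) b"
      by (rule mvt_simple[OF that]) (rule has_derivative_at_withinI[OF line])
    then obtain c where "g (x + s *\<^sub>R b) - g (x + 0 *\<^sub>R b) = (s - 0) * g' (x + c *\<^sub>R b) b" by blast
    then show ?thesis using B(2)[of "x + c *\<^sub>R b"] that by (simp add: abs_mult mult.commute mult_right_mono)
  qed
  define q where "q k x = (g (h k *\<^sub>R b + x) - g x) / h k" for k x
  have trans: "integrable lborel (\<lambda>x. g (c + x))" "(\<integral>x. g (c + x) \<partial>lborel) = (\<integral>x. g x \<partial>lborel)" for c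
  proof -
    have d: "distr lborel borel ((+) c) = lborel" by (rule lborel_distr_plus)
    show "integrable lborel (\<lambda>x. g (c + x))"
      using int by (subst integrable_distr_eq[of "(+) c" lborel borel g, symmetric]) (auto simp: d bm)
    show "(\<integral>x. g (c + x) \<partial>lborel) = (\<integral>x. g x \<partial>lborel)"
      using integral_distr[of "(+) c" lborel borel g] by (simp add: d bm)
  qed
  have q0: "(\<integral>x. q k x \<partial>lborel) = 0" for k
    unfolding q_def using trans int by simp
  have "(\<lambda>k. \<integral>x. q k x \<partial>lborel) \<longlonglongrightarrow> (\<integral>x. g' x b \<partial>lborel)"
  proof (rule integral_dominated_convergence[where w = "\<lambda>x. B * indicator (cball 0 (R + 1)) x"])
    show "(\<lambda>x. g' x b) \<in> borel_measurable lborel" using cont by (simp add: borel_measurable_continuous_onI)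
    show "q k \<in> borel_measurable lborel" for k
      unfolding q_def using bm by measurable
    show "integrable lborel (\<lambda>x. B * indicator (cball 0 (R + 1)) x)"
      by (intro integrable_mult_right integrable_real_indicator) (use emeasure_bounded_finite[OF bounded_cball, of 0 "R + 1"] in simp_all)
    show "AE x in lborel. (\<lambda>k. q k x) \<longlonglongrightarrow> g' x b"
    proof (rule AE_I2)
      fix x
      have "((\<lambda>s. g (x + s *\<^sub>R b)) has_real_derivative g' x b) (at 0)"
        using line[of x 0] by (simp add: has_field_derivative_def mult.commute[of _ "g' x b"])
      then have "(\<lambda>s. (g (x + s *\<^sub>R b) - g x) / s) \<midarrow>0\<rightarrow> g' x b"
        by (simp add: DERIV_def)
      moreover have "h \<longlonglongrightarrow> 0" unfolding h_def by (rule LIMSEQ_inverse_real_of_nat)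
      moreover have "\<forall>\<^sub>F k in sequentially. h k \<noteq> 0" using h by (auto intro!: always_eventually simp: less_imp_neq[THEN not_sym])
      ultimately have "(\<lambda>k. (g (x + h k *\<^sub>R b) - g x) / h k) \<longlonglongrightarrow> g' x b"
        by (auto intro: tendsto_compose_eventually)
      then show "(\<lambda>k. q k x) \<longlonglongrightarrow> g' x b" by (simp add: q_def add.commute)
    qed
    show "AE x in lborel. norm (q k x) \<le> B * indicator (cball 0 (R + 1)) x" for k
    proof (rule AE_I2)
      fix x
      show "norm (q k x) \<le> B * indicator (cball 0 (R + 1)) x"
      proof (cases "norm x \<le> R + 1")
        case True
        then show ?thesis using lip[OF h(1), of x k] h(1)[of k] by (simp add: q_def add.commute field_simps)
      next
        case False
        have "h k * norm b \<le> 1 * 1" using h[of k] b by (intro mult_mono) auto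
        then have "R < norm (h k *\<^sub>R b + x)"
          using False norm_triangle_ineq4[of "h k *\<^sub>R b + x" "h k *\<^sub>R b"] h(1)[of k] by simp
        then show ?thesis using False supp[of x] supp[of "h k *\<^sub>R b + x"] by (simp add: q_def)
      qed
    qed
  qed
  then show ?thesis using q0 LIMSEQ_unique[OF _ tendsto_const] by fastforce
qed

lemma integral_divergence_zero:
  fixes W :: "'a::euclidean_space \<Rightarrow> 'a"
  assumes der: "\<And>x. (W has_derivative W' x) (at x)" and cont: "\<And>b. continuous_on UNIV (\<lambda>x. W' x b)"
    and supp: "\<And>x. R < norm x \<Longrightarrow> W x = 0"
  shows "(\<integral>x. op_trace (W' x) \<partial>lborel) = 0"
proof -
  have i: "(\<integral>x. W' x b \<bullet> b \<partial>lborel) = 0" if "b \<in> Basis" for b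
  proof (rule integral_directional_derivative_zero[where R = R and g = "\<lambda>x. W x \<bullet> b" and g' = "\<lambda>x h. W' x h \<bullet> b"])
    show "((\<lambda>x. W x \<bullet> b) has_derivative (\<lambda>h. W' x h \<bullet> b)) (at x)" for x
      by (auto intro!: derivative_eq_intros der)
  qed (use that cont supp in \<open>auto intro!: continuous_intros\<close>)
  have "integrable lborel (\<lambda>x. W' x b \<bullet> b)" for b
  proof (rule integrable_compact_support)
    show "W' x b \<bullet> b = 0" if "R < norm x" for x
      using derivative_zero_outside[OF der supp that] by simp
  qed (intro continuous_intros cont)
  then show ?thesis unfolding op_trace_def by (subst Bochner_Integration.integral_sum) (auto simp: i)
qed

lemma continuous_on_op_trace:
  "(\<And>b. continuous_on A (\<lambda>x. W x b)) \<Longrightarrow> continuous_on A (\<lambda>x. op_trace (W x))"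
  unfolding op_trace_def by (intro continuous_intros)

text \<open>Green's identity and the transport term in one stroke: the compactly supported field
  \<open>W\<close> is chosen so that the products of \<open>P\<close> and \<open>G\<close> cancel in
  its divergence, leaving exactly the difference of the two integrands.\<close>

lemma integration_by_parts_test_function:
  fixes r \<psi> :: "'a::euclidean_space \<Rightarrow> real" and V :: "'a \<Rightarrow> 'a"
  assumes r: "has_grad_hess r G D" and \<psi>: "has_grad_hess \<psi> P Q"
    and V: "\<And>x. (V has_derivative V' x) (at x)" "\<And>b. continuous_on UNIV (\<lambda>x. V' x b)"
    and supp: "\<And>x. R < norm x \<Longrightarrow> \<psi> x = 0"
  shows "(\<integral>x. \<psi> x * (op_trace (D x) + op_trace (V' x)) \<partial>lborel) = (\<integral>x. r x * op_trace (Q x) - P x \<bullet> V x \<partial>lborel)"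
    "integrable lborel (\<lambda>x. r x * op_trace (Q x) - P x \<bullet> V x)"
proof -
  note r' = r[unfolded has_grad_hess_def, THEN conjunct1, rule_format]
    r[unfolded has_grad_hess_def, THEN conjunct2, THEN conjunct1, rule_format]
    and \<psi>' = \<psi>[unfolded has_grad_hess_def, THEN conjunct1, rule_format]
    \<psi>[unfolded has_grad_hess_def, THEN conjunct2, THEN conjunct1, rule_format]
  have P0: "P x = 0" if "R < norm x" for x
  proof -
    have "(\<lambda>h. P x \<bullet> h) = (\<lambda>_. 0)" using derivative_zero_outside[OF \<psi>'(1) supp that] .
    then have "P x \<bullet> P x = 0" by metis
    then show ?thesis by simp
  qed
  have Q0: "Q x = (\<lambda>_. 0)" if "R < norm x" for x
    using derivative_zero_outside[OF \<psi>'(2) P0 that] .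
  have cV: "continuous_on UNIV V" using V(1) by (rule has_derivative_continuous_on)
  note cont = has_grad_hess_continuous[OF r] has_grad_hess_continuous[OF \<psi>] cV V(2)
  define W where "W x = \<psi> x *\<^sub>R G x - r x *\<^sub>R P x + \<psi> x *\<^sub>R V x" for x
  define W' where "W' x h = (\<psi> x *\<^sub>R D x h + (P x \<bullet> h) *\<^sub>R G x) - (r x *\<^sub>R Q x h + (G x \<bullet> h) *\<^sub>R P x)
    + (\<psi> x *\<^sub>R V' x h + (P x \<bullet> h) *\<^sub>R V x)" for x h
  have "(\<integral>x. op_trace (W' x) \<partial>lborel) = 0"
  proof (rule integral_divergence_zero)
    show "(W has_derivative W' x) (at x)" for x
      unfolding W_def[abs_def] W'_def[abs_def]
      by (intro has_derivative_add has_derivative_diff has_derivative_scaleR r' \<psi>' V)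
    show "continuous_on UNIV (\<lambda>x. W' x b)" for b
      unfolding W'_def by (intro continuous_intros cont)
    show "W x = 0" if "R < norm x" for x using supp[OF that] P0[OF that] by (simp add: W_def)
  qed
  moreover have "op_trace (W' x) = \<psi> x * (op_trace (D x) + op_trace (V' x)) - (r x * op_trace (Q x) - P x \<bullet> V x)" for x
    unfolding W'_def
    by (simp add: op_trace_add op_trace_diff op_trace_scaleR op_trace_rank_one inner_commute[of "G x" "P x"] algebra_simps)
  moreover have i1: "integrable lborel (\<lambda>x. \<psi> x * (op_trace (D x) + op_trace (V' x)))"
    by (rule integrable_compact_support[where R = R])
      (auto intro!: continuous_intros continuous_on_op_trace cont simp: supp)
  moreover show i2: "integrable lborel (\<lambda>x. r x * op_trace (Q x) - P x \<bullet> V x)"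
    by (rule integrable_compact_support[where R = R])
      (auto intro!: continuous_intros continuous_on_op_trace cont simp: P0 Q0, simp add: op_trace_def)
  ultimately show "(\<integral>x. \<psi> x * (op_trace (D x) + op_trace (V' x)) \<partial>lborel)
      = (\<integral>x. r x * op_trace (Q x) - P x \<bullet> V x \<partial>lborel)"
    by simp
qed

section \<open>The Fokker-Planck equation tested with semiconcave functions\<close>

text \<open>The support of \<open>\<psi>\<close> fits into a box, so the Lebesgue integral becomes a
  gauge integral over that box and the Leibniz rule applies. The sign of \<open>R\<close> is
  unrestricted, hence the half-width \<open>\<bar>R\<bar>\<close>.\<close>

lemma has_derivative_integral_compact_support:
  fixes f f' :: "'a::euclidean_space \<Rightarrow> real \<Rightarrow> real" and \<psi> :: "'a \<Rightarrow> real"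
  assumes der: "\<And>x t. t \<in> {a..b} \<Longrightarrow> (f x has_real_derivative f' x t) (at t within {a..b})"
    and cont: "\<And>t. t \<in> {a..b} \<Longrightarrow> continuous_on UNIV (\<lambda>x. f x t)"
      "continuous_on (UNIV \<times> {a..b}) (\<lambda>(x, t). f' x t)"
    and \<psi>: "continuous_on UNIV \<psi>" and supp: "\<And>x. R < norm x \<Longrightarrow> \<psi> x = 0" and t: "t \<in> {a..b}"
  shows "((\<lambda>t. \<integral>x. \<psi> x * f x t \<partial>lborel) has_real_derivative (\<integral>x. \<psi> x * f' x t \<partial>lborel)) (at t within {a..b})"
proof -
  define l :: 'a where "l = - (\<bar>R\<bar> *\<^sub>R One)"
  define u :: 'a where "u = \<bar>R\<bar> *\<^sub>R One"
  have box: "x \<in> cbox l u" if "norm x \<le> R" for x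
  proof -
    have "\<bar>x \<bullet> i\<bar> \<le> \<bar>R\<bar>" if "i \<in> Basis" for i
      using Basis_le_norm[OF that, of x] \<open>norm x \<le> R\<close> by linarith
    then show ?thesis by (auto simp: mem_box l_def u_def abs_le_iff minus_le_iff)
  qed
  have eq: "(\<integral>x. \<psi> x * g x \<partial>lborel) = integral (cbox l u) (\<lambda>x. \<psi> x * g x)"
    if "continuous_on UNIV g" for g
  proof -
    have 0: "\<psi> x * g x = 0" if "x \<notin> cbox l u" for x using box[of x] supp[of x] that by force
    have "integrable lborel (\<lambda>x. \<psi> x * g x)"
      using supp by (intro integrable_compact_support[where R = R] continuous_intros \<psi> that) auto
    then have "(\<integral>x. \<psi> x * g x \<partial>lborel) = integral UNIV (\<lambda>x. \<psi> x * g x)"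
      by (rule integral_lborel[symmetric])
    also have "\<dots> = integral UNIV (\<lambda>x. if x \<in> cbox l u then \<psi> x * g x else 0)"
      using 0 by (intro integral_cong) auto
    also have "\<dots> = integral (cbox l u) (\<lambda>x. \<psi> x * g x)"
      by (rule integral_restrict_UNIV)
    finally show ?thesis .
  qed
  have c': "continuous_on UNIV (\<lambda>x. f' x t)" if "t \<in> {a..b}" for t
  proof -
    have "continuous_on UNIV (\<lambda>x. (\<lambda>(x, t). f' x t) (x, t))"
      by (rule continuous_on_compose2[OF cont(2)]) (use that in \<open>auto intro!: continuous_intros\<close>)
    then show ?thesis by simp
  qed
  have "((\<lambda>t. integral (cbox l u) (\<lambda>x. \<psi> x * f x t)) has_real_derivative
      integral (cbox l u) (\<lambda>x. \<psi> x * f' x t)) (at t within {a..b})"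
  proof (rule leibniz_rule_field_derivative[where f = "\<lambda>t x. \<psi> x * f x t" and fx = "\<lambda>t x. \<psi> x * f' x t"])
    show "((\<lambda>t. \<psi> x * f x t) has_real_derivative \<psi> x * f' x t) (at t within {a..b})"
      if "t \<in> {a..b}" for x t using der[OF that] by (intro DERIV_cmult)
    show "(\<lambda>x. \<psi> x * f x t) integrable_on cbox l u" if "t \<in> {a..b}" for t
      by (intro integrable_continuous continuous_intros continuous_on_subset[OF \<psi>]
          continuous_on_subset[OF cont(1)[OF that]]) auto
    have "continuous_on ({a..b} \<times> cbox l u) (\<lambda>z. (\<lambda>(x, t). f' x t) (snd z, fst z))"
      by (rule continuous_on_compose2[OF cont(2)]) (auto intro!: continuous_intros)
    then have "continuous_on ({a..b} \<times> cbox l u) (\<lambda>z. f' (snd z) (fst z))" by simp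
    moreover have "continuous_on ({a..b} \<times> cbox l u) (\<lambda>z. \<psi> (snd z))"
      by (rule continuous_on_compose2[OF \<psi>]) (auto intro!: continuous_intros)
    ultimately show "continuous_on ({a..b} \<times> cbox l u) (\<lambda>(t, x). \<psi> x * f' x t)"
      unfolding split_beta by (intro continuous_intros)
  qed (use t in auto)
  moreover have "(\<integral>x. \<psi> x * f x s \<partial>lborel) = integral (cbox l u) (\<lambda>x. \<psi> x * f x s)" if "s \<in> {a..b}" for s
    using eq[OF cont(1)[OF that]] .
  ultimately show ?thesis
    unfolding eq[OF c'[OF t]] has_field_derivative_def
    by (rule has_derivative_transform[OF t, rotated])
qed

text \<open>By the mean value theorem it suffices to bound the time derivative of the tested mass at
  one instant. After integration by parts the nonnegative density multiplies
  \<open>op_trace (Q x) - P x \<bullet> \<beta> x t\<close>; so an upper bound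
  \<open>\<kappa> + C\<close> on this factor is enough, and the unit mass integrates it.\<close>

lemma fokker_planck_test_estimate:
  fixes \<rho> \<rho>' :: "'a::euclidean_space \<Rightarrow> real \<Rightarrow> real" and \<beta> :: "'a \<Rightarrow> real \<Rightarrow> 'a"
  assumes ab: "a \<le> b"
    and \<rho>: "\<And>t. t \<in> {a..b} \<Longrightarrow> has_grad_hess (\<lambda>x. \<rho> x t) (G t) (D t)"
    and \<rho>': "\<And>x t. t \<in> {a..b} \<Longrightarrow> (\<rho> x has_real_derivative \<rho>' x t) (at t within {a..b})"
      "continuous_on (UNIV \<times> {a..b}) (\<lambda>(x, t). \<rho>' x t)"
    and V: "\<And>x t. t \<in> {a..b} \<Longrightarrow> ((\<lambda>x. \<rho> x t *\<^sub>R \<beta> x t) has_derivative V' t x) (at x)"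
      "\<And>t v. t \<in> {a..b} \<Longrightarrow> continuous_on UNIV (\<lambda>x. V' t x v)"
    and eq: "\<And>x t. t \<in> {a..b} \<Longrightarrow> \<rho>' x t = op_trace (D t x) + op_trace (V' t x)"
    and nonneg: "\<And>x t. t \<in> {a..b} \<Longrightarrow> 0 \<le> \<rho> x t"
    and mass: "\<And>t. t \<in> {a..b} \<Longrightarrow> integrable lborel (\<lambda>x. \<rho> x t)"
      "\<And>t. t \<in> {a..b} \<Longrightarrow> (\<integral>x. \<rho> x t \<partial>lborel) = 1"
    and \<beta>: "\<And>x t. t \<in> {a..b} \<Longrightarrow> norm (\<beta> x t) \<le> C"
    and \<psi>: "lip_semiconcave \<kappa> \<psi>" and supp: "\<And>x. R < norm x \<Longrightarrow> \<psi> x = 0"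
  shows "(\<integral>x. \<psi> x * \<rho> x b \<partial>lborel) - (\<integral>x. \<psi> x * \<rho> x a \<partial>lborel) \<le> (\<kappa> + C) * (b - a)"
proof (cases "a = b")
  case False
  with ab have ab: "a < b" by simp
  obtain P Q where P: "has_grad_hess \<psi> P Q" "\<And>x. norm (P x) \<le> 1" "\<And>x. op_trace (Q x) \<le> \<kappa>"
    using \<psi> by (auto simp: lip_semiconcave_def)
  define I where "I t = (\<integral>x. \<psi> x * \<rho> x t \<partial>lborel)" for t
  define I' where "I' t = (\<integral>x. \<psi> x * \<rho>' x t \<partial>lborel)" for t
  have "(I has_derivative (\<lambda>h. h * I' t)) (at t within {a..b})" if "t \<in> {a..b}" for t
  proof -
    have "(I has_real_derivative I' t) (at t within {a..b})"
      unfolding I_def[abs_def] I'_def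
      by (rule has_derivative_integral_compact_support[OF \<rho>'(1) has_grad_hess_continuous(1)[OF \<rho>]
            \<rho>'(2) has_grad_hess_continuous(1)[OF P(1)] supp that])
    then show ?thesis
      unfolding has_field_derivative_def by (rule has_derivative_eq_rhs) (simp add: fun_eq_iff)
  qed
  then have "\<exists>t\<in>{a<..<b}. I b - I a = (b - a) * I' t"
    using ab by (intro mvt_simple) auto
  then obtain t where t': "t \<in> {a<..<b}" "I b - I a = (b - a) * I' t" by blast
  then have t: "t \<in> {a..b}" "I b - I a = (b - a) * I' t" by auto
  have "I' t = (\<integral>x. \<psi> x * (op_trace (D t x) + op_trace (V' t x)) \<partial>lborel)"
    unfolding I'_def using eq[OF t(1)] by simp
  also have "\<dots> = (\<integral>x. \<rho> x t * op_trace (Q x) - P x \<bullet> (\<rho> x t *\<^sub>R \<beta> x t) \<partial>lborel)"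
    by (rule integration_by_parts_test_function(1)[OF \<rho>[OF t(1)] P(1) V(1)[OF t(1)] V(2)[OF t(1)] supp])
  also have "\<dots> \<le> (\<integral>x. (\<kappa> + C) * \<rho> x t \<partial>lborel)"
  proof (rule integral_mono)
    show "integrable lborel (\<lambda>x. \<rho> x t * op_trace (Q x) - P x \<bullet> (\<rho> x t *\<^sub>R \<beta> x t))"
      by (rule integration_by_parts_test_function(2)[OF \<rho>[OF t(1)] P(1) V(1)[OF t(1)] V(2)[OF t(1)] supp])
    show "integrable lborel (\<lambda>x. (\<kappa> + C) * \<rho> x t)" using mass(1)[OF t(1)] by simp
    fix x
    have "- (P x \<bullet> \<beta> x t) \<le> norm (P x) * norm (\<beta> x t)"
      using Cauchy_Schwarz_ineq2[of "P x" "\<beta> x t"] by linarith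
    also have "\<dots> \<le> 1 * C" using P(2)[of x] \<beta>[OF t(1), of x] by (intro mult_mono) auto
    finally have "op_trace (Q x) - P x \<bullet> \<beta> x t \<le> \<kappa> + C" using P(3)[of x] by linarith
    from mult_left_mono[OF this nonneg[OF t(1), of x]]
    show "\<rho> x t * op_trace (Q x) - P x \<bullet> (\<rho> x t *\<^sub>R \<beta> x t) \<le> (\<kappa> + C) * \<rho> x t"
      by (simp add: algebra_simps)
  qed
  also have "\<dots> = \<kappa> + C" using mass(2)[OF t(1)] by simp
  finally have "(b - a) * I' t \<le> (b - a) * (\<kappa> + C)" using ab by (intro mult_left_mono) auto
  then show ?thesis using t(2) by (simp add: I_def mult.commute)
qed simp

lemma lipschitz_of_gradient_bound:
  fixes f :: "'a::euclidean_space \<Rightarrow> real"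
  assumes "\<And>x. (f has_derivative (\<lambda>h. G x \<bullet> h)) (at x)" and "\<And>x. norm (G x) \<le> K"
  shows "\<bar>f x - f y\<bar> \<le> K * norm (x - y)"
proof -
  have "norm (f x - f y) \<le> K * norm (x - y)"
  proof (rule differentiable_bound[where S = UNIV and f' = "\<lambda>z h. G z \<bullet> h"])
    show "onorm (\<lambda>h. G z \<bullet> h) \<le> K" for z
    proof (rule onorm_bound)
      show "norm (G z \<bullet> h) \<le> K * norm h" for h
        using Cauchy_Schwarz_ineq2[of "G z" h] mult_right_mono[OF assms(2)[of z], of "norm h"] by simp
      show "0 \<le> K" using assms(2)[of z] norm_ge_zero[of "G z"] by linarith
    qed
  qed (use assms(1) in auto)
  then show ?thesis by simp
qed

lemma lip_semiconcave_lipschitz: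
  assumes "lip_semiconcave \<kappa> f"
  shows "\<bar>f x - f y\<bar> \<le> dist x y"
proof -
  obtain G D where G: "has_grad_hess f G D" "\<And>x. norm (G x) \<le> 1"
    using assms by (auto simp: lip_semiconcave_def)
  have "\<bar>f x - f y\<bar> \<le> 1 * norm (x - y)"
    by (rule lipschitz_of_gradient_bound) (use G in \<open>auto simp: has_grad_hess_def\<close>)
  then show ?thesis by (simp add: dist_norm)
qed

text \<open>Coercivity makes \<open>f + \<bar>c\<bar>\<close> nonnegative and lets it exceed any
  level outside a ball, so its truncations are admissible compactly supported tests. The level then
  tends to infinity.\<close>

lemma truncated_test_estimate:
  fixes \<mu> \<nu> :: "'a::euclidean_space measure"
  assumes \<mu>: "\<mu> \<in> P1" and \<nu>: "\<nu> \<in> P1"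
    and test: "\<And>\<psi> R. lip_semiconcave \<kappa> \<psi> \<Longrightarrow> (\<And>x. R < norm x \<Longrightarrow> \<psi> x = 0) \<Longrightarrow>
      (\<integral>x. \<psi> x \<partial>\<mu>) - (\<integral>x. \<psi> x \<partial>\<nu>) \<le> K"
    and \<kappa>: "0 \<le> \<kappa>" and f: "lip_semiconcave \<kappa> f" and coercive: "\<And>x. norm x - c \<le> f x"
  shows "(\<integral>x. f x \<partial>\<mu>) - (\<integral>x. f x \<partial>\<nu>) \<le> K"
proof -
  define g where "g x = f x + \<bar>c\<bar>" for x
  have g: "lip_semiconcave \<kappa> g" unfolding g_def by (rule lip_semiconcave_add_const[OF f])
  have g0: "0 \<le> g x" "norm x \<le> g x + \<bar>c\<bar>" for x
    using coercive[of x] norm_ge_zero[of x] unfolding g_def by (linarith, linarith)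
  define \<psi> where "\<psi> k x = truncation (real (Suc k)) (g x)" for k x
  \<comment> \<open>\<open>truncation\<close> has the value \<open>- M / 3\<close> at zero; only
    after subtracting it do the truncations converge to \<open>g\<close>. Both measures have mass
    one, so these constants cancel.\<close>
  define \<tau> where "\<tau> k = truncation (real (Suc k)) 0" for k
  have \<psi>: "lip_semiconcave \<kappa> (\<psi> k)" for k
    unfolding \<psi>_def by (rule lip_semiconcave_truncation[OF g g0(1) _ \<kappa>]) simp
  have lim: "integrable \<kappa>' (\<psi> k)" "(\<lambda>k. (\<integral>x. \<psi> k x \<partial>\<kappa>') - \<tau> k) \<longlonglongrightarrow> (\<integral>x. f x \<partial>\<kappa>') + \<bar>c\<bar>"
    if \<kappa>': "\<kappa>' \<in> P1" for \<kappa>' k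
  proof -
    interpret prob_space \<kappa>' using \<kappa>' by (simp add: P1_def)
    have [measurable_cong]: "sets \<kappa>' = sets borel" using \<kappa>' by (simp add: P1_def)
    have i: "h \<in> borel_measurable borel" "integrable \<kappa>' h" if "lip_semiconcave \<kappa> h" for h :: "'a \<Rightarrow> real"
      using integrable_lipschitz_P1[OF \<kappa>', of h 1] lip_semiconcave_lipschitz[OF that] by auto
    have ms[measurable]: "\<psi> k \<in> borel_measurable borel" "g \<in> borel_measurable borel" for k
      using i(1)[OF \<psi>] i(1)[OF g] by auto
    show int: "integrable \<kappa>' (\<psi> k)" for k by (rule i(2)[OF \<psi>])
    have "(\<lambda>k. \<integral>x. \<psi> k x - \<tau> k \<partial>\<kappa>') \<longlonglongrightarrow> (\<integral>x. g x \<partial>\<kappa>')"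
    proof (rule integral_dominated_convergence[where w = g])
      show "integrable \<kappa>' g" by (rule i(2)[OF g])
      show "AE x in \<kappa>'. (\<lambda>k. \<psi> k x - \<tau> k) \<longlonglongrightarrow> g x"
        unfolding \<psi>_def \<tau>_def by (rule AE_I2) (rule truncation_limit[OF g0(1)])
      show "AE x in \<kappa>'. norm (\<psi> k x - \<tau> k) \<le> g x" for k
        unfolding \<psi>_def \<tau>_def real_norm_def by (rule AE_I2) (rule truncation_le[OF g0(1)], simp)
    qed auto
    moreover have "(\<integral>x. \<psi> k x - \<tau> k \<partial>\<kappa>') = (\<integral>x. \<psi> k x \<partial>\<kappa>') - \<tau> k" for k
      using int by (simp add: prob_space)
    moreover have "(\<integral>x. g x \<partial>\<kappa>') = (\<integral>x. f x \<partial>\<kappa>') + \<bar>c\<bar>"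
      unfolding g_def using i(2)[OF f] by (simp add: prob_space)
    ultimately show "(\<lambda>k. (\<integral>x. \<psi> k x \<partial>\<kappa>') - \<tau> k) \<longlonglongrightarrow> (\<integral>x. f x \<partial>\<kappa>') + \<bar>c\<bar>" by simp
  qed
  have "\<psi> k x = 0" if "real (Suc k) + \<bar>c\<bar> < norm x" for k x
    using that g0(2)[of x] by (simp add: \<psi>_def truncation_def max_def)
  then have "(\<integral>x. \<psi> k x \<partial>\<mu>) - \<tau> k - ((\<integral>x. \<psi> k x \<partial>\<nu>) - \<tau> k) \<le> K" for k
    using test[OF \<psi>, where R = "real (Suc k) + \<bar>c\<bar>"] by simp
  moreover have "(\<lambda>k. (\<integral>x. \<psi> k x \<partial>\<mu>) - \<tau> k - ((\<integral>x. \<psi> k x \<partial>\<nu>) - \<tau> k)) \<longlonglongrightarrow>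
      (\<integral>x. f x \<partial>\<mu>) + \<bar>c\<bar> - ((\<integral>x. f x \<partial>\<nu>) + \<bar>c\<bar>)"
    by (rule tendsto_diff[OF lim(2)[OF \<mu>] lim(2)[OF \<nu>]])
  ultimately have "(\<integral>x. f x \<partial>\<mu>) + \<bar>c\<bar> - ((\<integral>x. f x \<partial>\<nu>) + \<bar>c\<bar>) \<le> K"
    using LIMSEQ_le_const2 by blast
  then show ?thesis by simp
qed

text \<open>The smooth approximation of a cone minimum errs by at most \<open>2 * \<delta>\<close>:
  one \<open>\<delta>\<close> from the soft cones, one from the soft minima, whose parameter is also
  \<open>\<delta>\<close>. Doing this under both measures costs \<open>4 * \<delta>\<close>.\<close>

theorem d1_le_of_semiconcave_tests:
  fixes \<mu> \<nu> :: "'a::euclidean_space measure"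
  assumes \<mu>: "\<mu> \<in> P1" and \<nu>: "\<nu> \<in> P1" and \<delta>: "\<delta> > 0" and K: "0 \<le> K"
    and test: "\<And>\<psi> R. lip_semiconcave (DIM('a) / \<delta>) \<psi> \<Longrightarrow> (\<And>x. R < norm x \<Longrightarrow> \<psi> x = 0) \<Longrightarrow>
      (\<integral>x. \<psi> x \<partial>\<mu>) - (\<integral>x. \<psi> x \<partial>\<nu>) \<le> K"
  shows "d1 \<mu> \<nu> \<le> K + 4 * \<delta>"
proof (rule d1_le_of_dual_bound[OF \<mu> \<nu>])
  show "0 \<le> K + 4 * \<delta>" using K \<delta> by simp
  fix J :: "'a set" and g assume J: "finite J" "J \<noteq> {}"
  let ?\<phi> = "cone_min J g"
  obtain f where f: "lip_semiconcave (DIM('a) / \<delta>) f" "\<And>x. \<bar>f x - ?\<phi> x\<bar> \<le> \<delta> + \<delta>"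
    using cone_min_smooth_approx[OF J \<delta> \<delta>] by blast
  have lip: "\<bar>?\<phi> x - ?\<phi> y\<bar> \<le> 1 * dist x y" for x y using cone_min_lipschitz[OF J] by simp
  have lipf: "\<bar>f x - f y\<bar> \<le> 1 * dist x y" for x y using lip_semiconcave_lipschitz[OF f(1)] by simp
  \<comment> \<open>Each cone satisfies \<open>dist x a - g a \<ge> norm x - (norm a + g a)\<close>;
    the extra \<open>2 * \<delta>\<close> absorbs the smoothing error.\<close>
  define c where "c = Max ((\<lambda>a. norm a + g a) ` J) + 2 * \<delta>"
  have "norm x - c \<le> f x" for x
  proof -
    obtain a where a: "a \<in> J" "?\<phi> x = dist x a - g a" using cone_min_attained[OF J] by blast
    have "norm a + g a \<le> Max ((\<lambda>a. norm a + g a) ` J)" using J a by (intro Max_ge) auto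
    moreover have "norm x \<le> dist x a + norm a" by (metis dist_norm norm_triangle_sub add.commute)
    ultimately show ?thesis using f(2)[of x] a(2) unfolding c_def by linarith
  qed
  note lower = this
  have 1: "(\<integral>x. f x \<partial>\<mu>) - (\<integral>x. f x \<partial>\<nu>) \<le> K"
  proof (rule truncated_test_estimate[OF \<mu> \<nu> _ _ f(1) lower])
    show "(\<integral>x. \<psi> x \<partial>\<mu>) - (\<integral>x. \<psi> x \<partial>\<nu>) \<le> K"
      if "lip_semiconcave (DIM('a) / \<delta>) \<psi>" "\<And>x. R < norm x \<Longrightarrow> \<psi> x = 0" for \<psi> R
      using that by (rule test)
  qed (use \<delta> in simp)
  have 2: "\<bar>(\<integral>x. f x \<partial>\<kappa>) - (\<integral>x. ?\<phi> x \<partial>\<kappa>)\<bar> \<le> 2 * \<delta>" if \<kappa>: "\<kappa> \<in> P1" for \<kappa>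
  proof -
    interpret prob_space \<kappa> using \<kappa> by (simp add: P1_def)
    have i: "integrable \<kappa> f" "integrable \<kappa> ?\<phi>"
      using integrable_lipschitz_P1(2)[OF \<kappa>, of f 1] integrable_lipschitz_P1(2)[OF \<kappa>, of ?\<phi> 1]
        lipf lip by auto
    have "\<bar>\<integral>x. f x - ?\<phi> x \<partial>\<kappa>\<bar> \<le> (\<integral>x. \<bar>f x - ?\<phi> x\<bar> \<partial>\<kappa>)" by (rule integral_abs_bound)
    also have "\<dots> \<le> (\<integral>x. 2 * \<delta> \<partial>\<kappa>)"
      using i f(2) by (intro integral_mono) auto
    finally show ?thesis using i by (simp add: prob_space)
  qed
  show "(\<integral>x. ?\<phi> x \<partial>\<mu>) - (\<integral>x. ?\<phi> x \<partial>\<nu>) \<le> K + 4 * \<delta>"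
    using 1 2[OF \<mu>] 2[OF \<nu>] by linarith
qed

section \<open>Derivative data for the operators in the system\<close>

lemma grad_has_derivative:
  assumes "f differentiable (at x)"
  shows "(f has_derivative (\<lambda>h. grad f x \<bullet> h)) (at x)"
proof -
  let ?D = "frechet_derivative f (at x)"
  have D: "(f has_derivative ?D) (at x)" using assms by (simp add: frechet_derivative_works)
  then have lin: "linear ?D" by (rule has_derivative_linear)
  have "?D h = grad f x \<bullet> h" for h
  proof -
    have "?D h = ?D (\<Sum>b\<in>Basis. (h \<bullet> b) *\<^sub>R b)" by (simp add: euclidean_representation)
    also have "\<dots> = (\<Sum>b\<in>Basis. (h \<bullet> b) * ?D b)"
      by (simp add: linear_sum[OF lin] linear_cmul[OF lin])
    also have "\<dots> = grad f x \<bullet> h"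
      unfolding grad_def inner_sum_left by (intro sum.cong) (simp_all add: inner_commute mult.commute)
    finally show ?thesis .
  qed
  with D show ?thesis by (metis (no_types, lifting) has_derivative_eq_rhs ext)
qed

lemma grad_eqI:
  assumes "(f has_derivative (\<lambda>h. v \<bullet> h)) (at x)"
  shows "grad f x = v"
  unfolding grad_def frechet_derivative_at[OF assms, symmetric] by (rule euclidean_representation)

lemma deriv_op_apply:
  assumes "V differentiable (at x)"
  shows "blinfun_apply (deriv_op V x) = frechet_derivative V (at x)"
    "(V has_derivative blinfun_apply (deriv_op V x)) (at x)"
proof -
  have D: "(V has_derivative frechet_derivative V (at x)) (at x)"
    using assms by (simp add: frechet_derivative_works)
  then show "blinfun_apply (deriv_op V x) = frechet_derivative V (at x)"
    unfolding deriv_op_def by (intro bounded_linear_Blinfun_apply has_derivative_bounded_linear)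
  with D show "(V has_derivative blinfun_apply (deriv_op V x)) (at x)" by simp
qed

lemma op_trace_deriv_op:
  "V differentiable (at x) \<Longrightarrow> op_trace (blinfun_apply (deriv_op V x)) = divergence V x"
  by (simp add: op_trace_def divergence_def deriv_op_apply(1))

lemma has_grad_hess_of_differentiable:
  assumes "\<And>x. f differentiable (at x)" "\<And>x. grad f differentiable (at x)" "continuous_on UNIV (hess f)"
  shows "has_grad_hess f (grad f) (\<lambda>x. blinfun_apply (hess f x))"
  unfolding has_grad_hess_def
  using grad_has_derivative[OF assms(1)] deriv_op_apply(2)[OF assms(2)] assms(3)
  by (auto simp: hess_def intro!: continuous_intros)

lemma op_trace_hess:
  "grad f differentiable (at x) \<Longrightarrow> op_trace (blinfun_apply (hess f x)) = laplacian f x"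
  by (simp add: hess_def laplacian_def op_trace_deriv_op)

lemma continuous_on_hess:
  assumes "0 < \<alpha>" "C2_holder \<alpha> f"
  shows "continuous_on UNIV (hess f)"
proof -
  have "isCont (hess f) x" for x
  proof -
    obtain C where C: "\<And>z y. z \<in> cball x 1 \<Longrightarrow> y \<in> cball x 1 \<Longrightarrow>
        norm (hess f z - hess f y) \<le> C * dist z y powr \<alpha>"
      using assms(2) compact_cball[of x 1] unfolding C2_holder_def by metis
    have "((\<lambda>y. hess f y - hess f x) \<longlongrightarrow> 0) (at x)"
    proof (rule Lim_null_comparison)
      have "\<forall>\<^sub>F y in at x. y \<in> ball x 1"
        using eventually_at_ball[of 1 x UNIV] by simp
      then show "\<forall>\<^sub>F y in at x. norm (hess f y - hess f x) \<le> C * dist y x powr \<alpha>"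
        by eventually_elim (auto intro!: C)
      have "((\<lambda>y. C * dist y x powr \<alpha>) \<longlongrightarrow> C * dist x x powr \<alpha>) (at x)"
        using assms(1) by (intro tendsto_intros) auto
      then show "((\<lambda>y. C * dist y x powr \<alpha>) \<longlongrightarrow> 0) (at x)"
        using assms(1) by simp
    qed
    then show ?thesis by (simp add: isCont_def LIM_zero_cancel)
  qed
  then show ?thesis by (simp add: continuous_at_imp_continuous_on)
qed

lemma grad_partial:
  fixes H :: "'a::euclidean_space \<Rightarrow> 'a \<Rightarrow> real"
  assumes "(\<lambda>(p, x). H p x) differentiable (at (p, x))"
  shows "grad (\<lambda>q. H q x) p = fst (grad (\<lambda>(p, x). H p x) (p, x))"
    "((\<lambda>q. H q x) has_derivative (\<lambda>h. grad (\<lambda>q. H q x) p \<bullet> h)) (at p)"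
    "((\<lambda>y. H p y) has_derivative (\<lambda>h. grad (H p) x \<bullet> h)) (at x)"
proof -
  let ?G = "grad (\<lambda>(p, x). H p x) (p, x)"
  note D = grad_has_derivative[OF assms]
  have "((\<lambda>q. (q, x)) has_derivative (\<lambda>h. (h, 0))) (at p)"
    by (auto intro!: derivative_eq_intros)
  from has_derivative_compose[OF this D]
  have 1: "((\<lambda>q. H q x) has_derivative (\<lambda>h. fst ?G \<bullet> h)) (at p)"
    by (simp add: inner_prod_def)
  show eq: "grad (\<lambda>q. H q x) p = fst ?G" by (rule grad_eqI[OF 1])
  show "((\<lambda>q. H q x) has_derivative (\<lambda>h. grad (\<lambda>q. H q x) p \<bullet> h)) (at p)"
    unfolding eq by (rule 1)
  have "((\<lambda>y. (p, y)) has_derivative (\<lambda>h. (0, h))) (at x)"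
    by (auto intro!: derivative_eq_intros)
  from has_derivative_compose[OF this D]
  have 2: "((\<lambda>y. H p y) has_derivative (\<lambda>h. snd ?G \<bullet> h)) (at x)"
    by (simp add: inner_prod_def)
  then have "((\<lambda>y. H p y) has_derivative (\<lambda>h. grad (\<lambda>y. H p y) x \<bullet> h)) (at x)"
    using grad_eqI[OF 2] by simp
  then show "((\<lambda>y. H p y) has_derivative (\<lambda>h. grad (H p) x \<bullet> h)) (at x)" by simp
qed

text \<open>The drift is the first component of the joint gradient of \<open>H\<close> along
  \<open>y \<mapsto> (w y, y)\<close>, so the chain rule with the continuous joint Hessian applies.
  It makes the flux in the Fokker-Planck equation continuously differentiable.\<close>

lemma velocity_continuously_differentiable:
  fixes H :: "'a::euclidean_space \<Rightarrow> 'a \<Rightarrow> real"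
  assumes H: "0 < \<alpha>" "C2_holder \<alpha> (\<lambda>(p, x). H p x)"
    and w: "\<And>x. (w has_derivative w' x) (at x)" "\<And>b. continuous_on UNIV (\<lambda>x. w' x b)"
  defines "\<beta> \<equiv> \<lambda>y. grad (\<lambda>p. H p y) (w y)"
  obtains \<beta>' where "\<And>x. (\<beta> has_derivative \<beta>' x) (at x)" "\<And>b. continuous_on UNIV (\<lambda>x. \<beta>' x b)"
proof -
  let ?H = "\<lambda>(p, x). H p x"
  have dH: "?H differentiable (at z)" "grad ?H differentiable (at z)" for z
    using H(2) unfolding C2_holder_def by blast+
  have \<beta>: "\<beta> = (\<lambda>y. fst (grad ?H (w y, y)))"
    unfolding \<beta>_def using grad_partial(1)[OF dH(1)] by simp
  define \<beta>' where "\<beta>' x h = fst (blinfun_apply (hess ?H (w x, x)) (w' x h, h))" for x h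
  have "(\<beta> has_derivative \<beta>' x) (at x)" for x
  proof -
    have "((\<lambda>y. (w y, y)) has_derivative (\<lambda>h. (w' x h, h))) (at x)"
      by (intro has_derivative_Pair w has_derivative_ident)
    from has_derivative_fst[OF has_derivative_compose[OF this deriv_op_apply(2)[OF dH(2)]]]
    show ?thesis unfolding \<beta> \<beta>'_def hess_def by simp
  qed
  moreover have "continuous_on UNIV (\<lambda>x. \<beta>' x b)" for b
  proof -
    have "continuous_on UNIV w" using w(1) by (rule has_derivative_continuous_on)
    then have "continuous_on UNIV (\<lambda>x. hess ?H (w x, x))"
      by (intro continuous_on_compose2[OF continuous_on_hess[OF H]] continuous_intros) auto
    then show ?thesis unfolding \<beta>'_def by (intro continuous_intros w)
  qed
  ultimately show ?thesis using that by blast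
qed

section \<open>Bounds on the Hamiltonian\<close>

text \<open>A convex function lies above its tangent. A unit step in the direction of the gradient
  gives \<open>norm g \<le> h (p + v) - h p\<close>, and the two growth bounds control the
  right-hand side.\<close>

lemma convex_growth_gradient_bound:
  fixes h :: "'a::euclidean_space \<Rightarrow> real"
  assumes cvx: "convex_on UNIV h" and der: "(h has_derivative (\<lambda>v. g \<bullet> v)) (at p)"
    and lower: "\<And>q. - c \<le> h q" and upper: "\<And>q. h q \<le> c * (1 + (norm q)\<^sup>2)" and c: "0 \<le> c"
  shows "norm g \<le> c * (2 + (norm p + 1)\<^sup>2)"
proof (cases "g = 0")
  case True
  then show ?thesis using c by simp
next
  case False
  define v where "v = (1 / norm g) *\<^sub>R g"
  have v: "norm v = 1" "g \<bullet> v = norm g"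
    using False by (auto simp: v_def dot_square_norm power2_eq_square)
  define k where "k s = h (p + s *\<^sub>R v)" for s
  have "convex_on UNIV k"
  proof (rule convex_onI)
    fix t x y :: real assume t: "0 < t" "t < 1"
    have "k ((1 - t) *\<^sub>R x + t *\<^sub>R y) = h ((1 - t) *\<^sub>R (p + x *\<^sub>R v) + t *\<^sub>R (p + y *\<^sub>R v))"
      unfolding k_def by (simp add: algebra_simps)
    also have "\<dots> \<le> (1 - t) * h (p + x *\<^sub>R v) + t * h (p + y *\<^sub>R v)"
      using t by (intro convex_onD[OF cvx]) auto
    finally show "k ((1 - t) *\<^sub>R x + t *\<^sub>R y) \<le> (1 - t) * k x + t * k y" by (simp add: k_def)
  qed simp
  moreover have "(k has_real_derivative norm g) (at 0)"
  proof -
    have "((\<lambda>s. p + s *\<^sub>R v) has_derivative (\<lambda>r. r *\<^sub>R v)) (at 0)"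
      by (auto intro!: derivative_eq_intros)
    moreover have "(h has_derivative (\<lambda>v. g \<bullet> v)) (at (p + 0 *\<^sub>R v))" using der by simp
    ultimately have "(k has_derivative (\<lambda>r. g \<bullet> (r *\<^sub>R v))) (at 0)"
      unfolding k_def by (rule has_derivative_compose)
    then show ?thesis
      unfolding has_field_derivative_def by (rule has_derivative_eq_rhs) (simp add: fun_eq_iff v)
  qed
  ultimately have "k 1 - k 0 \<ge> norm g * (1 - 0)"
    by (intro convex_on_imp_above_tangent[where A = UNIV]) auto
  then have "norm g \<le> h (p + v) - h p" by (simp add: k_def)
  also have "\<dots> \<le> c * (1 + (norm (p + v))\<^sup>2) + c" using upper[of "p + v"] lower[of p] by linarith
  also have "\<dots> \<le> c * (1 + (norm p + 1)\<^sup>2) + c"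
    using c norm_triangle_ineq[of p v] v(1) by (intro add_right_mono mult_left_mono add_left_mono power_mono) auto
  finally show ?thesis by (simp add: algebra_simps)
qed

context
  fixes \<alpha> Co :: real and H :: "real^'n \<Rightarrow> real^'n \<Rightarrow> real"
  assumes \<alpha>: "0 < \<alpha>" and H: "hamiltonian_assms \<alpha> Co H" and Co: "1 \<le> Co"
begin

lemma hamiltonian_differentiable: "(\<lambda>(p, x). H p x) differentiable (at z)"
  using H unfolding hamiltonian_assms_def C2_holder_def by blast

lemma grad_p_bound:
  assumes "norm p \<le> R"
  shows "norm (grad (\<lambda>q. H q x) p) \<le> Co * (2 + (R + 1)\<^sup>2)"
proof -
  have "norm (grad (\<lambda>q. H q x) p) \<le> Co * (2 + (norm p + 1)\<^sup>2)"
    by (rule convex_growth_gradient_bound[OF _ grad_partial(2)[OF hamiltonian_differentiable]])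
      (use H Co in \<open>auto simp: hamiltonian_assms_def\<close>)
  also have "\<dots> \<le> Co * (2 + (R + 1)\<^sup>2)"
    using assms Co by (intro mult_left_mono add_left_mono power_mono) auto
  finally show ?thesis .
qed

lemma hamiltonian_lipschitz_p:
  assumes "norm p \<le> R" "norm q \<le> R"
  shows "\<bar>H p x - H q x\<bar> \<le> Co * (2 + (R + 1)\<^sup>2) * norm (p - q)"
proof -
  have "norm (H p x - H q x) \<le> Co * (2 + (R + 1)\<^sup>2) * norm (p - q)"
  proof (rule differentiable_bound[where S = "cball 0 R" and f' = "\<lambda>z h. grad (\<lambda>q. H q x) z \<bullet> h"])
    show "((\<lambda>q. H q x) has_derivative (\<lambda>h. grad (\<lambda>q. H q x) z \<bullet> h)) (at z within cball 0 R)" for z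
      by (rule has_derivative_at_withinI[OF grad_partial(2)[OF hamiltonian_differentiable]])
    show "onorm (\<lambda>h. grad (\<lambda>q. H q x) z \<bullet> h) \<le> Co * (2 + (R + 1)\<^sup>2)" if "z \<in> cball 0 R" for z
    proof (rule onorm_bound)
      have z: "norm (grad (\<lambda>q. H q x) z) \<le> Co * (2 + (R + 1)\<^sup>2)" using that by (intro grad_p_bound) simp
      show "norm (grad (\<lambda>q. H q x) z \<bullet> h) \<le> Co * (2 + (R + 1)\<^sup>2) * norm h" for h
        using Cauchy_Schwarz_ineq2[of "grad (\<lambda>q. H q x) z" h] mult_right_mono[OF z, of "norm h"] by simp
    qed (use Co in simp)
  qed (use assms in auto)
  then show ?thesis by simp
qed

lemma hamiltonian_lipschitz_x:
  "\<bar>H p x - H p y\<bar> \<le> Co * (1 + norm p) * norm (x - y)"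
proof (rule lipschitz_of_gradient_bound)
  show "((H p) has_derivative (\<lambda>h. grad (H p) z \<bullet> h)) (at z)" for z
    using grad_partial(3)[OF hamiltonian_differentiable] by simp
  show "norm (grad (H p) z) \<le> Co * (1 + norm p)" for z
  proof -
    have "norm (grad (H p) z) + norm (deriv_op (\<lambda>y. grad (\<lambda>q. H q y) p) z) \<le> Co * (1 + norm p)"
      using H unfolding hamiltonian_assms_def by blast
    then show ?thesis by (rule order_trans[rotated]) simp
  qed
qed

end

lemma C21_on_slice:
  assumes "C21_on T f" "t \<in> T"
  shows "has_grad_hess (\<lambda>y. f y t) (grad (\<lambda>y. f y t)) (\<lambda>x. blinfun_apply (hess (\<lambda>y. f y t) x))"
    "op_trace (blinfun_apply (hess (\<lambda>y. f y t) x)) = laplacian (\<lambda>y. f y t) x"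
proof -
  have c: "continuous_on (UNIV \<times> T) (\<lambda>(x, t). hess (\<lambda>y. f y t) x)"
    using assms(1) by (simp add: C21_on_def)
  have "continuous_on UNIV (\<lambda>x. (\<lambda>(x, t). hess (\<lambda>y. f y t) x) (x, t))"
    by (rule continuous_on_compose2[OF c]) (use assms(2) in \<open>auto intro!: continuous_intros\<close>)
  then show "has_grad_hess (\<lambda>y. f y t) (grad (\<lambda>y. f y t)) (\<lambda>x. blinfun_apply (hess (\<lambda>y. f y t) x))"
    using assms by (intro has_grad_hess_of_differentiable) (auto simp: C21_on_def)
  show "op_trace (blinfun_apply (hess (\<lambda>y. f y t) x)) = laplacian (\<lambda>y. f y t) x"
    using assms by (intro op_trace_hess) (auto simp: C21_on_def)
qed

lemma C21_on_time_deriv: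
  assumes "C21_on T f" "t \<in> T" "S \<subseteq> {0..}"
  shows "(f x has_real_derivative time_deriv f x t) (at t within S)"
proof -
  have "f x differentiable (at t within {0..})" using assms by (auto simp: C21_on_def)
  then have "(f x has_vector_derivative time_deriv f x t) (at t within {0..})"
    unfolding time_deriv_def by (simp add: vector_derivative_works)
  then have "(f x has_real_derivative time_deriv f x t) (at t within {0..})"
    by (simp add: has_real_derivative_iff_has_vector_derivative)
  then show ?thesis using assms(3) by (rule DERIV_subset)
qed

text \<open>The drift is \<open>D_p H\<close> evaluated in the ball of radius \<open>R\<close>,
  hence bounded by \<open>grad_p_bound\<close>; this is the constant \<open>C\<close> of the test
  estimate, and \<open>CARD('n) / \<delta>\<close> is its \<open>\<kappa>\<close>. The start
  \<open>a\<close> is positive because densities exist only for positive times.\<close>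

lemma d1_time_estimate:
  fixes H :: "real^'n \<Rightarrow> real^'n \<Rightarrow> real"
  assumes \<alpha>: "0 < \<alpha>" and H: "hamiltonian_assms \<alpha> Co H" and Co: "1 \<le> Co"
    and u: "C21_on {0..} u" and fp: "FP_solution lam H m0 u m"
    and R: "\<And>x t. 0 \<le> t \<Longrightarrow> norm (lam *\<^sub>R grad (\<lambda>y. u y t) x) \<le> R"
    and t: "0 < a" "a \<le> b" and \<delta>: "0 < \<delta>"
  shows "d1 (m b) (m a) \<le> (CARD('n) / \<delta> + Co * (2 + (R + 1)\<^sup>2)) * (b - a) + 4 * \<delta>"
proof -
  obtain \<rho> where \<rho>: "C21_on {0<..} \<rho>" "\<And>x t. 0 < t \<Longrightarrow> 0 \<le> \<rho> x t"
    "\<And>t. 0 < t \<Longrightarrow> m t = density lborel (\<lambda>x. ennreal (\<rho> x t))"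
    "\<And>x t. 0 < t \<Longrightarrow> time_deriv \<rho> x t - laplacian (\<lambda>y. \<rho> y t) x
       - divergence (\<lambda>y. \<rho> y t *\<^sub>R grad (\<lambda>p. H p y) (lam *\<^sub>R grad (\<lambda>z. u z t) y)) x = 0"
    using fp unfolding FP_solution_def by blast
  have P1: "m t \<in> P1" if "0 \<le> t" for t using fp that by (simp add: FP_solution_def)
  define \<beta> where "\<beta> y t = grad (\<lambda>p. H p y) (lam *\<^sub>R grad (\<lambda>z. u z t) y)" for y t
  have sl: "has_grad_hess (\<lambda>y. \<rho> y t) (grad (\<lambda>y. \<rho> y t)) (\<lambda>x. blinfun_apply (hess (\<lambda>y. \<rho> y t) x))"
    if "0 < t" for t using C21_on_slice(1)[OF \<rho>(1)] that by simp
  have "\<exists>V'. (\<forall>x. ((\<lambda>y. \<rho> y t *\<^sub>R \<beta> y t) has_derivative V' x) (at x)) \<and>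
      (\<forall>v. continuous_on UNIV (\<lambda>x. V' x v))" if "0 < t" for t
  proof -
    have us: "has_grad_hess (\<lambda>y. u y t) (grad (\<lambda>y. u y t)) (\<lambda>x. blinfun_apply (hess (\<lambda>y. u y t) x))"
      using C21_on_slice(1)[OF u] that by simp
    have "((\<lambda>y. lam *\<^sub>R grad (\<lambda>z. u z t) y) has_derivative
        (\<lambda>h. lam *\<^sub>R blinfun_apply (hess (\<lambda>y. u y t) x) h)) (at x)" for x
      using us by (intro has_derivative_scaleR_right) (simp add: has_grad_hess_def)
    moreover have "continuous_on UNIV (\<lambda>x. lam *\<^sub>R blinfun_apply (hess (\<lambda>y. u y t) x) v)" for v
      by (rule continuous_on_scaleR[OF continuous_on_const has_grad_hess_continuous(3)[OF us]])
    ultimately obtain \<beta>' where \<beta>': "\<And>x. ((\<lambda>y. \<beta> y t) has_derivative \<beta>' x) (at x)"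
      "\<And>v. continuous_on UNIV (\<lambda>x. \<beta>' x v)"
      unfolding \<beta>_def using H
      by (elim velocity_continuously_differentiable[OF \<alpha>, rotated -1]) (auto simp: hamiltonian_assms_def)
    have "((\<lambda>y. \<rho> y t *\<^sub>R \<beta> y t) has_derivative
        (\<lambda>h. \<rho> x t *\<^sub>R \<beta>' x h + (grad (\<lambda>y. \<rho> y t) x \<bullet> h) *\<^sub>R \<beta> x t)) (at x)" for x
      using sl[OF that] by (intro has_derivative_scaleR \<beta>') (simp add: has_grad_hess_def)
    moreover have "continuous_on UNIV (\<lambda>x. \<rho> x t *\<^sub>R \<beta>' x v + (grad (\<lambda>y. \<rho> y t) x \<bullet> v) *\<^sub>R \<beta> x t)" for v
      by (intro continuous_intros has_grad_hess_continuous[OF sl[OF that]] \<beta>'(2)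
          has_derivative_continuous_on[OF \<beta>'(1)])
    ultimately show ?thesis
      by (intro exI[of _ "\<lambda>x h. \<rho> x t *\<^sub>R \<beta>' x h + (grad (\<lambda>y. \<rho> y t) x \<bullet> h) *\<^sub>R \<beta> x t"]) simp
  qed
  then have "\<forall>t\<in>{0<..}. \<exists>V'. (\<forall>x. ((\<lambda>y. \<rho> y t *\<^sub>R \<beta> y t) has_derivative V' x) (at x)) \<and>
      (\<forall>v. continuous_on UNIV (\<lambda>x. V' x v))" by simp
  from bchoice[OF this] obtain V' where
    "\<forall>t\<in>{0<..}. (\<forall>x. ((\<lambda>y. \<rho> y t *\<^sub>R \<beta> y t) has_derivative V' t x) (at x)) \<and>
      (\<forall>v. continuous_on UNIV (\<lambda>x. V' t x v))" by blast
  then have V': "\<And>t x. 0 < t \<Longrightarrow> ((\<lambda>y. \<rho> y t *\<^sub>R \<beta> y t) has_derivative V' t x) (at x)"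
    "\<And>t v. 0 < t \<Longrightarrow> continuous_on UNIV (\<lambda>x. V' t x v)"
    by simp_all
  have div: "divergence (\<lambda>y. \<rho> y t *\<^sub>R \<beta> y t) x = op_trace (V' t x)" if "0 < t" for t x
    unfolding divergence_def op_trace_def frechet_derivative_at[OF V'(1)[OF that], symmetric] ..
  have dens: "(\<integral>x. \<psi> x \<partial>m t) = (\<integral>x. \<psi> x * \<rho> x t \<partial>lborel)"
    if "0 < t" "\<psi> \<in> borel_measurable borel" for t and \<psi> :: "real^'n \<Rightarrow> real"
  proof -
    have "(\<lambda>x. \<rho> x t) \<in> borel_measurable borel"
      using has_grad_hess_continuous(1)[OF sl[OF that(1)]] by (rule borel_measurable_continuous_onI)
    then show ?thesis unfolding \<rho>(3)[OF that(1)] using that \<rho>(2)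
      by (subst integral_density) (auto simp: mult.commute)
  qed
  have mass: "integrable lborel (\<lambda>x. \<rho> x t)" "(\<integral>x. \<rho> x t \<partial>lborel) = 1" if "0 < t" for t
  proof -
    interpret prob_space "m t" using P1[of t] that by (simp add: P1_def)
    have [measurable]: "(\<lambda>x. \<rho> x t) \<in> borel_measurable borel"
      using has_grad_hess_continuous(1)[OF sl[OF that(1)]] by (rule borel_measurable_continuous_onI)
    have "(\<integral>\<^sup>+ x. ennreal (\<rho> x t) \<partial>lborel) = emeasure (m t) (space (m t))"
      unfolding \<rho>(3)[OF that] by (subst emeasure_density) auto
    then have "(\<integral>\<^sup>+ x. ennreal (\<rho> x t) \<partial>lborel) = 1" using emeasure_space_1 by simp
    then show "integrable lborel (\<lambda>x. \<rho> x t)" "(\<integral>x. \<rho> x t \<partial>lborel) = 1"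
      using \<rho>(2)[OF that] by (auto intro!: integrableI_nonneg simp: integral_eq_nn_integral)
  qed
  have sub: "{a..b} \<subseteq> {0<..}" "{a..b} \<subseteq> {0..}" using t by auto
  have ct: "continuous_on (UNIV \<times> {a..b}) (\<lambda>(x, t). time_deriv \<rho> x t)"
    using \<rho>(1) sub(1) unfolding C21_on_def
    by (auto elim: continuous_on_subset)
  have K: "0 \<le> (CARD('n) / \<delta> + Co * (2 + (R + 1)\<^sup>2)) * (b - a)"
    using t \<delta> Co by simp
  show ?thesis
  proof (rule d1_le_of_semiconcave_tests[OF P1 P1 \<delta> K])
    fix \<psi> :: "real^'n \<Rightarrow> real" and S
    assume \<psi>: "lip_semiconcave (DIM(real^'n) / \<delta>) \<psi>" and supp: "\<And>x. S < norm x \<Longrightarrow> \<psi> x = 0"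
    have "\<bar>\<psi> x - \<psi> y\<bar> \<le> 1 * dist x y" for x y using lip_semiconcave_lipschitz[OF \<psi>] by simp
    then have \<psi>m: "\<psi> \<in> borel_measurable borel"
      using integrable_lipschitz_P1(1)[OF P1[of a], of \<psi> 1] t by simp
    have "(\<integral>x. \<psi> x * \<rho> x b \<partial>lborel) - (\<integral>x. \<psi> x * \<rho> x a \<partial>lborel)
        \<le> (DIM(real^'n) / \<delta> + Co * (2 + (R + 1)\<^sup>2)) * (b - a)"
    proof (rule fokker_planck_test_estimate[OF t(2), where \<beta> = \<beta> and V' = V' and \<rho>' = "time_deriv \<rho>"])
      fix x s assume "s \<in> {a..b}"
      then have s: "0 < s" using t by simp
      show "has_grad_hess (\<lambda>y. \<rho> y s) (grad (\<lambda>y. \<rho> y s)) (\<lambda>x. blinfun_apply (hess (\<lambda>y. \<rho> y s) x))"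
        by (rule sl[OF s])
      show "(\<rho> x has_real_derivative time_deriv \<rho> x s) (at s within {a..b})"
        using C21_on_time_deriv[OF \<rho>(1) _ sub(2)] s by simp
      show "time_deriv \<rho> x s = op_trace (blinfun_apply (hess (\<lambda>y. \<rho> y s) x)) + op_trace (V' s x)"
        using \<rho>(4)[OF s, of x] div[OF s, of x] C21_on_slice(2)[OF \<rho>(1), of s x] s
        by (simp add: \<beta>_def)
      show "norm (\<beta> x s) \<le> Co * (2 + (R + 1)\<^sup>2)"
        unfolding \<beta>_def using s by (intro grad_p_bound[OF \<alpha> H Co] R) simp
    qed (use t V' \<rho>(2) mass ct \<psi> supp in auto)
    then show "(\<integral>x. \<psi> x \<partial>m b) - (\<integral>x. \<psi> x \<partial>m a) \<le> (CARD('n) / \<delta> + Co * (2 + (R + 1)\<^sup>2)) * (b - a)"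
      using t \<psi>m by (simp add: dens)
  qed (use t in auto)
qed

section \<open>The maximum principle and the gradient estimate\<close>

lemma second_derivative_at_max:
  fixes g g' :: "real \<Rightarrow> real"
  assumes g: "\<And>s. (g has_real_derivative g' s) (at s)" and g': "(g' has_real_derivative c) (at 0)"
    and max: "\<And>s. g s \<le> g 0"
  shows "g' 0 = 0" "c \<le> 0"
proof -
  show 0: "g' 0 = 0"
    by (rule DERIV_local_max[OF g zero_less_one]) (simp add: max)
  show "c \<le> 0"
  proof (rule ccontr)
    assume "\<not> c \<le> 0"
    then obtain e where e: "e > 0" "\<And>s. 0 < s \<Longrightarrow> s < e \<Longrightarrow> g' 0 < g' (0 + s)"
      using has_real_derivative_pos_inc_right[OF g'] by force
    have "\<exists>z. z > 0 \<and> z < e / 2 \<and> g (e / 2) - g 0 = (e / 2 - 0) * g' z"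
      by (rule MVT2) (use e g in auto)
    then obtain z where z: "0 < z" "z < e / 2" "g (e / 2) - g 0 = e / 2 * g' z" by auto
    have "0 < g' z" using e(2)[of z] z e(1) 0 by simp
    then have "0 < e / 2 * g' z" using e(1) by simp
    then show False using z(3) max[of "e / 2"] by linarith
  qed
qed

lemma op_trace_nonpos_at_max:
  assumes f: "has_grad_hess f G D" and max: "\<And>y. f y \<le> f x"
  shows "G x = 0" "op_trace (D x) \<le> 0"
proof -
  note f' = f[unfolded has_grad_hess_def, THEN conjunct1, rule_format]
    and G' = f[unfolded has_grad_hess_def, THEN conjunct2, THEN conjunct1, rule_format]
  have *: "G x \<bullet> b = 0 \<and> D x b \<bullet> b \<le> 0" if "b \<in> Basis" for b
  proof -
    have line: "((\<lambda>s. x + s *\<^sub>R b) has_derivative (\<lambda>r. r *\<^sub>R b)) (at s)" for s :: real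
      by (auto intro!: derivative_eq_intros)
    have 1: "((\<lambda>s. f (x + s *\<^sub>R b)) has_real_derivative G (x + s *\<^sub>R b) \<bullet> b) (at s)" for s
      using has_derivative_compose[OF line f'] unfolding has_field_derivative_def
      by (rule has_derivative_eq_rhs) (simp add: fun_eq_iff)
    have "((\<lambda>s. G (x + s *\<^sub>R b) \<bullet> b) has_derivative (\<lambda>r. D (x + 0 *\<^sub>R b) (r *\<^sub>R b) \<bullet> b)) (at 0)"
      by (intro has_derivative_inner_left has_derivative_compose[OF line G'])
    then have 2: "((\<lambda>s. G (x + s *\<^sub>R b) \<bullet> b) has_real_derivative D x b \<bullet> b) (at 0)"
      unfolding has_field_derivative_def
      by (rule has_derivative_eq_rhs)
        (simp add: fun_eq_iff linear_cmul[OF has_derivative_linear[OF G'[of x]]])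
    show ?thesis using second_derivative_at_max[OF 1 2] max by simp
  qed
  then show "G x = 0" by (simp add: euclidean_eq_iff[of "G x"])
  show "op_trace (D x) \<le> 0" unfolding op_trace_def using * by (intro sum_nonpos) auto
qed

text \<open>Comparison with later times only: the penalty controls the future of \<open>t0\<close>,
  and this one-sided condition remains available when the maximum sits at \<open>t0\<close>. Its
  sign is the one required by the backward equation.\<close>

lemma right_derivative_at_max:
  fixes f :: "real \<Rightarrow> real"
  assumes "(f has_real_derivative c) (at t within {t..})" and "\<And>s. t \<le> s \<Longrightarrow> f s \<le> f t"
  shows "c \<le> 0"
proof (rule ccontr)
  assume "\<not> c \<le> 0"
  then obtain d where "d > 0" "\<And>h. 0 < h \<Longrightarrow> t + h \<in> {t..} \<Longrightarrow> h < d \<Longrightarrow> f t < f (t + h)"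
    using has_real_derivative_pos_inc_right[OF assms(1)] by force
  from this(2)[of "d / 2"] this(1) assms(2)[of "t + d / 2"] show False by simp
qed

lemma has_grad_hess_shift:
  assumes "has_grad_hess f G D"
  shows "has_grad_hess (\<lambda>x. f (x + h)) (\<lambda>x. G (x + h)) (\<lambda>x. D (x + h))"
proof -
  have line: "((\<lambda>x. x + h) has_derivative (\<lambda>k. k)) (at x)" for x
    by (auto intro!: derivative_eq_intros)
  have "continuous_on UNIV (\<lambda>x. D (x + h) b)" for b
    using assms unfolding has_grad_hess_def
    by (intro continuous_on_compose2[of UNIV "\<lambda>x. D x b" _ "\<lambda>x. x + h"] continuous_intros) auto
  moreover have "((\<lambda>x. f (x + h)) has_derivative (\<lambda>k. G (x + h) \<bullet> k)) (at x)" for x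
    using assms by (intro has_derivative_compose[OF line]) (simp add: has_grad_hess_def)
  moreover have "((\<lambda>x. G (x + h)) has_derivative D (x + h)) (at x)" for x
    using assms by (intro has_derivative_compose[OF line]) (simp add: has_grad_hess_def)
  ultimately show ?thesis by (simp add: has_grad_hess_def)
qed

lemma has_grad_hess_diff:
  assumes "has_grad_hess f G D" "has_grad_hess g P Q"
  shows "has_grad_hess (\<lambda>x. f x - g x) (\<lambda>x. G x - P x) (\<lambda>x h. D x h - Q x h)"
proof -
  have "((\<lambda>x. f x - g x) has_derivative (\<lambda>h. (G x - P x) \<bullet> h)) (at x)" for x
    unfolding inner_diff_left using assms by (intro has_derivative_diff) (auto simp: has_grad_hess_def)
  moreover have "((\<lambda>x. G x - P x) has_derivative (\<lambda>h. D x h - Q x h)) (at x)" for x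
    using assms by (intro has_derivative_diff) (auto simp: has_grad_hess_def)
  moreover have "continuous_on UNIV (\<lambda>x. D x h - Q x h)" for h
    by (intro continuous_on_diff has_grad_hess_continuous(3)[OF assms(1)] has_grad_hess_continuous(3)[OF assms(2)])
  ultimately show ?thesis by (simp add: has_grad_hess_def)
qed

lemma has_grad_hess_scale:
  assumes "has_grad_hess f G D"
  shows "has_grad_hess (\<lambda>x. c * f x) (\<lambda>x. c *\<^sub>R G x) (\<lambda>x h. c *\<^sub>R D x h)"
proof -
  have "((\<lambda>x. c * f x) has_derivative (\<lambda>h. (c *\<^sub>R G x) \<bullet> h)) (at x)" for x
    unfolding inner_scaleR_left using assms by (intro has_derivative_mult_right) (simp add: has_grad_hess_def)
  moreover have "((\<lambda>x. c *\<^sub>R G x) has_derivative (\<lambda>h. c *\<^sub>R D x h)) (at x)" for x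
    using assms by (intro has_derivative_scaleR_right) (simp add: has_grad_hess_def)
  moreover have "continuous_on UNIV (\<lambda>x. c *\<^sub>R D x h)" for h
    by (intro continuous_on_scaleR continuous_on_const has_grad_hess_continuous(3)[OF assms(1)])
  ultimately show ?thesis by (simp add: has_grad_hess_def)
qed

text \<open>Upper bounds on forward increments in all unit directions include the direction of
  \<open>g\<close> itself, where the derivative equals \<open>norm g\<close>.\<close>

lemma norm_gradient_le:
  fixes f :: "'a::euclidean_space \<Rightarrow> real"
  assumes der: "(f has_derivative (\<lambda>h. g \<bullet> h)) (at x)" and c: "0 \<le> c"
    and le: "\<And>e s. norm e = 1 \<Longrightarrow> 0 < s \<Longrightarrow> f (x + s *\<^sub>R e) - f x \<le> s * c"
  shows "norm g \<le> c"
proof (cases "g = 0")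
  case False
  define e where "e = (1 / norm g) *\<^sub>R g"
  have e: "norm e = 1" "g \<bullet> e = norm g"
    using False by (auto simp: e_def dot_square_norm power2_eq_square)
  have "((\<lambda>s. x + s *\<^sub>R e) has_derivative (\<lambda>r. r *\<^sub>R e)) (at 0)"
    by (auto intro!: derivative_eq_intros)
  moreover have "(f has_derivative (\<lambda>h. g \<bullet> h)) (at (x + 0 *\<^sub>R e))" using der by simp
  ultimately have "((\<lambda>s. f (x + s *\<^sub>R e)) has_derivative (\<lambda>r. g \<bullet> (r *\<^sub>R e))) (at 0)"
    by (rule has_derivative_compose)
  then have "((\<lambda>s. f (x + s *\<^sub>R e)) has_real_derivative norm g) (at 0)"
    unfolding has_field_derivative_def by (rule has_derivative_eq_rhs) (simp add: fun_eq_iff e)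
  then have "((\<lambda>s. (f (x + s *\<^sub>R e) - f x) / s) \<longlongrightarrow> norm g) (at 0)" by (simp add: DERIV_def)
  then have "((\<lambda>s. (f (x + s *\<^sub>R e) - f x) / s) \<longlongrightarrow> norm g) (at_right 0)"
    by (rule tendsto_within_subset) simp
  moreover have "\<forall>\<^sub>F s in at_right 0. (f (x + s *\<^sub>R e) - f x) / s \<le> c"
    using eventually_at_right_less[of 0]
  proof eventually_elim
    case (elim s)
    then show ?case using le[OF e(1) elim] by (simp add: field_simps)
  qed
  ultimately show ?thesis by (rule tendsto_upperbound) simp
qed (use c in simp)

lemma d1_self: "\<mu> \<in> P1 \<Longrightarrow> d1 \<mu> \<mu> \<le> 0"
  by (rule d1_le_of_dual_bound) auto

text \<open>Maximum principle for the increment \<open>w x t = u (x + h) t - u x t\<close>: subtracting from \<open>w\<close> a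
  multiple of \<open>(t - t0) + soft_norm \<delta> (x - x0)\<close>, which is coercive, forces the maximum to be attained.\<close>

lemma increment_estimate:
  fixes H :: "real^'n \<Rightarrow> real^'n \<Rightarrow> real"
  assumes \<alpha>: "0 < \<alpha>" and H: "hamiltonian_assms \<alpha> Co H" and Co: "1 \<le> Co" and lam: "0 < lam"
    and hjb: "HJB_solution lam F H u m"
    and R: "\<And>x t. 0 \<le> t \<Longrightarrow> norm (lam *\<^sub>R grad (\<lambda>y. u y t) x) \<le> R"
    and t0: "0 < t0" and \<delta>: "0 < \<delta>" and b: "0 < b" and d: "0 < d"
    and F: "\<And>x t. t0 \<le> t \<Longrightarrow> F (x + h) (m t) - F x (m t) \<le> a + b * (t - t0) + d * soft_norm \<delta> (x - x0)"
  defines "C \<equiv> Co * (2 + (R + 1)\<^sup>2)"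
  shows "lam * (u (x0 + h) t0 - u x0 t0)
    \<le> a + (b + d * (CARD('n) / \<delta>) + C * d + Co * (1 + R) * norm h) / lam + d * \<delta>"
proof -
  have u: "C21_on {0..} u" and eq: "\<And>x t. 0 < t \<Longrightarrow> - time_deriv u x t - laplacian (\<lambda>y. u y t) x
        + 1 / lam * H (lam *\<^sub>R grad (\<lambda>y. u y t) x) x + lam * u x t = F x (m t)"
    using hjb by (auto simp: HJB_solution_def)
  note us = C21_on_slice(1)[OF u]
  define \<zeta> where "\<zeta> x = soft_norm \<delta> (x - x0)" for x
  obtain G D where \<zeta>: "has_grad_hess \<zeta> G D" "\<And>x. norm (G x) \<le> 1" "\<And>x. op_trace (D x) \<le> CARD('n) / \<delta>"
    unfolding \<zeta>_def using lip_semiconcave_soft_norm[OF \<delta>, of x0] by (auto simp: lip_semiconcave_def)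
  have \<zeta>b: "0 \<le> \<zeta> x" "norm (x - x0) \<le> \<zeta> x" "\<zeta> x0 = \<delta>" for x
    using soft_norm_bounds[OF \<delta>, of "x - x0"] soft_norm_0[OF \<delta>] \<delta> by (auto simp: \<zeta>_def)
  define w where "w x t = u (x + h) t - u x t" for x t
  \<comment> \<open>The slopes are those in \<open>F\<close> divided by \<open>lam\<close>, so that
    in \<open>lam * v\<close> they cancel the growing part of the increment of
    \<open>F\<close>.\<close>
  define v where "v x t = w x t - b / lam * (t - t0) - d / lam * \<zeta> x" for x t
  define B where "B = R / lam * norm h"
  have wB: "\<bar>w x t\<bar> \<le> B" if "0 \<le> t" for x t
  proof -
    have "\<bar>u (x + h) t - u x t\<bar> \<le> R / lam * norm (x + h - x)"
    proof (rule lipschitz_of_gradient_bound)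
      show "((\<lambda>y. u y t) has_derivative (\<lambda>h. grad (\<lambda>y. u y t) x \<bullet> h)) (at x)" for x
        using us that by (simp add: has_grad_hess_def)
      show "norm (grad (\<lambda>y. u y t) x) \<le> R / lam" for x
        using R[OF that, of x] lam by (simp add: field_simps)
    qed
    then show ?thesis by (simp add: w_def B_def)
  qed
  \<comment> \<open>Once the penalty reaches \<open>S\<close> it outweighs the oscillation
    \<open>2 * B\<close> of \<open>w\<close> and the value \<open>d / lam * \<delta>\<close> of the
    penalty at \<open>(x0, t0)\<close>; the set \<open>K\<close> contains every point where it is
    smaller.\<close>
  define S where "S = 2 * B + d / lam * \<delta>"
  have S: "0 \<le> S" using wB[of 0 x0] d lam \<delta> by (simp add: S_def)
  define K where "K = cball x0 (lam * S / d) \<times> {t0..t0 + lam * S / b}"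
  have K0: "(x0, t0) \<in> K" using S b d lam by (simp add: K_def)
  have outside: "v x t \<le> v x0 t0" if "t0 \<le> t" "(x, t) \<notin> K" for x t
  proof -
    have "S \<le> b / lam * (t - t0) + d / lam * \<zeta> x"
    proof (cases "x \<in> cball x0 (lam * S / d)")
      case True
      then have "lam * S / b \<le> t - t0" using that by (auto simp: K_def)
      then have "S \<le> b / lam * (t - t0)" using b lam by (simp add: field_simps)
      moreover have "0 \<le> d / lam * \<zeta> x" using d lam \<zeta>b(1)[of x] by simp
      ultimately show ?thesis by linarith
    next
      case False
      then have "lam * S / d \<le> \<zeta> x" using \<zeta>b(2)[of x] by (simp add: dist_norm norm_minus_commute)
      then have "S \<le> d / lam * \<zeta> x" using d lam by (simp add: field_simps)
      moreover have "0 \<le> b / lam * (t - t0)" using b lam that by simp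
      ultimately show ?thesis by linarith
    qed
    then show ?thesis
      using wB[of t x] wB[of t0 x0] that t0 \<zeta>b(3) by (simp add: v_def S_def abs_le_iff)
  qed
  have "continuous_on K (\<lambda>z. v (fst z) (snd z))"
  proof -
    have cu: "continuous_on (UNIV \<times> {0..}) (\<lambda>(x, t). u x t)" using u by (simp add: C21_on_def)
    have "continuous_on K (\<lambda>z. (\<lambda>(x, t). u x t) (fst z + k, snd z))" for k
      using t0 by (intro continuous_on_compose2[OF cu]) (auto intro!: continuous_intros simp: K_def)
    from this[of h] this[of 0]
    have "continuous_on K (\<lambda>z. u (fst z + h) (snd z))" "continuous_on K (\<lambda>z. u (fst z) (snd z))"
      by (simp_all add: split_def)
    moreover have "continuous_on K (\<lambda>z. \<zeta> (fst z))"
      by (rule continuous_on_compose2[OF has_grad_hess_continuous(1)[OF \<zeta>(1), of UNIV]])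
        (auto intro!: continuous_intros)
    ultimately show ?thesis unfolding v_def w_def by (intro continuous_intros)
  qed
  moreover have "compact K" unfolding K_def by (intro compact_Times compact_cball compact_Icc)
  ultimately obtain z where z: "z \<in> K" "\<And>y. y \<in> K \<Longrightarrow> v (fst y) (snd y) \<le> v (fst z) (snd z)"
    using continuous_attains_sup[of K "\<lambda>z. v (fst z) (snd z)"] K0 by blast
  obtain x1 t1 where z1: "z = (x1, t1)" by (cases z)
  have t1: "t0 \<le> t1" using z(1) by (simp add: z1 K_def)
  have max: "v x t \<le> v x1 t1" if "t0 \<le> t" for x t
  proof (cases "(x, t) \<in> K")
    case True
    then show ?thesis using z(2)[of "(x, t)"] by (simp add: z1)
  next
    case False
    then show ?thesis using outside[OF that False] z(2)[OF K0] by (simp add: z1)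
  qed
  define P where "P = lam *\<^sub>R grad (\<lambda>y. u y t1) (x1 + h)"
  define Q where "Q = lam *\<^sub>R grad (\<lambda>y. u y t1) x1"
  have PQ: "norm P \<le> R" "norm Q \<le> R" unfolding P_def Q_def using R[of t1] t1 t0 by auto
  have "has_grad_hess (\<lambda>x. u (x + h) t1 - u x t1 - d / lam * \<zeta> x)
    (\<lambda>x. grad (\<lambda>y. u y t1) (x + h) - grad (\<lambda>y. u y t1) x - (d / lam) *\<^sub>R G x)
    (\<lambda>x k. blinfun_apply (hess (\<lambda>y. u y t1) (x + h)) k - blinfun_apply (hess (\<lambda>y. u y t1) x) k - (d / lam) *\<^sub>R D x k)"
    using t1 t0 by (intro has_grad_hess_diff has_grad_hess_scale has_grad_hess_shift us \<zeta>(1)) auto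
  note sp = op_trace_nonpos_at_max[OF this, of x1]
  have sm: "u (x + h) t1 - u x t1 - d / lam * \<zeta> x \<le> u (x1 + h) t1 - u x1 t1 - d / lam * \<zeta> x1" for x
    using max[OF t1, of x] by (simp add: v_def w_def)
  \<comment> \<open>First-order condition: the scaled gradients at \<open>x1 + h\<close> and
    \<open>x1\<close> differ by \<open>d\<close> times the gradient of the soft cone. The momentum
    part of the Hamiltonian difference is therefore at most \<open>C * d\<close>.\<close>
  have "P - Q = lam *\<^sub>R (grad (\<lambda>y. u y t1) (x1 + h) - grad (\<lambda>y. u y t1) x1)"
    by (simp add: P_def Q_def scaleR_diff_right)
  also have "grad (\<lambda>y. u y t1) (x1 + h) - grad (\<lambda>y. u y t1) x1 = (d / lam) *\<^sub>R G x1"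
    using sp(1)[OF sm] by simp
  finally have "norm (P - Q) = d * norm (G x1)" using lam d by simp
  also have "\<dots> \<le> d * 1" using \<zeta>(2) d by (intro mult_left_mono) auto
  finally have nPQ: "norm (P - Q) \<le> d" by simp
  have lapl: "laplacian (\<lambda>y. u y t1) (x1 + h) - laplacian (\<lambda>y. u y t1) x1 \<le> d / lam * (CARD('n) / \<delta>)"
  proof -
    have "laplacian (\<lambda>y. u y t1) (x1 + h) - laplacian (\<lambda>y. u y t1) x1 - d / lam * op_trace (D x1) \<le> 0"
      using sp(2)[OF sm] t1 t0 C21_on_slice(2)[OF u, of t1]
      by (simp add: op_trace_diff op_trace_scaleR del: scaleR_scaleR)
    moreover have "d / lam * op_trace (D x1) \<le> d / lam * (CARD('n) / \<delta>)"
      using \<zeta>(3) d lam by (intro mult_left_mono) auto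
    ultimately show ?thesis by linarith
  qed
  have time: "time_deriv u (x1 + h) t1 - time_deriv u x1 t1 - b / lam \<le> 0"
  proof (rule right_derivative_at_max)
    show "((\<lambda>t. u (x1 + h) t - u x1 t - b / lam * (t - t0)) has_real_derivative
        time_deriv u (x1 + h) t1 - time_deriv u x1 t1 - b / lam) (at t1 within {t1..})"
      using t1 t0 lam by (auto intro!: derivative_eq_intros C21_on_time_deriv[OF u])
    show "u (x1 + h) s - u x1 s - b / lam * (s - t0) \<le> u (x1 + h) t1 - u x1 t1 - b / lam * (t1 - t0)"
      if "t1 \<le> s" for s using max[of s x1] that t1 by (simp add: v_def w_def)
  qed
  have "H Q x1 - H P (x1 + h) \<le> C * d + Co * (1 + R) * norm h"
  proof -
    have "H Q (x1 + h) - H P (x1 + h) \<le> C * norm (P - Q)"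
      using hamiltonian_lipschitz_p[OF \<alpha> H Co PQ, of "x1 + h"] by (simp add: C_def abs_le_iff)
    also have "\<dots> \<le> C * d" using nPQ Co by (intro mult_left_mono) (auto simp: C_def)
    finally have 1: "H Q (x1 + h) - H P (x1 + h) \<le> C * d" .
    have "H Q x1 - H Q (x1 + h) \<le> Co * (1 + norm Q) * norm h"
      using hamiltonian_lipschitz_x[OF \<alpha> H Co, of Q x1 "x1 + h"] by (simp add: abs_le_iff)
    also have "\<dots> \<le> Co * (1 + R) * norm h"
      using PQ Co by (intro mult_right_mono mult_left_mono) auto
    finally show ?thesis using 1 by linarith
  qed
  then have "1 / lam * (H Q x1 - H P (x1 + h)) \<le> 1 / lam * (C * d + Co * (1 + R) * norm h)"
    using lam by (intro mult_left_mono) auto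
  then have ham: "1 / lam * H Q x1 - 1 / lam * H P (x1 + h) \<le> (C * d + Co * (1 + R) * norm h) / lam"
    by (simp add: right_diff_distrib diff_divide_distrib)
  \<comment> \<open>The two Hamilton-Jacobi equations at \<open>x1 + h\<close> and \<open>x1\<close>
    are subtracted. Time derivative, Laplacian and Hamiltonian each contribute a term of order
    \<open>1 / lam\<close>.\<close>
  have "lam * w x1 t1 \<le> a + b * (t1 - t0) + d * \<zeta> x1
      + b / lam + d / lam * (CARD('n) / \<delta>) + (C * d + Co * (1 + R) * norm h) / lam"
    using eq[of t1 "x1 + h"] eq[of t1 x1] t1 t0 F[OF t1, of x1] time lapl ham
    unfolding P_def[symmetric] Q_def[symmetric] \<zeta>_def[symmetric] w_def right_diff_distrib by simp
  moreover have "lam * v x1 t1 = lam * w x1 t1 - b * (t1 - t0) - d * \<zeta> x1"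
    using lam by (simp add: v_def field_simps)
  ultimately have "lam * v x1 t1 \<le> a + b / lam + d / lam * (CARD('n) / \<delta>) + (C * d + Co * (1 + R) * norm h) / lam"
    by linarith
  also have "\<dots> = a + (b + d * (CARD('n) / \<delta>) + C * d + Co * (1 + R) * norm h) / lam"
    by (simp add: add_divide_distrib)
  finally have "lam * v x1 t1 \<le> a + (b + d * (CARD('n) / \<delta>) + C * d + Co * (1 + R) * norm h) / lam" .
  moreover have "lam * v x0 t0 \<le> lam * v x1 t1" using max[of t0 x0] lam by simp
  moreover have "lam * v x0 t0 = lam * (u (x0 + h) t0 - u x0 t0) - d * \<delta>"
    using lam by (simp add: v_def w_def \<zeta>b(3) field_simps)
  ultimately show ?thesis by linarith
qed

section \<open>A priori bound on the scaled gradient\<close>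

text \<open>The increment of \<open>F\<close> over a step of length \<open>s\<close> is at most
  \<open>L * s\<close> at every time, so the penalty serves only to attain the maximum and its size
  \<open>\<epsilon>\<close> can be sent to zero. The constant \<open>C\<close>, quadratic in
  \<open>R\<close>, disappears with it, and a bound linear in \<open>R\<close> is left.\<close>

lemma scaled_gradient_step:
  fixes H :: "real^'n \<Rightarrow> real^'n \<Rightarrow> real"
  assumes \<alpha>: "0 < \<alpha>" and H: "hamiltonian_assms \<alpha> Co H" and Co: "1 \<le> Co" and lam: "0 < lam"
    and F: "coupling_assms \<alpha> Co L F" and L: "0 < L" and P1: "\<And>t. 0 \<le> t \<Longrightarrow> m t \<in> P1"
    and hjb: "HJB_solution lam F H u m"
    and R: "\<And>x t. 0 \<le> t \<Longrightarrow> norm (lam *\<^sub>R grad (\<lambda>y. u y t) x) \<le> R"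
    and t: "0 < t"
  shows "norm (lam *\<^sub>R grad (\<lambda>y. u y t) x) \<le> L + Co * (1 + R) / lam"
proof (rule norm_gradient_le)
  have u: "C21_on {0..} u" using hjb by (simp add: HJB_solution_def)
  have R0: "0 \<le> R" using R[of t x] t norm_ge_zero[of "lam *\<^sub>R grad (\<lambda>y. u y t) x"] by linarith
  show "0 \<le> L + Co * (1 + R) / lam" using L Co R0 lam by simp
  show "((\<lambda>x. lam * u x t) has_derivative (\<lambda>h. (lam *\<^sub>R grad (\<lambda>y. u y t) x) \<bullet> h)) (at x)"
    using has_grad_hess_scale[OF C21_on_slice(1)[OF u, of t], of lam] t by (simp add: has_grad_hess_def)
  fix e :: "real^'n" and s :: real assume e: "norm e = 1" and s: "0 < s"
  define C where "C = Co * (2 + (R + 1)\<^sup>2)"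
  have C: "0 \<le> C" using Co by (simp add: C_def)
  show "lam * u (x + s *\<^sub>R e) t - lam * u x t \<le> s * (L + Co * (1 + R) / lam)"
  proof (rule field_le_epsilon)
    fix \<eta> :: real assume \<eta>: "0 < \<eta>"
    \<comment> \<open>\<open>k\<close> is the total coefficient of \<open>\<epsilon>\<close> in the
      increment estimate with \<open>\<delta> = 1\<close>.\<close>
    define k where "k = (1 + CARD('n) + C) / lam + 1"
    have k: "0 < k" using C lam by (simp add: k_def add_pos_pos add_nonneg_pos)
    define \<epsilon> where "\<epsilon> = \<eta> / k"
    have \<epsilon>: "0 < \<epsilon>" using \<eta> k by (simp add: \<epsilon>_def)
    have "lam * (u (x + s *\<^sub>R e) t - u x t)
        \<le> L * s + (\<epsilon> + \<epsilon> * (CARD('n) / 1) + C * \<epsilon> + Co * (1 + R) * norm (s *\<^sub>R e)) / lam + \<epsilon> * 1"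
      unfolding C_def
    proof (rule increment_estimate[OF \<alpha> H Co lam hjb R t zero_less_one \<epsilon> \<epsilon>])
      fix y r assume r: "t \<le> r"
      have "F (y + s *\<^sub>R e) (m r) - F y (m r) \<le> L * (norm (y + s *\<^sub>R e - y) + d1 (m r) (m r))"
        using F P1[of r] r t unfolding coupling_assms_def by (smt (verit))
      also have "\<dots> \<le> L * s"
        using d1_self[OF P1[of r]] r t e s L by (intro mult_left_mono) auto
      also have "\<dots> \<le> L * s + \<epsilon> * (r - t) + \<epsilon> * soft_norm 1 (y - x)"
        using \<epsilon> r soft_norm_bounds(1)[of 1 "y - x"] by simp
      finally show "F (y + s *\<^sub>R e) (m r) - F y (m r) \<le> L * s + \<epsilon> * (r - t) + \<epsilon> * soft_norm 1 (y - x)" .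
    qed
    also have "\<dots> = s * (L + Co * (1 + R) / lam) + \<epsilon> * k"
      using lam s e by (simp add: k_def field_simps)
    finally show "lam * u (x + s *\<^sub>R e) t - lam * u x t \<le> s * (L + Co * (1 + R) / lam) + \<eta>"
      using k by (simp add: \<epsilon>_def right_diff_distrib)
  qed
qed

lemma grad_continuous_at_0:
  assumes "C21_on {0..} u"
  shows "((\<lambda>t. grad (\<lambda>y. u y t) x) \<longlongrightarrow> grad (\<lambda>y. u y 0) x) (at_right 0)"
proof -
  have c: "continuous_on (UNIV \<times> {0..}) (\<lambda>(x, t). grad (\<lambda>y. u y t) x)"
    using assms by (simp add: C21_on_def)
  have "continuous_on {0..} (\<lambda>t. (\<lambda>(x, t). grad (\<lambda>y. u y t) x) (x, t))"
    by (rule continuous_on_compose2[OF c]) (auto intro!: continuous_intros)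
  then have "((\<lambda>t. grad (\<lambda>y. u y t) x) \<longlongrightarrow> grad (\<lambda>y. u y 0) x) (at 0 within {0..})"
    by (simp add: continuous_on_def)
  then show ?thesis by (rule tendsto_within_subset) auto
qed

text \<open>Self-improvement of the supremum \<open>R\<close>: the step above gives
  \<open>R \<le> L + Co * (1 + R) / lam\<close>, and \<open>lam \<ge> 2 * Co\<close> bounds the last
  term by \<open>(1 + R) / 2\<close>. Absorbing \<open>R / 2\<close> into the left-hand side is
  legitimate because \<open>finite\<close> makes \<open>R\<close> a real number.\<close>

lemma scaled_gradient_bound:
  fixes H :: "real^'n \<Rightarrow> real^'n \<Rightarrow> real"
  assumes \<alpha>: "0 < \<alpha>" and H: "hamiltonian_assms \<alpha> Co H" and Co: "1 \<le> Co" and lam: "2 * Co \<le> lam"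
    and F: "coupling_assms \<alpha> Co L F" and L: "0 < L" and P1: "\<And>t. 0 \<le> t \<Longrightarrow> m t \<in> P1"
    and hjb: "HJB_solution lam F H u m"
    and finite: "sup_norm (\<lambda>x t. grad (\<lambda>y. u y t) x) < \<infinity>" and t: "0 \<le> t"
  shows "norm (lam *\<^sub>R grad (\<lambda>y. u y t) x) \<le> 2 * L + 1"
proof -
  have lam0: "0 < lam" using lam Co by linarith
  have u: "C21_on {0..} u" using hjb by (simp add: HJB_solution_def)
  define g where "g = (\<lambda>(x, t). norm (lam *\<^sub>R grad (\<lambda>y. u y t) x))"
  define N where "N = g ` (UNIV \<times> {0..})"
  define R where "R = Sup N"
  have N: "N \<noteq> {}" by (auto simp: N_def)
  have "bdd_above N"
  proof -
    obtain M where M: "sup_norm (\<lambda>x t. grad (\<lambda>y. u y t) x) \<le> ereal M"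
      using finite by (cases "sup_norm (\<lambda>x t. grad (\<lambda>y. u y t) x)") auto
    have "norm (grad (\<lambda>y. u y t) x) \<le> M" if "0 \<le> t" for x t
    proof -
      have "ereal (norm (grad (\<lambda>y. u y t) x)) \<le> sup_norm (\<lambda>x t. grad (\<lambda>y. u y t) x)"
        unfolding sup_norm_def using that by (intro SUP_upper2[of "(x, t)"]) auto
      from order_trans[OF this M] show ?thesis by simp
    qed
    then show ?thesis
      unfolding N_def g_def using lam0 by (intro bdd_aboveI[of _ "lam * M"]) auto
  qed
  then have R: "norm (lam *\<^sub>R grad (\<lambda>y. u y t) x) \<le> R" if "0 \<le> t" for x t
    unfolding R_def by (rule cSup_upper[rotated]) (use that in \<open>force simp: N_def g_def\<close>)
  define c where "c = L + Co * (1 + R) / lam"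
  have step: "norm (lam *\<^sub>R grad (\<lambda>y. u y t) x) \<le> c" if "0 < t" for x t
    unfolding c_def by (rule scaled_gradient_step[OF \<alpha> H Co lam0 F L P1 hjb R that])
  have "norm (lam *\<^sub>R grad (\<lambda>y. u y t) x) \<le> c" if "0 \<le> t" for x t
  proof (cases "t = 0")
    case True
    have "((\<lambda>t. norm (lam *\<^sub>R grad (\<lambda>y. u y t) x)) \<longlongrightarrow> norm (lam *\<^sub>R grad (\<lambda>y. u y 0) x)) (at_right 0)"
      by (intro tendsto_intros grad_continuous_at_0 u)
    moreover have "\<forall>\<^sub>F t in at_right 0. norm (lam *\<^sub>R grad (\<lambda>y. u y t) x) \<le> c"
      using eventually_at_right_less[of 0] by eventually_elim (rule step)
    ultimately show ?thesis unfolding True by (rule tendsto_upperbound) simp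
  qed (use that step in simp)
  then have Rc: "R \<le> c" unfolding R_def by (intro cSup_least N) (auto simp: N_def g_def)
  have R0: "0 \<le> R" using R[OF t, of x] norm_ge_zero order_trans by blast
  have "Co * (1 + R) / lam \<le> (1 + R) / 2"
    using mult_right_mono[OF lam, of "1 + R"] R0 lam0 by (simp add: field_simps)
  then have "c \<le> L + (1 + R) / 2" by (simp add: c_def)
  with Rc have "R \<le> L + (1 + R) / 2" by (rule order_trans)
  then have "R \<le> 2 * L + 1" by (simp add: field_simps)
  then show ?thesis using R[OF t, of x] by linarith
qed

text \<open>The scale \<open>\<delta> = 1 / sqrt lam\<close> balances the second-order term \<open>1 / (\<delta> * lam)\<close> against the
  oscillation \<open>\<delta>\<close> of the data at that scale.\<close>

lemma gradient_convergence_rate: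
  fixes H :: "real^'n \<Rightarrow> real^'n \<Rightarrow> real"
  assumes \<alpha>: "0 < \<alpha>" and Co: "1 \<le> Co" and L: "0 < L" and lam: "2 * Co \<le> lam"
    and std: "standing_assms \<alpha> Co L F H m0" and sol: "MFG_solution lam F H m0 u m" and t: "0 \<le> t"
  defines "C \<equiv> Co * (2 + (2 * L + 1 + 1)\<^sup>2)"
  shows "norm (lam *\<^sub>R grad (\<lambda>y. u y t) x - grad (\<lambda>y. F y (m t)) x)
    \<le> (5 * L + 2 * L * CARD('n) + 2 * L * C + Co * (2 * L + 2)) / sqrt lam"
proof -
  have H: "hamiltonian_assms \<alpha> Co H" and F: "coupling_assms \<alpha> Co L F"
    using std by (auto simp: standing_assms_def)
  have hjb: "HJB_solution lam F H u m" and fp: "FP_solution lam H m0 u m"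
    and fin: "sup_norm (\<lambda>x t. grad (\<lambda>y. u y t) x) < \<infinity>"
    using sol by (auto simp: MFG_solution_def)
  have u: "C21_on {0..} u" using hjb by (simp add: HJB_solution_def)
  have P1: "m t \<in> P1" if "0 \<le> t" for t using fp that by (simp add: FP_solution_def)
  have lam0: "0 < lam" "1 \<le> lam" using lam Co by linarith+
  define \<delta> where "\<delta> = 1 / sqrt lam"
  have \<delta>: "0 < \<delta>" "\<delta> * \<delta> = 1 / lam" "1 / \<delta> / lam = \<delta>" "1 / lam \<le> \<delta>"
  proof -
    have "sqrt lam \<le> lam" using lam0 by (intro real_le_lsqrt) (auto simp: power2_eq_square)
    then show "0 < \<delta>" "\<delta> * \<delta> = 1 / lam" "1 / \<delta> / lam = \<delta>" "1 / lam \<le> \<delta>"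
      using lam0 by (simp_all add: \<delta>_def real_div_sqrt field_simps)
  qed
  have R: "norm (lam *\<^sub>R grad (\<lambda>y. u y t) x) \<le> 2 * L + 1" if "0 \<le> t" for x t
    by (rule scaled_gradient_bound[OF \<alpha> H Co lam F L P1 hjb fin that])
  have C: "0 < C" using Co by (simp add: C_def add_pos_nonneg)
  define c where "c = (5 * L + 2 * L * CARD('n) + 2 * L * C + Co * (2 * L + 2)) / sqrt lam"
  have c0: "0 \<le> c" using L C Co lam0 by (simp add: c_def)
  have dF: "((\<lambda>y. F y \<mu>) has_derivative (\<lambda>h. grad (\<lambda>y. F y \<mu>) z \<bullet> h)) (at z)" if "\<mu> \<in> P1" for \<mu> z
    using F that by (intro grad_has_derivative) (auto simp: coupling_assms_def C2_holder_def)
  have gF: "norm (grad (\<lambda>z. F z \<mu>) x - grad (\<lambda>z. F z \<nu>) y) \<le> L * (norm (x - y) + d1 \<mu> \<nu>)"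
    if "\<mu> \<in> P1" "\<nu> \<in> P1" for x y \<mu> \<nu> using F that by (simp add: coupling_assms_def)
  have pos: "norm (lam *\<^sub>R grad (\<lambda>y. u y t0) x0 - grad (\<lambda>y. F y (m t0)) x0) \<le> c" if t0: "0 < t0" for x0 t0
  proof (rule norm_gradient_le[OF _ c0])
    show "((\<lambda>x. lam * u x t0 - F x (m t0)) has_derivative
        (\<lambda>h. (lam *\<^sub>R grad (\<lambda>y. u y t0) x0 - grad (\<lambda>y. F y (m t0)) x0) \<bullet> h)) (at x0)"
    proof -
      have "((\<lambda>x. lam * u x t0) has_derivative (\<lambda>h. (lam *\<^sub>R grad (\<lambda>y. u y t0) x0) \<bullet> h)) (at x0)"
        using has_grad_hess_scale[OF C21_on_slice(1)[OF u, of t0], of lam] t0 by (simp add: has_grad_hess_def)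
      from has_derivative_diff[OF this dF[OF P1[of t0], of x0]] t0 show ?thesis
        by (simp add: inner_diff_left)
    qed
    fix e :: "real^'n" and s :: real assume e: "norm e = 1" and s: "0 < s"
    define h where "h = s *\<^sub>R e"
    have h: "norm h = s" using e s by (simp add: h_def)
    \<comment> \<open>The speed of the flow in \<open>d1\<close>, up to the additive error
      \<open>4 * \<delta>\<close>, at the smoothing scale \<open>\<delta>\<close>.\<close>
    define K where "K = CARD('n) / \<delta> + C"
    have K: "0 < K" using C \<delta> by (simp add: K_def add_nonneg_pos)
    define f0 where "f0 = F (x0 + h) (m t0) - F x0 (m t0)"
    have "lam * (u (x0 + h) t0 - u x0 t0)
        \<le> (f0 + s * L * (4 * \<delta>)) + (s * L * K + s * L * (CARD('n) / \<delta>) + C * (s * L)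
            + Co * (1 + (2 * L + 1)) * norm h) / lam + s * L * \<delta>"
      unfolding C_def
    proof (rule increment_estimate[OF \<alpha> H Co lam0(1) hjb R t0 \<delta>(1)])
      show "0 < s * L * K" "0 < s * L" using s L K by auto
      fix y r assume r: "t0 \<le> r"
      have d: "d1 (m r) (m t0) \<le> K * (r - t0) + 4 * \<delta>"
        unfolding K_def C_def by (rule d1_time_estimate[OF \<alpha> H Co u fp R t0 r \<delta>(1)])
      let ?A = "L * (norm (y - x0) + d1 (m r) (m t0))"
      have mP: "m r \<in> P1" "m t0 \<in> P1" using P1 r t0 by auto
      \<comment> \<open>A second-order difference: the increment by \<open>h\<close> is compared at
        \<open>(y, m r)\<close> and at \<open>(x0, m t0)\<close>. The Lipschitz bound on the
        gradient of \<open>F\<close> makes the difference proportional to \<open>norm h\<close>,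
        which division by the step length requires.\<close>
      have "\<bar>(F (y + h) (m r) - F (x0 + h) (m t0)) - (F (y + 0) (m r) - F (x0 + 0) (m t0))\<bar> \<le> ?A * norm (h - 0)"
      proof (rule lipschitz_of_gradient_bound[where f = "\<lambda>z. F (y + z) (m r) - F (x0 + z) (m t0)"])
        fix z
        have sh: "((\<lambda>z. x + z) has_derivative (\<lambda>k. k)) (at z)" for x :: "real^'n"
          by (auto intro!: derivative_eq_intros)
        show "((\<lambda>z. F (y + z) (m r) - F (x0 + z) (m t0)) has_derivative
          (\<lambda>k. (grad (\<lambda>y. F y (m r)) (y + z) - grad (\<lambda>y. F y (m t0)) (x0 + z)) \<bullet> k)) (at z)"
          unfolding inner_diff_left
          by (intro has_derivative_diff has_derivative_compose[OF sh dF] mP)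
        show "norm (grad (\<lambda>y. F y (m r)) (y + z) - grad (\<lambda>y. F y (m t0)) (x0 + z)) \<le> ?A"
          using gF[OF mP, of "y + z" "x0 + z"] by simp
      qed
      then have "F (y + h) (m r) - F y (m r) \<le> f0 + ?A * s"
        using h by (simp add: f0_def abs_le_iff)
      also have "?A * s \<le> L * (soft_norm \<delta> (y - x0) + (K * (r - t0) + 4 * \<delta>)) * s"
        using L s d soft_norm_bounds(2)[OF \<delta>(1), of "y - x0"]
        by (intro mult_right_mono mult_left_mono add_mono) auto
      finally show "F (y + h) (m r) - F y (m r)
          \<le> (f0 + s * L * (4 * \<delta>)) + s * L * K * (r - t0) + s * L * soft_norm \<delta> (y - x0)"
        by (simp add: algebra_simps)
    qed
    \<comment> \<open>In \<open>5 * L * \<delta>\<close>, four parts come from the additive error in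
      \<open>d1\<close> and one from the tip of the soft cone. The dimension enters once through
      \<open>K\<close> and once through the Laplacian of the barrier; \<open>C\<close> enters once
      through \<open>K\<close> and once through the Hamiltonian.\<close>
    also have "\<dots> = f0 + s * (5 * L * \<delta> + 2 * L * CARD('n) * (1 / \<delta> / lam)
        + (2 * L * C + Co * (2 * L + 2)) * (1 / lam))"
      using lam0 \<delta>(1) by (simp add: K_def h field_simps)
    also have "\<dots> \<le> f0 + s * (5 * L * \<delta> + 2 * L * CARD('n) * \<delta> + (2 * L * C + Co * (2 * L + 2)) * \<delta>)"
      using s L C Co \<delta>(4) unfolding \<delta>(3)
      by (intro add_left_mono mult_left_mono) auto
    also have "\<dots> = f0 + s * c" by (simp add: c_def \<delta>_def algebra_simps add_divide_distrib)
    finally show "lam * u (x0 + s *\<^sub>R e) t0 - F (x0 + s *\<^sub>R e) (m t0) - (lam * u x0 t0 - F x0 (m t0)) \<le> s * c"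
      by (simp add: f0_def h_def right_diff_distrib)
  qed
  show ?thesis
  proof (cases "t = 0")
    \<comment> \<open>The estimate of \<open>d1\<close> needs a positive starting time. At
      \<open>t = 0\<close> the bound follows by continuity of the gradient of \<open>u\<close> and
      of \<open>m\<close> in \<open>d1\<close>.\<close>
    case True
    have "((\<lambda>s. d1 (m s) (m 0)) \<longlongrightarrow> 0) (at 0 within {0..})"
      using fp unfolding FP_solution_def by blast
    then have d: "((\<lambda>s. d1 (m s) (m 0)) \<longlongrightarrow> 0) (at_right 0)"
      by (rule tendsto_within_subset) auto
    have "((\<lambda>s. grad (\<lambda>y. F y (m s)) x) \<longlongrightarrow> grad (\<lambda>y. F y (m 0)) x) (at_right 0)"
    proof (rule LIM_zero_cancel, rule Lim_null_comparison)
      show "\<forall>\<^sub>F s in at_right 0. norm (grad (\<lambda>y. F y (m s)) x - grad (\<lambda>y. F y (m 0)) x) \<le> L * d1 (m s) (m 0)"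
        using eventually_at_right_less[of 0]
      proof eventually_elim
        case (elim s)
        then show ?case using gF[OF P1[of s] P1[of 0], of x x] by simp
      qed
      show "((\<lambda>s. L * d1 (m s) (m 0)) \<longlongrightarrow> 0) (at_right 0)"
        using tendsto_mult_left[OF d, of L] by simp
    qed
    then have "((\<lambda>s. norm (lam *\<^sub>R grad (\<lambda>y. u y s) x - grad (\<lambda>y. F y (m s)) x)) \<longlongrightarrow>
        norm (lam *\<^sub>R grad (\<lambda>y. u y 0) x - grad (\<lambda>y. F y (m 0)) x)) (at_right 0)"
      by (intro tendsto_norm tendsto_diff tendsto_scaleR tendsto_const grad_continuous_at_0[OF u])
    moreover have "\<forall>\<^sub>F s in at_right 0. norm (lam *\<^sub>R grad (\<lambda>y. u y s) x - grad (\<lambda>y. F y (m s)) x) \<le> c"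
      using eventually_at_right_less[of 0] by eventually_elim (rule pos)
    ultimately have "norm (lam *\<^sub>R grad (\<lambda>y. u y 0) x - grad (\<lambda>y. F y (m 0)) x) \<le> c"
      by (rule tendsto_upperbound) simp
    then show ?thesis by (simp add: True c_def)
  next
    case False
    then show ?thesis using pos[of t x] t by (simp add: c_def)
  qed
qed

theorem proposition3p1:
  fixes Co L :: real
  assumes "Co \<ge> 1" and "L > 0"
  shows "\<exists>Cbar>0. \<exists>lam0\<ge>1.
    \<forall>\<alpha> (F :: real^'n \<Rightarrow> (real^'n) measure \<Rightarrow> real) (H :: real^'n \<Rightarrow> real^'n \<Rightarrow> real) m0.
      0 < \<alpha> \<longrightarrow> \<alpha> < 1 \<longrightarrow> standing_assms \<alpha> Co L F H m0 \<longrightarrow>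
      (\<forall>lam\<ge>lam0. \<forall>u m. MFG_solution lam F H m0 u m \<longrightarrow>
         sup_norm (\<lambda>x t. lam *\<^sub>R grad (\<lambda>y. u y t) x - grad (\<lambda>y. F y (m t)) x)
           \<le> ereal (Cbar / sqrt lam * (L + 1))) \<and>
      (\<forall>u m. (\<forall>\<^sub>F lam in at_top. MFG_solution lam F H m0 (u lam) (m lam)) \<longrightarrow>
         uniform_limit (UNIV \<times> {0..})
           (\<lambda>lam (x, t). lam *\<^sub>R grad (\<lambda>y. u lam y t) x - grad (\<lambda>y. F y (m lam t)) x)
           (\<lambda>_. 0) at_top)"
proof -
  define C where "C = Co * (2 + (2 * L + 1 + 1)\<^sup>2)"
  \<comment> \<open>The constant of the rate, with \<open>C\<close> the bound on
    \<open>D_p H\<close> in the ball of radius \<open>2 * L + 1\<close>. The term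
    \<open>CARD('n)\<close> stems from the Laplacian of the soft cones.\<close>
  define Cbar where "Cbar = 5 * L + 2 * L * CARD('n) + 2 * L * C + Co * (2 * L + 2)"
  have Cbar: "0 < Cbar" using assms by (simp add: Cbar_def C_def add_pos_nonneg add_nonneg_pos)
  show ?thesis
  \<comment> \<open>The threshold \<open>2 * Co\<close> is the one that closes the a priori gradient
    bound.\<close>
  proof (rule exI[of _ Cbar], intro conjI Cbar, rule exI[of _ "2 * Co"], intro conjI allI impI)
    show "1 \<le> 2 * Co" using assms by simp
    fix \<alpha> and F :: "real^'n \<Rightarrow> (real^'n) measure \<Rightarrow> real" and H :: "real^'n \<Rightarrow> real^'n \<Rightarrow> real" and m0
    assume \<alpha>: "0 < \<alpha>" "\<alpha> < 1" and std: "standing_assms \<alpha> Co L F H m0"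
    have rate: "norm (lam *\<^sub>R grad (\<lambda>y. u y t) x - grad (\<lambda>y. F y (m t)) x) \<le> Cbar / sqrt lam"
      if "2 * Co \<le> lam" "MFG_solution lam F H m0 u m" "0 \<le> t" for lam u m x t
      unfolding Cbar_def C_def by (rule gradient_convergence_rate[OF \<alpha>(1) assms that(1) std that(2,3)])
    {
      fix lam u m assume lam: "2 * Co \<le> lam" and sol: "MFG_solution lam F H m0 u m"
      have "Cbar / sqrt lam * 1 \<le> Cbar / sqrt lam * (L + 1)"
        using Cbar lam assms by (intro mult_left_mono) auto
      then have "norm (lam *\<^sub>R grad (\<lambda>y. u y t) x - grad (\<lambda>y. F y (m t)) x) \<le> Cbar / sqrt lam * (L + 1)"
        if "0 \<le> t" for x t using rate[OF lam sol that, of x] by linarith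
      then show "sup_norm (\<lambda>x t. lam *\<^sub>R grad (\<lambda>y. u y t) x - grad (\<lambda>y. F y (m t)) x)
           \<le> ereal (Cbar / sqrt lam * (L + 1))"
        unfolding sup_norm_def by (intro SUP_least) auto
    }
    {
      fix u m assume sol: "\<forall>\<^sub>F lam in at_top. MFG_solution lam F H m0 (u lam) (m lam)"
      have "((\<lambda>lam. Cbar / sqrt lam) \<longlongrightarrow> 0) at_top"
        by (rule tendsto_divide_0[OF tendsto_const filterlim_at_top_imp_at_infinity[OF sqrt_at_top]])
      show "uniform_limit (UNIV \<times> {0..})
           (\<lambda>lam (x, t). lam *\<^sub>R grad (\<lambda>y. u lam y t) x - grad (\<lambda>y. F y (m lam t)) x) (\<lambda>_. 0) at_top"
      proof (rule uniform_limitI)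
        fix \<epsilon> :: real assume "0 < \<epsilon>"
        with \<open>((\<lambda>lam. Cbar / sqrt lam) \<longlongrightarrow> 0) at_top\<close> have "\<forall>\<^sub>F lam in at_top. Cbar / sqrt lam < \<epsilon>"
          by (rule order_tendstoD(2))
        then show "\<forall>\<^sub>F lam in at_top. \<forall>z\<in>UNIV \<times> {0..}.
            dist (case z of (x, t) \<Rightarrow> lam *\<^sub>R grad (\<lambda>y. u lam y t) x - grad (\<lambda>y. F y (m lam t)) x) 0 < \<epsilon>"
          using sol eventually_ge_at_top[of "2 * Co"]
        proof eventually_elim
          case (elim lam)
          then show ?case using rate[OF elim(3,2)] by (auto intro: le_less_trans)
        qed
      qed
    }
  qed
qed

end
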